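(* For any $\mu\in\mathcal M_{\mathrm{inv}}$, the joint distribution of the array $(R^\infty_{l,l'})_{l,l'\ge1}$, $$R^\infty_{l,l'}=\mathbb E_v\,\bar\sigma(w,u_l,v)\,\bar\sigma(w,u_{l'},v),\qquad \bar\sigma=\bar\sigma_\mu,$$ uniquely determines $\mu$ (i.e. two elements of $\mathcal M_{\mathrm{inv}}$ with the same joint distribution of this array coincide), and thus it determines the joint distribution of all multi-overlaps $$R^\infty_{l_1,\dots,l_n}=\mathbb E_v\,\bar\sigma(w,u_{l_1},v)\cdots\bar\sigma(w,u_{l_n},v),\qquad n\ge1,\ l_1,\dots,l_n\ge1.$$
   Context: Let $(\beta_p)$ be indexed by $p=1$ and even $p\ge2$ with $\sum_p2^p\beta_p^2<\infty$; $\xi(x)=\sum_p\beta_p^2x^p$ and $\theta(x)=x\xi'(x)-\xi(x)$ (mixed $p$-spin Sherrington–Kirkpatrick model). Let $w,(u_l)_{l\ge1},u,(v_i)_{i\ge1},(x_{i,l})$ be i.i.d. uniform on $[0,1]$; $\mathbb E_v$ is expectation in $v$ uniform on $[0,1]$ only. For measurable $\sigma_\mu:[0,1]^4\to\{-1,+1\}$ let $\mu$ be the distribution of the array $s_i^l=\sigma_\mu(w,u_l,v_i,x_{i,l})$, $i,l\ge1$, and $\bar\sigma_\mu(w,u,v)=\int_0^1\sigma_\mu(w,u,v,x)\,dx$. Gaussian processes. For measurable $\bar\sigma:[0,1]^3\to[-1,1]$ and $w\in[0,1]$ let $g_{\xi'}(\bar\sigma(w,u,\cdot))$ and $g_\theta(\bar\sigma(w,u,\cdot))$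 be independent centered Gaussian processes indexed by the functions $v\mapsto\bar\sigma(w,u,v)$, $u\in[0,1]$, with covariances $\xi'(\mathbb E_v\bar\sigma(w,u,v)\bar\sigma(w,u',v))$ and $\theta(\mathbb E_v\bar\sigma(w,u,v)\bar\sigma(w,u',v))$. With independent standard Gaussian $z,z'$ let $$G_{\xi'}(\bar\sigma(w,u,\cdot))=g_{\xi'}(\bar\sigma(w,u,\cdot))+z\big(\xi'(1)-\xi'(\mathbb E_v\bar\sigma(w,u,v)^2)\big)^{1/2},$$ $$G_{\theta}(\bar\sigma(w,u,\cdot))=g_{\theta}(\bar\sigma(w,u,\cdot))+z'\big(\theta(1)-\theta(\mathbb E_v\bar\sigma(w,u,v)^2)\big)^{1/2},$$ and let $G_{\xi',i},G_{\theta,i}$ be independent copies (including independent copies of $z,z'$), independent of $w,u,(v_i)$. Put $\bar\sigma_i=\bar\sigma(w,u,v_i)$. $\mathbb E'$ is the expectation in $u$ and all copies of $z,z'$ only; $\mathbb E$ is expectation over all randomness. The family $\mathcal M_{\mathrm{inv}}$: the set of distributions $\mu$ of arrays $(s_i^l)_{i,l\ge1}$, $s_i^l=\sigma_\mu(w,u_l,v_i,x_{i,l})$, generated by measurable $\sigma_\mu:[0,1]^4\to\{-1,+1\}$ such that $\bar\sigma=\bar\sigma_\mu$ satisfies, for all integers $n,r\ge0$, $m,q\ge1$ with $n\le m$ and all $C_1,\dots,C_q\subseteq\{1,\dots,m\}$, $$\mathbb E\prod_{l\le q}\mathbb E'\prod_{i\in C_l}\bar\sigma_i=\mathbb E\frac{\prod_{l\le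 q}U_l}{V^q},$$ where $\mathcal E_{n,r}=\exp\big(\sum_{i\le n}\log\cosh G_{\xi',i}(\bar\sigma(w,u,\cdot))+\sum_{k\le r}G_{\theta,k}(\bar\sigma(w,u,\cdot))\big)$, $V=\mathbb E'\mathcal E_{n,r}$ and $U_l=\mathbb E'\prod_{i\in C_l,\,i\le n}\tanh G_{\xi',i}(\bar\sigma(w,u,\cdot))\prod_{i\in C_l,\,i>n}\bar\sigma_i\,\mathcal E_{n,r}$. *)

theory Defs
  imports "HOL-Probability.Probability"
begin

text \<open>All sequences and arrays are indexed by \<open>nat\<close>, starting at \<open>0\<close>: site \<open>i \<ge> 1\<close> of the
  usual convention is site \<open>i - 1\<close> here, so \<open>i \<le> n\<close> reads \<open>i < n\<close> and \<open>{1..m}\<close> reads \<open>{..<m}\<close>.\<close>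

subsection \<open>The mixed \<open>p\<close>-spin covariance\<close>

definition spin_degrees :: "nat set" where
  "spin_degrees = {p. p = 1 \<or> (even p \<and> 2 \<le> p)}"

definition xi :: "(nat \<Rightarrow> real) \<Rightarrow> real \<Rightarrow> real" where
  "xi \<beta> x = (\<Sum>\<^sub>\<infinity>p\<in>spin_degrees. (\<beta> p)\<^sup>2 * x ^ p)"

definition theta :: "(nat \<Rightarrow> real) \<Rightarrow> real \<Rightarrow> real" where
  "theta \<beta> x = x * deriv (xi \<beta>) x - xi \<beta> x"

subsection \<open>Spin functions and the arrays they generate\<close>

definition I01 :: "real measure" where
  "I01 = restrict_space lborel {0..1}"

type_synonym spin_fun = "real \<Rightarrow> real \<Rightarrow> real \<Rightarrow> real \<Rightarrow> real"

definition spin_function :: "spin_fun \<Rightarrow> bool" where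
  "spin_function \<sigma> \<longleftrightarrow>
     (\<lambda>(w, u, v, x). \<sigma> w u v x)
       \<in> measurable (I01 \<Otimes>\<^sub>M I01 \<Otimes>\<^sub>M I01 \<Otimes>\<^sub>M I01) (count_space {-1, 1})"

text \<open>The entry of the array at \<open>(i, l)\<close> is the spin at site \<open>i\<close> in replica \<open>l\<close>.\<close>

definition spin_law :: "spin_fun \<Rightarrow> (nat \<times> nat \<Rightarrow> real) measure" where
  "spin_law \<sigma> =
     distr (I01 \<Otimes>\<^sub>M PiM (UNIV :: nat set) (\<lambda>_. I01) \<Otimes>\<^sub>M PiM (UNIV :: nat set) (\<lambda>_. I01)
              \<Otimes>\<^sub>M PiM (UNIV :: (nat \<times> nat) set) (\<lambda>_. I01))
       (PiM UNIV (\<lambda>_. borel))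
       (\<lambda>(w, u, v, x) (i, l). \<sigma> w (u l) (v i) (x (i, l)))"

definition generates :: "spin_fun \<Rightarrow> (nat \<times> nat \<Rightarrow> real) measure \<Rightarrow> bool" where
  "generates \<sigma> \<mu> \<longleftrightarrow> spin_function \<sigma> \<and> \<mu> = spin_law \<sigma>"

definition mag :: "spin_fun \<Rightarrow> real \<Rightarrow> real \<Rightarrow> real \<Rightarrow> real" where
  "mag \<sigma> w u v = (\<integral>x. \<sigma> w u v x \<partial>I01)"

definition overlap :: "spin_fun \<Rightarrow> real \<Rightarrow> real \<Rightarrow> real \<Rightarrow> real" where
  "overlap \<sigma> w u u' = (\<integral>v. mag \<sigma> w u v * mag \<sigma> w u' v \<partial>I01)"

definition overlap_law :: "spin_fun \<Rightarrow> (nat \<times> nat \<Rightarrow> real) measure" where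
  "overlap_law \<sigma> =
     distr (I01 \<Otimes>\<^sub>M PiM (UNIV :: nat set) (\<lambda>_. I01)) (PiM UNIV (\<lambda>_. borel))
       (\<lambda>(w, u) (l, l'). overlap \<sigma> w (u l) (u l'))"

text \<open>The multi-overlaps are indexed by the nonempty lists \<open>[l\<^sub>1, \<dots>, l\<^sub>n]\<close> of replica indices,
  repetitions allowed.\<close>

definition multi_overlap :: "spin_fun \<Rightarrow> real \<Rightarrow> (nat \<Rightarrow> real) \<Rightarrow> nat list \<Rightarrow> real" where
  "multi_overlap \<sigma> w u ls = (\<integral>v. (\<Prod>l\<leftarrow>ls. mag \<sigma> w (u l) v) \<partial>I01)"

definition multi_overlap_law :: "spin_fun \<Rightarrow> (nat list \<Rightarrow> real) measure" where
  "multi_overlap_law \<sigma> =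
     distr (I01 \<Otimes>\<^sub>M PiM (UNIV :: nat set) (\<lambda>_. I01)) (PiM {ls. ls \<noteq> []} (\<lambda>_. borel))
       (\<lambda>(w, u). \<lambda>ls\<in>{ls. ls \<noteq> []}. multi_overlap \<sigma> w u ls)"

subsection \<open>Gaussian processes\<close>

abbreviation std_gauss :: "real measure" where
  "std_gauss \<equiv> density lborel std_normal_density"

text \<open>A centered Gaussian law is the law of a multiple of a standard Gaussian; the multiple \<open>0\<close>
  covers the degenerate case.\<close>

definition centered_gaussian_process ::
  "'a measure \<Rightarrow> 't set \<Rightarrow> ('t \<Rightarrow> 'a \<Rightarrow> real) \<Rightarrow> ('t \<Rightarrow> 't \<Rightarrow> real) \<Rightarrow> bool" where
  "centered_gaussian_process M T X K \<longleftrightarrow>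
     (\<forall>t\<in>T. X t \<in> borel_measurable M) \<and>
     (\<forall>F a. finite F \<longrightarrow> F \<subseteq> T \<longrightarrow>
        (\<exists>s. distr M borel (\<lambda>\<omega>. \<Sum>t\<in>F. a t * X t \<omega>) = distr std_gauss borel (\<lambda>x. s * x))) \<and>
     (\<forall>t\<in>T. \<forall>t'\<in>T. (\<integral>\<omega>. X t \<omega> * X t' \<omega> \<partial>M) = K t t')"

text \<open>A realization on a probability space \<open>\<Omega>\<close> of all the copies of the Gaussian processes:
  \<open>g (Inl i)\<close> is copy \<open>i\<close> of the process with covariance \<open>\<xi>'\<close>, and \<open>g (Inr k)\<close> is copy \<open>k\<close> of the
  one with covariance \<open>\<theta>\<close>. For fixed \<open>w\<close> the process indexed by the functions \<open>\<sigma>(w,u,\<cdot>)\<close> (averaged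
  over \<open>x\<close>) is written as a process in \<open>u \<in> [0,1]\<close>; its covariance depends on \<open>u\<close> only through
  that function, so equal functions receive almost surely equal values. Joint measurability
  is what makes expectations in \<open>u\<close> for a fixed outcome \<open>\<omega>\<close> meaningful.\<close>

definition gaussian_fields ::
  "(nat \<Rightarrow> real) \<Rightarrow> spin_fun \<Rightarrow> 'a measure \<Rightarrow> (nat + nat \<Rightarrow> real \<Rightarrow> real \<Rightarrow> 'a \<Rightarrow> real) \<Rightarrow> bool" where
  "gaussian_fields \<beta> \<sigma> \<Omega> g \<longleftrightarrow>
     prob_space \<Omega> \<and>
     (\<forall>j. (\<lambda>(w, u, \<omega>). g j w u \<omega>) \<in> borel_measurable (I01 \<Otimes>\<^sub>M I01 \<Otimes>\<^sub>M \<Omega>)) \<and>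
     (\<forall>w\<in>{0..1}.
        (\<forall>i. centered_gaussian_process \<Omega> {0..1} (g (Inl i) w)
               (\<lambda>u u'. deriv (xi \<beta>) (overlap \<sigma> w u u'))) \<and>
        (\<forall>k. centered_gaussian_process \<Omega> {0..1} (g (Inr k) w)
               (\<lambda>u u'. theta \<beta> (overlap \<sigma> w u u'))) \<and>
        prob_space.indep_vars \<Omega> (\<lambda>_. PiM {0..1} (\<lambda>_. borel))
          (\<lambda>j \<omega>. \<lambda>u\<in>{0..1}. g j w u \<omega>) UNIV)"

definition G_xi ::
  "(nat \<Rightarrow> real) \<Rightarrow> spin_fun \<Rightarrow> (nat + nat \<Rightarrow> real \<Rightarrow> real \<Rightarrow> 'a \<Rightarrow> real)
     \<Rightarrow> nat \<Rightarrow> real \<Rightarrow> real \<Rightarrow> 'a \<Rightarrow> (nat \<Rightarrow> real) \<Rightarrow> real" where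
  "G_xi \<beta> \<sigma> g i w u \<omega> z =
     g (Inl i) w u \<omega> + z i * sqrt (deriv (xi \<beta>) 1 - deriv (xi \<beta>) (overlap \<sigma> w u u))"

definition G_theta ::
  "(nat \<Rightarrow> real) \<Rightarrow> spin_fun \<Rightarrow> (nat + nat \<Rightarrow> real \<Rightarrow> real \<Rightarrow> 'a \<Rightarrow> real)
     \<Rightarrow> nat \<Rightarrow> real \<Rightarrow> real \<Rightarrow> 'a \<Rightarrow> (nat \<Rightarrow> real) \<Rightarrow> real" where
  "G_theta \<beta> \<sigma> g k w u \<omega> z' =
     g (Inr k) w u \<omega> + z' k * sqrt (theta \<beta> 1 - theta \<beta> (overlap \<sigma> w u u))"

subsection \<open>The invariance equations\<close>

text \<open>Expectation in \<open>u\<close> and in all copies of the standard Gaussians \<open>z\<close>, \<open>z'\<close>.\<close>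

definition E_prime :: "(real \<Rightarrow> (nat \<Rightarrow> real) \<Rightarrow> (nat \<Rightarrow> real) \<Rightarrow> real) \<Rightarrow> real" where
  "E_prime F = (\<integral>(u, z, z'). F u z z'
     \<partial>(I01 \<Otimes>\<^sub>M PiM (UNIV :: nat set) (\<lambda>_. std_gauss) \<Otimes>\<^sub>M PiM (UNIV :: nat set) (\<lambda>_. std_gauss)))"

text \<open>Expectation in the remaining randomness: \<open>w\<close>, all \<open>v\<^sub>i\<close>, and the Gaussian processes.\<close>

definition E_outer :: "'a measure \<Rightarrow> (real \<Rightarrow> (nat \<Rightarrow> real) \<Rightarrow> 'a \<Rightarrow> real) \<Rightarrow> real" where
  "E_outer \<Omega> F = (\<integral>(w, v, \<omega>). F w v \<omega> \<partial>(I01 \<Otimes>\<^sub>M PiM (UNIV :: nat set) (\<lambda>_. I01) \<Otimes>\<^sub>M \<Omega>))"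

definition cavity_weight ::
  "(nat \<Rightarrow> real) \<Rightarrow> spin_fun \<Rightarrow> (nat + nat \<Rightarrow> real \<Rightarrow> real \<Rightarrow> 'a \<Rightarrow> real) \<Rightarrow> nat \<Rightarrow> nat
     \<Rightarrow> real \<Rightarrow> real \<Rightarrow> 'a \<Rightarrow> (nat \<Rightarrow> real) \<Rightarrow> (nat \<Rightarrow> real) \<Rightarrow> real" where
  "cavity_weight \<beta> \<sigma> g n r w u \<omega> z z' =
     exp ((\<Sum>i<n. ln (cosh (G_xi \<beta> \<sigma> g i w u \<omega> z))) + (\<Sum>k<r. G_theta \<beta> \<sigma> g k w u \<omega> z'))"

definition cavity_V ::
  "(nat \<Rightarrow> real) \<Rightarrow> spin_fun \<Rightarrow> (nat + nat \<Rightarrow> real \<Rightarrow> real \<Rightarrow> 'a \<Rightarrow> real) \<Rightarrow> nat \<Rightarrow> nat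
     \<Rightarrow> real \<Rightarrow> 'a \<Rightarrow> real" where
  "cavity_V \<beta> \<sigma> g n r w \<omega> = E_prime (\<lambda>u z z'. cavity_weight \<beta> \<sigma> g n r w u \<omega> z z')"

definition cavity_U ::
  "(nat \<Rightarrow> real) \<Rightarrow> spin_fun \<Rightarrow> (nat + nat \<Rightarrow> real \<Rightarrow> real \<Rightarrow> 'a \<Rightarrow> real) \<Rightarrow> nat \<Rightarrow> nat
     \<Rightarrow> nat set \<Rightarrow> real \<Rightarrow> (nat \<Rightarrow> real) \<Rightarrow> 'a \<Rightarrow> real" where
  "cavity_U \<beta> \<sigma> g n r C w v \<omega> = E_prime (\<lambda>u z z'.
     (\<Prod>i\<in>{i \<in> C. i < n}. tanh (G_xi \<beta> \<sigma> g i w u \<omega> z)) *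
     (\<Prod>i\<in>{i \<in> C. i \<ge> n}. mag \<sigma> w u (v i)) *
     cavity_weight \<beta> \<sigma> g n r w u \<omega> z z')"

text \<open>Both sides of the equations depend on the Gaussian processes only through their laws, hence
  not on the realization, and these laws (countably many independent Gaussian variables
  suffice to construct them) can be realized on the product space of real sequences.\<close>

definition cavity_invariant :: "(nat \<Rightarrow> real) \<Rightarrow> spin_fun \<Rightarrow> bool" where
  "cavity_invariant \<beta> \<sigma> \<longleftrightarrow>
     (\<exists>(\<Omega> :: (nat \<Rightarrow> real) measure) g. gaussian_fields \<beta> \<sigma> \<Omega> g \<and>
        (\<forall>n r m q (C :: nat \<Rightarrow> nat set).
           1 \<le> m \<longrightarrow> 1 \<le> q \<longrightarrow> n \<le> m \<longrightarrow> (\<forall>l<q. C l \<subseteq> {..<m}) \<longrightarrow>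
           E_outer \<Omega> (\<lambda>w v \<omega>. \<Prod>l<q. E_prime (\<lambda>u z z'. \<Prod>i\<in>C l. mag \<sigma> w u (v i))) =
           E_outer \<Omega> (\<lambda>w v \<omega>.
             (\<Prod>l<q. cavity_U \<beta> \<sigma> g n r (C l) w v \<omega>) / cavity_V \<beta> \<sigma> g n r w \<omega> ^ q)))"

definition M_inv :: "(nat \<Rightarrow> real) \<Rightarrow> (nat \<times> nat \<Rightarrow> real) measure set" where
  "M_inv \<beta> = {\<mu>. \<exists>\<sigma>. generates \<sigma> \<mu> \<and> cavity_invariant \<beta> \<sigma>}"

end

theory Submission
  imports Defs
begin

text \<open>With \<open>n = m\<close> and \<open>r = 0\<close> the left-hand sides of the invariance equations are all the joint moments
  of the spins, while the right-hand sides involve only Gaussian processes, whose law given \<open>w\<close> and the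
  \<open>u\<^sub>l\<close> is a function of the overlap array. Expectations in \<open>u, z\<close> of bounded functions are unfolded into
  replicas, so the joint law of the (truncated) numerators and denominators depends only on the law of
  the overlaps; letting the truncation go to infinity gives the right-hand sides themselves.

  The spin function that generates \<open>\<mu>\<close> need not be the one satisfying the equations, so one also needs that
  \<open>\<mu>\<close> determines the law of all overlaps, those with repeated replica indices included. These
  are not moments of the array, which contains each \<open>\<sigma>(w, u\<^sub>l, v\<^sub>i, \<cdot>)\<close> only once. But for fixed \<open>w\<close> the
  magnetization is the kernel of an operator \<open>F\<close> with \<open>0 \<le> F F\<^sup>* \<le> 1\<close>, and \<open>(1 - F F\<^sup>*)\<^sup>n F \<rightarrow> 0\<close> weakly; so one
  factor in a moment can be replaced by combinations of \<open>(F F\<^sup>*)\<^sup>k F\<close> with \<open>k \<ge> 1\<close>, whose kernels are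
  themselves integrals of products of the magnetization over fresh coordinates.\<close>

section \<open>Bounded families are determined by their moments\<close>

text \<open>Neither the Gaussian fields nor the cavity weights are bounded, and the moment method
  used here is for bounded families. So every comparison of laws is brought down to one statement
  about families with values in [-1, 1]: Gaussian fields enter it through sin (x / n), from which x
  is recovered as a limit, and the weights through truncation, which a measurable limit functional
  undoes.

  The weak limit comes from an energy estimate. Let F be the operator of the kernel, x_0 an
  indicator and x_{k+1} = x_k - F* F x_k. As F is a contraction, |x_{k+1}|^2 + |F x_k|^2 <= |x_k|^2
  in squared norms, so the |F x_k|^2 are summable and F x_k tends to 0. A weak limit is enough: with
  all coordinates frozen except the two endpoints of the peeled edge, the other edges form a bounded
  test function of these endpoints.

  Repeated edges arise from multi-overlaps with a repeated replica index: a self-overlap contains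
  the square of a magnetization, whereas the square of a spin is 1.\<close>

lemma halfline_polynomial_approx_single:
  fixes a :: real
  obtains c :: "nat \<Rightarrow> nat \<Rightarrow> real" and d :: "nat \<Rightarrow> nat"
  where "\<And>n x. \<bar>x\<bar> \<le> 1 \<Longrightarrow> \<bar>\<Sum>i\<le>d n. c n i * x ^ i\<bar> \<le> 2"
    and "\<And>x. \<bar>x\<bar> \<le> 1 \<Longrightarrow> (\<lambda>n. \<Sum>i\<le>d n. c n i * x ^ i) \<longlonglongrightarrow> indicator {..a} x"
proof -
  \<comment> \<open>A ramp that equals 1 up to \<open>a\<close> and 0 from
    \<open>a + 1 / Suc n\<close> on. It has the value 1 at \<open>a\<close> itself, so its pointwise
    limit is the indicator of the closed half-line. A polynomial within \<open>1 / Suc n\<close> of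
    the ramp has the same limit and is bounded by 2.\<close>
  define r where "r = (\<lambda>(n::nat) x. max 0 (min 1 (1 - real (Suc n) * (x - a))))"
  have "\<exists>c d. \<forall>x\<in>{-1..1}. \<bar>r n x - (\<Sum>i\<le>d. c i * x ^ i)\<bar> < 1 / real (Suc n)" for n
  proof -
    have "continuous_on {-1..1::real} (r n)"
      unfolding r_def by (intro continuous_intros)
    then obtain g where g: "real_polynomial_function g" "\<And>x. x \<in> {-1..1} \<Longrightarrow> \<bar>r n x - g x\<bar> < 1 / real (Suc n)"
      using Stone_Weierstrass_real_polynomial_function[of "{-1..1::real}" "r n" "1 / real (Suc n)"] by auto
    then obtain c d where "g = (\<lambda>x. \<Sum>i\<le>d. c i * x ^ i)" by (auto simp: real_polynomial_function_iff_sum)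
    with g show ?thesis by (intro exI[of _ c] exI[of _ d]) auto
  qed
  then obtain c d where cd: "\<And>n x. x \<in> {-1..1} \<Longrightarrow> \<bar>r n x - (\<Sum>i\<le>d n. c n i * x ^ i)\<bar> < 1 / real (Suc n)"
    by metis
  show thesis
  proof
    fix n and x :: real assume "\<bar>x\<bar> \<le> 1"
    then have "\<bar>r n x - (\<Sum>i\<le>d n. c n i * x ^ i)\<bar> < 1 / real (Suc n)" by (intro cd) auto
    moreover have "1 / real (Suc n) \<le> 1" by simp
    moreover have "0 \<le> r n x" "r n x \<le> 1" by (auto simp: r_def)
    ultimately show "\<bar>\<Sum>i\<le>d n. c n i * x ^ i\<bar> \<le> 2" by linarith
  next
    fix x :: real assume x: "\<bar>x\<bar> \<le> 1"
    have r: "(\<lambda>n. r n x) \<longlonglongrightarrow> indicator {..a} x"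
    proof (cases "x \<le> a")
      case True
      then have "r n x = 1" for n
        using mult_nonneg_nonpos[of "real (Suc n)" "x - a"] by (auto simp: r_def simp del: of_nat_Suc)
      then show ?thesis using True by simp
    next
      case False
      then obtain N where N: "1 / (x - a) < real N" using reals_Archimedean2 by blast
      have "r n x = 0" if "n \<ge> N" for n
      proof -
        have "1 / (x - a) < real (Suc n)" using N that by linarith
        then show ?thesis using False by (auto simp: r_def field_simps)
      qed
      then have "eventually (\<lambda>n. r n x = 0) sequentially" by (auto simp: eventually_sequentially)
      then show ?thesis using False by (auto intro!: tendsto_eventually)
    qed
    have "(\<lambda>n. r n x - (\<Sum>i\<le>d n. c n i * x ^ i)) \<longlonglongrightarrow> 0"
    proof (rule Lim_null_comparison)
      show "eventually (\<lambda>n. norm (r n x - (\<Sum>i\<le>d n. c n i * x ^ i)) \<le> 1 / real (Suc n)) sequentially"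
        using x by (intro always_eventually allI) (auto intro!: less_imp_le[OF cd, THEN order_trans])
      show "(\<lambda>n. 1 / real (Suc n)) \<longlonglongrightarrow> 0" by (rule LIMSEQ_Suc[OF lim_1_over_n])
    qed
    from tendsto_diff[OF r this] show "(\<lambda>n. \<Sum>i\<le>d n. c n i * x ^ i) \<longlonglongrightarrow> indicator {..a} x" by simp
  qed
qed

text \<open>The coefficients are chosen for all thresholds simultaneously, because an orthant has a
  different threshold in each coordinate. The bound 2, uniform in \<open>n\<close>, is what
  dominated convergence asks for.\<close>

lemma halfline_polynomial_approx:
  obtains c :: "real \<Rightarrow> nat \<Rightarrow> nat \<Rightarrow> real" and d :: "real \<Rightarrow> nat \<Rightarrow> nat"
  where "\<And>a n x. \<bar>x\<bar> \<le> 1 \<Longrightarrow> \<bar>\<Sum>i\<le>d a n. c a n i * x ^ i\<bar> \<le> 2"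
    and "\<And>a x. \<bar>x\<bar> \<le> 1 \<Longrightarrow> (\<lambda>n. \<Sum>i\<le>d a n. c a n i * x ^ i) \<longlonglongrightarrow> indicator {..a} x"
proof -
  define Q where "Q = (\<lambda>a cd. (\<forall>n x. \<bar>x\<bar> \<le> 1 \<longrightarrow> \<bar>\<Sum>i\<le>snd cd n. fst cd n i * x ^ i\<bar> \<le> (2::real))
      \<and> (\<forall>x. \<bar>x\<bar> \<le> 1 \<longrightarrow> (\<lambda>n. \<Sum>i\<le>snd cd n. fst cd n i * x ^ i) \<longlonglongrightarrow> indicator {..a::real} x))"
  have "\<exists>cd. Q a cd" for a
  proof (rule halfline_polynomial_approx_single[of a])
    fix c :: "nat \<Rightarrow> nat \<Rightarrow> real" and d
    assume "\<And>n x. \<bar>x\<bar> \<le> 1 \<Longrightarrow> \<bar>\<Sum>i\<le>d n. c n i * x ^ i\<bar> \<le> 2"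
      "\<And>x. \<bar>x\<bar> \<le> 1 \<Longrightarrow> (\<lambda>n. \<Sum>i\<le>d n. c n i * x ^ i) \<longlonglongrightarrow> indicator {..a} x"
    then have "Q a (c, d)" by (simp add: Q_def)
    then show "\<exists>cd. Q a cd" ..
  qed
  from choice[rule_format, of Q, OF this] obtain cd where "\<And>a. Q a (cd a)" by blast
  then show thesis by (intro that[of "\<lambda>a. fst (cd a)" "\<lambda>a. snd (cd a)"]) (auto simp: Q_def)
qed

lemma abs_prod_list_le_1:
  fixes f :: "'a \<Rightarrow> real"
  assumes "\<And>x. x \<in> set xs \<Longrightarrow> \<bar>f x\<bar> \<le> 1"
  shows "\<bar>\<Prod>x\<leftarrow>xs. f x\<bar> \<le> 1"
  using assms by (induction xs) (auto simp: abs_mult intro: mult_le_one)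

lemma borel_measurable_prod_list:
  fixes f :: "'a \<Rightarrow> 'b \<Rightarrow> real"
  assumes "\<And>x. x \<in> set xs \<Longrightarrow> f x \<in> borel_measurable M"
  shows "(\<lambda>\<omega>. \<Prod>x\<leftarrow>xs. f x \<omega>) \<in> borel_measurable M"
  using assms by (induction xs) auto

lemma (in finite_measure) integrable_bounded:
  fixes f :: "'a \<Rightarrow> real"
  assumes "f \<in> borel_measurable M" "\<And>x. x \<in> space M \<Longrightarrow> \<bar>f x\<bar> \<le> B"
  shows "integrable M f"
  using assms by (intro integrable_const_bound[where B=B]) auto

text \<open>The list \<open>js\<close> is an accumulator: expanding the polynomial of one coordinate
  \<open>a\<close> moves each power of \<open>X a\<close> into the list as
  \<open>replicate i a\<close>, until only plain moments remain. Integrability is carried along in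
  the induction since linearity of the integral needs it.\<close>

lemma polynomial_expectations_eq:
  fixes X :: "'j \<Rightarrow> 'a \<Rightarrow> real" and Y :: "'j \<Rightarrow> 'b \<Rightarrow> real"
  assumes M: "prob_space M" "prob_space N"
    and X: "\<And>j. j \<in> J \<Longrightarrow> X j \<in> borel_measurable M" "\<And>j \<omega>. j \<in> J \<Longrightarrow> \<omega> \<in> space M \<Longrightarrow> \<bar>X j \<omega>\<bar> \<le> 1"
    and Y: "\<And>j. j \<in> J \<Longrightarrow> Y j \<in> borel_measurable N" "\<And>j \<omega>. j \<in> J \<Longrightarrow> \<omega> \<in> space N \<Longrightarrow> \<bar>Y j \<omega>\<bar> \<le> 1"
    and eq: "\<And>js. set js \<subseteq> J \<Longrightarrow> (\<integral>\<omega>. (\<Prod>j\<leftarrow>js. X j \<omega>) \<partial>M) = (\<integral>\<omega>. (\<Prod>j\<leftarrow>js. Y j \<omega>) \<partial>N)"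
    and F: "finite F" "F \<subseteq> J"
  shows "set js \<subseteq> J \<Longrightarrow>
    integrable M (\<lambda>\<omega>. (\<Prod>j\<in>F. \<Sum>i\<le>d j. c j i * X j \<omega> ^ i) * (\<Prod>j\<leftarrow>js. X j \<omega>)) \<and>
    integrable N (\<lambda>\<omega>. (\<Prod>j\<in>F. \<Sum>i\<le>d j. c j i * Y j \<omega> ^ i) * (\<Prod>j\<leftarrow>js. Y j \<omega>)) \<and>
    (\<integral>\<omega>. (\<Prod>j\<in>F. \<Sum>i\<le>d j. c j i * X j \<omega> ^ i) * (\<Prod>j\<leftarrow>js. X j \<omega>) \<partial>M) =
    (\<integral>\<omega>. (\<Prod>j\<in>F. \<Sum>i\<le>d j. c j i * Y j \<omega> ^ i) * (\<Prod>j\<leftarrow>js. Y j \<omega>) \<partial>N)"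
  using F
proof (induction F arbitrary: js rule: finite_induct)
  case empty
  interpret M: prob_space M by fact
  interpret N: prob_space N by fact
  have "integrable M (\<lambda>\<omega>. \<Prod>j\<leftarrow>js. X j \<omega>)"
    using X empty by (intro M.integrable_bounded[where B=1] borel_measurable_prod_list abs_prod_list_le_1) auto
  moreover have "integrable N (\<lambda>\<omega>. \<Prod>j\<leftarrow>js. Y j \<omega>)"
    using Y empty by (intro N.integrable_bounded[where B=1] borel_measurable_prod_list abs_prod_list_le_1) auto
  ultimately show ?case using eq empty by simp
next
  case (insert a F)
  have expand: "(\<Prod>j\<in>insert a F. \<Sum>i\<le>d j. c j i * Z j ^ i) * (\<Prod>j\<leftarrow>js. Z j)
     = (\<Sum>i\<le>d a. c a i * ((\<Prod>j\<in>F. \<Sum>i\<le>d j. c j i * Z j ^ i) * (\<Prod>j\<leftarrow>replicate i a @ js. Z j)))" for Z :: "'j \<Rightarrow> real"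
    using insert.hyps by (simp add: sum_distrib_right sum_distrib_left prod_list_replicate ac_simps)
  have IH: "integrable M (\<lambda>\<omega>. (\<Prod>j\<in>F. \<Sum>i\<le>d j. c j i * X j \<omega> ^ i) * (\<Prod>j\<leftarrow>replicate i a @ js. X j \<omega>)) \<and>
    integrable N (\<lambda>\<omega>. (\<Prod>j\<in>F. \<Sum>i\<le>d j. c j i * Y j \<omega> ^ i) * (\<Prod>j\<leftarrow>replicate i a @ js. Y j \<omega>)) \<and>
    (\<integral>\<omega>. (\<Prod>j\<in>F. \<Sum>i\<le>d j. c j i * X j \<omega> ^ i) * (\<Prod>j\<leftarrow>replicate i a @ js. X j \<omega>) \<partial>M) =
    (\<integral>\<omega>. (\<Prod>j\<in>F. \<Sum>i\<le>d j. c j i * Y j \<omega> ^ i) * (\<Prod>j\<leftarrow>replicate i a @ js. Y j \<omega>) \<partial>N)" for i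
    by (rule insert.IH) (use insert.prems in auto)
  show ?case
    unfolding expand using IH
    by (intro conjI integrable_sum integrable_mult_right; simp del: map_append map_replicate)
qed

lemma halfline_cylinder_measurable:
  assumes F: "finite F" "F \<subseteq> J"
  shows "{x\<in>PiE J (\<lambda>_. UNIV). \<forall>j\<in>F. x j \<le> a j} \<in> sets (PiM J (\<lambda>_. borel :: real measure))"
proof -
  have "(\<lambda>x. x j) \<in> borel_measurable (PiM J (\<lambda>_. borel :: real measure))" if "j \<in> F" for j
    using that F by (intro measurable_component_singleton) auto
  then have "{x\<in>space (PiM J (\<lambda>_. borel :: real measure)). \<forall>j\<in>F. x j \<le> a j} \<in> sets (PiM J (\<lambda>_. borel :: real measure))"
    using F by (intro sets.sets_Collect_finite_All borel_measurable_le) auto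
  then show ?thesis by (simp add: space_PiM)
qed

text \<open>Dominated convergence with the constant bound \<open>2 ^ card F\<close>: the product of
  the approximating polynomials tends pointwise to the indicator of an orthant. Orthant
  probabilities thus become limits of combinations of moments.\<close>

lemma halfline_prob_limit:
  fixes Z :: "'j \<Rightarrow> 'c \<Rightarrow> real"
  assumes L: "prob_space L" and Z: "\<And>j. j \<in> J \<Longrightarrow> Z j \<in> borel_measurable L"
      "\<And>j \<omega>. j \<in> J \<Longrightarrow> \<omega> \<in> space L \<Longrightarrow> \<bar>Z j \<omega>\<bar> \<le> 1"
    and F: "finite F" "F \<subseteq> J"
    and bound: "\<And>b n x. \<bar>x\<bar> \<le> 1 \<Longrightarrow> \<bar>\<Sum>i\<le>d b n. c b n i * x ^ i\<bar> \<le> (2::real)"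
    and lim: "\<And>b x. \<bar>x\<bar> \<le> 1 \<Longrightarrow> (\<lambda>n. \<Sum>i\<le>d b n. c b n i * x ^ i) \<longlonglongrightarrow> indicator {..b::real} x"
  shows "(\<lambda>n. \<integral>\<omega>. (\<Prod>j\<in>F. \<Sum>i\<le>d (a j) n. c (a j) n i * Z j \<omega> ^ i) \<partial>L)
    \<longlonglongrightarrow> measure (distr L (PiM J (\<lambda>_. borel)) (\<lambda>\<omega>. \<lambda>j\<in>J. Z j \<omega>)) {x\<in>PiE J (\<lambda>_. UNIV). \<forall>j\<in>F. x j \<le> a j}"
proof -
      interpret L: prob_space L by fact
      have Zm[measurable]: "Z j \<in> borel_measurable L" if "j \<in> F" for j using that F Z by auto
      have Zb: "\<bar>Z j \<omega>\<bar> \<le> 1" if "j \<in> F" "\<omega> \<in> space L" for j \<omega> using that F Z by auto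
      have ms: "{\<omega> \<in> space L. \<forall>j\<in>F. Z j \<omega> \<le> a j} \<in> sets L"
        using F Zm by (intro sets.sets_Collect_finite_All borel_measurable_le) auto
      have "(\<lambda>n. \<integral>\<omega>. (\<Prod>j\<in>F. \<Sum>i\<le>d (a j) n. c (a j) n i * Z j \<omega> ^ i) \<partial>L)
        \<longlonglongrightarrow> (\<integral>\<omega>. (\<Prod>j\<in>F. indicator {..a j} (Z j \<omega>)) \<partial>L)"
      proof (rule integral_dominated_convergence[where w="\<lambda>_. 2 ^ card F"])
        show "(\<lambda>\<omega>. \<Prod>j\<in>F. indicator {..a j} (Z j \<omega>) :: real) \<in> borel_measurable L"
          "(\<lambda>\<omega>. \<Prod>j\<in>F. \<Sum>i\<le>d (a j) n. c (a j) n i * Z j \<omega> ^ i) \<in> borel_measurable L" for n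
          by (auto intro!: borel_measurable_prod borel_measurable_sum)
        show "AE \<omega> in L. (\<lambda>n. \<Prod>j\<in>F. \<Sum>i\<le>d (a j) n. c (a j) n i * Z j \<omega> ^ i)
            \<longlonglongrightarrow> (\<Prod>j\<in>F. indicator {..a j} (Z j \<omega>))"
          by (intro AE_I2 tendsto_prod lim Zb)
        show "AE \<omega> in L. norm (\<Prod>j\<in>F. \<Sum>i\<le>d (a j) n. c (a j) n i * Z j \<omega> ^ i) \<le> 2 ^ card F" for n
        proof (rule AE_I2)
          fix \<omega> assume "\<omega> \<in> space L"
          then have "(\<Prod>j\<in>F. \<bar>\<Sum>i\<le>d (a j) n. c (a j) n i * Z j \<omega> ^ i\<bar>) \<le> (\<Prod>j\<in>F. 2)"
            by (intro prod_mono) (auto intro!: bound Zb)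
          then show "norm (\<Prod>j\<in>F. \<Sum>i\<le>d (a j) n. c (a j) n i * Z j \<omega> ^ i) \<le> 2 ^ card F"
            by (simp add: abs_prod)
        qed
      qed auto
      also have "(\<integral>\<omega>. (\<Prod>j\<in>F. indicator {..a j} (Z j \<omega>)) \<partial>L :: real) =
          (\<integral>\<omega>. indicator {\<omega> \<in> space L. \<forall>j\<in>F. Z j \<omega> \<le> a j} \<omega> \<partial>L)"
        proof (rule Bochner_Integration.integral_cong[OF refl])
        fix \<omega> assume "\<omega> \<in> space L"
        then show "(\<Prod>j\<in>F. indicator {..a j} (Z j \<omega>)) = (indicator {\<omega> \<in> space L. \<forall>j\<in>F. Z j \<omega> \<le> a j} \<omega> :: real)"
          using F(1) prod_zero[OF F(1), of "\<lambda>j. indicator {..a j} (Z j \<omega>) :: real"]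
          by (cases "\<forall>j\<in>F. Z j \<omega> \<le> a j") (auto simp: indicator_def)
      qed
      also have "\<dots> = measure L {\<omega> \<in> space L. \<forall>j\<in>F. Z j \<omega> \<le> a j}"
        using ms by simp
      also have "\<dots> = measure (distr L (PiM J (\<lambda>_. borel)) (\<lambda>\<omega>. \<lambda>j\<in>J. Z j \<omega>))
          {x\<in>PiE J (\<lambda>_. UNIV). \<forall>j\<in>F. x j \<le> a j}"
        using Z F halfline_cylinder_measurable[OF F] by (subst measure_distr)
          (auto intro!: measurable_restrict arg_cong[where f="measure L"] simp: space_PiM)
      finally show ?thesis .
    qed

text \<open>Orthants that constrain finitely many coordinates form an intersection-stable generator
  of the product sigma-algebra, and their probabilities are limits of polynomial expectations. This
  one criterion serves for spins, multi-overlaps, sines of Gaussian fields and truncated cavity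
  averages.\<close>

theorem moments_determine_law:
  fixes X :: "'j \<Rightarrow> 'a \<Rightarrow> real" and Y :: "'j \<Rightarrow> 'b \<Rightarrow> real"
  assumes M: "prob_space M" "prob_space N"
    and X: "\<And>j. j \<in> J \<Longrightarrow> X j \<in> borel_measurable M" "\<And>j \<omega>. j \<in> J \<Longrightarrow> \<omega> \<in> space M \<Longrightarrow> \<bar>X j \<omega>\<bar> \<le> 1"
    and Y: "\<And>j. j \<in> J \<Longrightarrow> Y j \<in> borel_measurable N" "\<And>j \<omega>. j \<in> J \<Longrightarrow> \<omega> \<in> space N \<Longrightarrow> \<bar>Y j \<omega>\<bar> \<le> 1"
    and eq: "\<And>js. set js \<subseteq> J \<Longrightarrow> (\<integral>\<omega>. (\<Prod>j\<leftarrow>js. X j \<omega>) \<partial>M) = (\<integral>\<omega>. (\<Prod>j\<leftarrow>js. Y j \<omega>) \<partial>N)"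
  shows "distr M (PiM J (\<lambda>_. borel)) (\<lambda>\<omega>. \<lambda>j\<in>J. X j \<omega>) = distr N (PiM J (\<lambda>_. borel)) (\<lambda>\<omega>. \<lambda>j\<in>J. Y j \<omega>)"
    (is "?P = ?Q")
proof -
  interpret M: prob_space M by fact
  interpret N: prob_space N by fact
  have mX: "(\<lambda>\<omega>. \<lambda>j\<in>J. X j \<omega>) \<in> measurable M (PiM J (\<lambda>_. borel))"
    using X by (intro measurable_restrict) auto
  have mY: "(\<lambda>\<omega>. \<lambda>j\<in>J. Y j \<omega>) \<in> measurable N (PiM J (\<lambda>_. borel))"
    using Y by (intro measurable_restrict) auto
  define \<Omega> where "\<Omega> = PiE J (\<lambda>_. UNIV :: real set)"
  define E where "E = (\<lambda>(F, a). {x\<in>\<Omega>. \<forall>j\<in>F. x j \<le> a j}) ` ({F. finite F \<and> F \<subseteq> J} \<times> (UNIV :: ('j \<Rightarrow> real) set))"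
  have E_Pow: "E \<subseteq> Pow \<Omega>" by (auto simp: E_def)
  have E_meas: "A \<in> sets (PiM J (\<lambda>_. borel :: real measure))" if "A \<in> E" for A
    using that halfline_cylinder_measurable unfolding E_def \<Omega>_def by auto
  have sets_E: "sets (PiM J (\<lambda>_. borel)) = sigma_sets \<Omega> E"
  proof
    show "sigma_sets \<Omega> E \<subseteq> sets (PiM J (\<lambda>_. borel))"
      using E_meas sets.top[of "PiM J (\<lambda>_. borel :: real measure)"]
      by (intro sets.sigma_sets_subset') (auto simp: \<Omega>_def space_PiM)
    \<comment> \<open>The product sigma-algebra is the smallest one with measurable coordinates, so
      it suffices that the coordinates are measurable for the sigma-algebra generated by
      \<open>E\<close>. Their sublevel sets are the orthants with \<open>F = {j}\<close>.\<close>
    define S where "S = sigma \<Omega> E"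
    have spS: "space S = \<Omega>" and seS: "sets S = sigma_sets \<Omega> E"
      using E_Pow by (auto simp: S_def)
    have "(\<lambda>x. x) \<in> measurable S (PiM J (\<lambda>_. borel :: real measure))"
    proof (rule measurable_PiM_single')
      show "(\<lambda>x. x) \<in> space S \<rightarrow> (\<Pi>\<^sub>E i\<in>J. space borel)" by (auto simp: spS \<Omega>_def)
      fix j assume j: "j \<in> J"
      show "(\<lambda>x. x j) \<in> borel_measurable S"
      proof (subst borel_measurable_iff_le, intro allI)
        fix a :: real
        have "{x \<in> space S. x j \<le> a} = (\<lambda>(F, a). {x\<in>\<Omega>. \<forall>j\<in>F. x j \<le> a j}) ({j}, \<lambda>_. a)"
          by (auto simp: spS)
        also have "\<dots> \<in> E" unfolding E_def using j by (intro imageI) auto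
        finally show "{x \<in> space S. x j \<le> a} \<in> sets S" by (auto simp: seS)
      qed
    qed
    from measurable_sets[OF this]
    show "sets (PiM J (\<lambda>_. borel)) \<subseteq> sigma_sets \<Omega> E"
      using sets.sets_into_space[of _ "PiM J (\<lambda>_. borel :: real measure)"]
      by (auto simp: seS spS \<Omega>_def space_PiM Int_absorb2)
  qed
  show ?thesis
  proof (rule measure_eqI_generator_eq[where E=E and \<Omega>=\<Omega> and A="\<lambda>_. \<Omega>"])
    show "Int_stable E"
    proof (rule Int_stableI)
      fix A B assume "A \<in> E" "B \<in> E"
      then obtain F a G b where FG: "finite F" "F \<subseteq> J" "finite G" "G \<subseteq> J"
        and AB: "A = {x\<in>\<Omega>. \<forall>j\<in>F. x j \<le> a j}" "B = {x\<in>\<Omega>. \<forall>j\<in>G. x j \<le> b j}"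
        by (auto simp: E_def)
      define c where "c j = (if j \<in> F \<and> j \<in> G then min (a j) (b j) else if j \<in> F then a j else b j)" for j
      have "A \<inter> B = (\<lambda>(F, a). {x\<in>\<Omega>. \<forall>j\<in>F. x j \<le> a j}) (F \<union> G, c)"
        unfolding AB c_def by (auto split: if_splits)
      also have "\<dots> \<in> E" unfolding E_def using FG by (intro imageI) auto
      finally show "A \<inter> B \<in> E" .
    qed
    show "sets ?P = sigma_sets \<Omega> E" "sets ?Q = sigma_sets \<Omega> E" using sets_E by auto
    have "\<Omega> = (\<lambda>(F, a). {x\<in>\<Omega>. \<forall>j\<in>F. x j \<le> a j}) ({}, \<lambda>_. 0)" by auto
    also have "\<dots> \<in> E" unfolding E_def by (intro imageI) auto
    finally show "range (\<lambda>_. \<Omega>) \<subseteq> E" by auto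
    show "emeasure ?P \<Omega> \<noteq> \<infinity>"
      using finite_measure.emeasure_finite[OF M.finite_measure_distr[OF mX]] by auto
    fix A assume AE: "A \<in> E"
    then obtain F a where F: "finite F" "F \<subseteq> J" and A: "A = {x\<in>\<Omega>. \<forall>j\<in>F. x j \<le> a j}"
      by (auto simp: E_def)
    obtain c :: "real \<Rightarrow> nat \<Rightarrow> nat \<Rightarrow> real" and d :: "real \<Rightarrow> nat \<Rightarrow> nat"
      where bound: "\<And>b n x. \<bar>x\<bar> \<le> 1 \<Longrightarrow> \<bar>\<Sum>i\<le>d b n. c b n i * x ^ i\<bar> \<le> 2"
      and lim: "\<And>b x. \<bar>x\<bar> \<le> 1 \<Longrightarrow> (\<lambda>n. \<Sum>i\<le>d b n. c b n i * x ^ i) \<longlonglongrightarrow> indicator {..b} x"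
      using halfline_polynomial_approx by blast
    have "(\<integral>\<omega>. (\<Prod>j\<in>F. \<Sum>i\<le>d (a j) n. c (a j) n i * X j \<omega> ^ i) \<partial>M)
       = (\<integral>\<omega>. (\<Prod>j\<in>F. \<Sum>i\<le>d (a j) n. c (a j) n i * Y j \<omega> ^ i) \<partial>N)" for n
      using polynomial_expectations_eq[OF M X Y eq F, of "[]" "\<lambda>j. c (a j) n" "\<lambda>j. d (a j) n"] by simp
    then have "measure ?P A = measure ?Q A"
      using halfline_prob_limit[where Z=X and J=J and a=a, OF M(1) X F bound lim]
        halfline_prob_limit[where Z=Y and J=J and a=a, OF M(2) Y F bound lim] unfolding A \<Omega>_def by (auto intro: LIMSEQ_unique)
    then show "emeasure ?P A = emeasure ?Q A"
      using finite_measure.emeasure_eq_measure[OF M.finite_measure_distr[OF mX]]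
        finite_measure.emeasure_eq_measure[OF N.finite_measure_distr[OF mY]] by simp
  qed (use E_Pow in auto)
qed

section \<open>Characteristic functions and resampling\<close>

lemma sin_products_measurable:
  fixes Z :: "'j \<Rightarrow> 'c \<Rightarrow> real"
  assumes "\<And>j. j \<in> fst ` set ks \<Longrightarrow> Z j \<in> borel_measurable L"
  shows "(\<lambda>\<omega>. \<Prod>(j,b)\<leftarrow>ks. sin (b * Z j \<omega>)) \<in> borel_measurable L"
  unfolding case_prod_unfold
proof (rule borel_measurable_prod_list)
  fix x assume "x \<in> set ks"
  then have [measurable]: "Z (fst x) \<in> borel_measurable L" using assms by auto
  show "(\<lambda>\<omega>. sin (snd x * Z (fst x) \<omega>)) \<in> borel_measurable L" by measurable
qed

text \<open>Product-to-sum formulas: multiplying a sine or cosine of a linear form by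
  \<open>sin (b * X j)\<close> gives half a difference of two such functions with the coefficient of
  \<open>j\<close> shifted by \<open>b\<close> and \<open>- b\<close>. Hence joint moments of sines
  reduce to the two trigonometric hypotheses, which explains why \<open>a\<close> varies in the
  induction.\<close>

lemma sin_products_expectations_eq:
  fixes X :: "'j \<Rightarrow> 'a \<Rightarrow> real" and Y :: "'j \<Rightarrow> 'b \<Rightarrow> real"
  assumes M: "prob_space M" "prob_space N" and J: "finite J"
    and X: "\<And>j. j \<in> J \<Longrightarrow> X j \<in> borel_measurable M"
    and Y: "\<And>j. j \<in> J \<Longrightarrow> Y j \<in> borel_measurable N"
    and cos_eq: "\<And>a. (\<integral>\<omega>. cos (\<Sum>j\<in>J. a j * X j \<omega>) \<partial>M) = (\<integral>\<omega>. cos (\<Sum>j\<in>J. a j * Y j \<omega>) \<partial>N)"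
    and sin_eq: "\<And>a. (\<integral>\<omega>. sin (\<Sum>j\<in>J. a j * X j \<omega>) \<partial>M) = (\<integral>\<omega>. sin (\<Sum>j\<in>J. a j * Y j \<omega>) \<partial>N)"
  shows "fst ` set ks \<subseteq> J \<Longrightarrow>
    (\<integral>\<omega>. (\<Prod>(j,b)\<leftarrow>ks. sin (b * X j \<omega>)) * cos (\<Sum>j\<in>J. a j * X j \<omega>) \<partial>M) =
      (\<integral>\<omega>. (\<Prod>(j,b)\<leftarrow>ks. sin (b * Y j \<omega>)) * cos (\<Sum>j\<in>J. a j * Y j \<omega>) \<partial>N) \<and>
    (\<integral>\<omega>. (\<Prod>(j,b)\<leftarrow>ks. sin (b * X j \<omega>)) * sin (\<Sum>j\<in>J. a j * X j \<omega>) \<partial>M) =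
      (\<integral>\<omega>. (\<Prod>(j,b)\<leftarrow>ks. sin (b * Y j \<omega>)) * sin (\<Sum>j\<in>J. a j * Y j \<omega>) \<partial>N)"
proof (induction ks arbitrary: a)
  case Nil
  then show ?case using cos_eq sin_eq by simp
next
  case (Cons k ks)
  interpret M: prob_space M by fact
  interpret N: prob_space N by fact
  obtain j b where k: "k = (j, b)" and j: "j \<in> J" using Cons.prems by (cases k) auto
  define p where "p = a(j := a j + b)"
  define m where "m = a(j := a j - b)"
  have sum: "(\<Sum>i\<in>J. p i * z i) = (\<Sum>i\<in>J. a i * z i) + b * z j"
            "(\<Sum>i\<in>J. m i * z i) = (\<Sum>i\<in>J. a i * z i) - b * z j" for z :: "'j \<Rightarrow> real"
    using J j by (auto simp: p_def m_def sum.remove[of _ j] algebra_simps)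
  have sc: "sin (b * z j) * cos (\<Sum>i\<in>J. a i * z i) = (sin (\<Sum>i\<in>J. p i * z i) - sin (\<Sum>i\<in>J. m i * z i)) / 2"
           "sin (b * z j) * sin (\<Sum>i\<in>J. a i * z i) = (cos (\<Sum>i\<in>J. m i * z i) - cos (\<Sum>i\<in>J. p i * z i)) / 2"
    for z :: "'j \<Rightarrow> real"
    unfolding sum by (simp_all add: sin_add sin_diff cos_add cos_diff)
  have split: "(\<Prod>(j,b)\<leftarrow>k # ks. sin (b * z j)) * cos (\<Sum>i\<in>J. a i * z i) =
      ((\<Prod>(j,b)\<leftarrow>ks. sin (b * z j)) * sin (\<Sum>i\<in>J. p i * z i) - (\<Prod>(j,b)\<leftarrow>ks. sin (b * z j)) * sin (\<Sum>i\<in>J. m i * z i)) / 2"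
    "(\<Prod>(j,b)\<leftarrow>k # ks. sin (b * z j)) * sin (\<Sum>i\<in>J. a i * z i) =
      ((\<Prod>(j,b)\<leftarrow>ks. sin (b * z j)) * cos (\<Sum>i\<in>J. m i * z i) - (\<Prod>(j,b)\<leftarrow>ks. sin (b * z j)) * cos (\<Sum>i\<in>J. p i * z i)) / 2"
    for z :: "'j \<Rightarrow> real"
  proof -
    define P where "P = (\<Prod>(j,b)\<leftarrow>ks. sin (b * z j))"
    have "(\<Prod>(j,b)\<leftarrow>k # ks. sin (b * z j)) * t = P * (sin (b * z j) * t)" for t
      by (simp add: k P_def)
    then show "(\<Prod>(j,b)\<leftarrow>k # ks. sin (b * z j)) * cos (\<Sum>i\<in>J. a i * z i) =
        (P * sin (\<Sum>i\<in>J. p i * z i) - P * sin (\<Sum>i\<in>J. m i * z i)) / 2"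
      "(\<Prod>(j,b)\<leftarrow>k # ks. sin (b * z j)) * sin (\<Sum>i\<in>J. a i * z i) =
        (P * cos (\<Sum>i\<in>J. m i * z i) - P * cos (\<Sum>i\<in>J. p i * z i)) / 2"
      by (simp_all only: sc right_diff_distrib times_divide_eq_right)
  qed
  define PX where "PX = (\<lambda>\<omega>. \<Prod>(j,b)\<leftarrow>ks. sin (b * X j \<omega>))"
  define PY where "PY = (\<lambda>\<omega>. \<Prod>(j,b)\<leftarrow>ks. sin (b * Y j \<omega>))"
  have [measurable]: "PX \<in> borel_measurable M" "PY \<in> borel_measurable N"
    using Cons.prems by (auto simp: PX_def PY_def intro!: sin_products_measurable X Y)
  have [measurable]: "(\<lambda>\<omega>. \<Sum>j\<in>J. c j * X j \<omega>) \<in> borel_measurable M"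
      "(\<lambda>\<omega>. \<Sum>j\<in>J. c j * Y j \<omega>) \<in> borel_measurable N" for c
    using X Y by auto
  have "\<bar>PX \<omega>\<bar> \<le> 1" "\<bar>PY \<omega>'\<bar> \<le> 1" for \<omega> \<omega>'
    unfolding PX_def PY_def by (rule abs_prod_list_le_1, auto)+
  then have bX: "\<bar>PX \<omega> * sin t\<bar> \<le> 1" "\<bar>PX \<omega> * cos t\<bar> \<le> 1" and bY: "\<bar>PY \<omega>' * sin t\<bar> \<le> 1" "\<bar>PY \<omega>' * cos t\<bar> \<le> 1" for \<omega> \<omega>' t
    by (auto simp: abs_mult intro!: mult_le_one)
  have iX: "integrable M (\<lambda>\<omega>. PX \<omega> * sin (\<Sum>j\<in>J. c j * X j \<omega>))" "integrable M (\<lambda>\<omega>. PX \<omega> * cos (\<Sum>j\<in>J. c j * X j \<omega>))" for c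
    using bX by (auto intro!: M.integrable_bounded[where B=1])
  have iY: "integrable N (\<lambda>\<omega>. PY \<omega> * sin (\<Sum>j\<in>J. c j * Y j \<omega>))" "integrable N (\<lambda>\<omega>. PY \<omega> * cos (\<Sum>j\<in>J. c j * Y j \<omega>))" for c
    using bY by (auto intro!: N.integrable_bounded[where B=1])
  show ?case
    unfolding split using Cons.IH[of p] Cons.IH[of m] Cons.prems iX[unfolded PX_def] iY[unfolded PY_def]
    by simp
qed

text \<open>A real form of the uniqueness theorem for characteristic functions of finitely many
  variables. The variables \<open>X j\<close> are unbounded, so the moment criterion is applied to
  the bounded family \<open>sin (X j / Suc n)\<close>, and \<open>X j\<close> is the limit of
  \<open>Suc n * sin (X j / Suc n)\<close>.\<close>

lemma trig_determines_law:
  fixes X :: "'j \<Rightarrow> 'a \<Rightarrow> real" and Y :: "'j \<Rightarrow> 'b \<Rightarrow> real"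
  assumes M: "prob_space M" "prob_space N" and J: "finite J"
    and X: "\<And>j. j \<in> J \<Longrightarrow> X j \<in> borel_measurable M"
    and Y: "\<And>j. j \<in> J \<Longrightarrow> Y j \<in> borel_measurable N"
    and cos_eq: "\<And>a. (\<integral>\<omega>. cos (\<Sum>j\<in>J. a j * X j \<omega>) \<partial>M) = (\<integral>\<omega>. cos (\<Sum>j\<in>J. a j * Y j \<omega>) \<partial>N)"
    and sin_eq: "\<And>a. (\<integral>\<omega>. sin (\<Sum>j\<in>J. a j * X j \<omega>) \<partial>M) = (\<integral>\<omega>. sin (\<Sum>j\<in>J. a j * Y j \<omega>) \<partial>N)"
  shows "distr M (PiM J (\<lambda>_. borel)) (\<lambda>\<omega>. \<lambda>j\<in>J. X j \<omega>) = distr N (PiM J (\<lambda>_. borel)) (\<lambda>\<omega>. \<lambda>j\<in>J. Y j \<omega>)"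
proof -
  define K where "K = J \<times> (UNIV :: nat set)"
  define S where "S = (\<lambda>(z :: 'j \<Rightarrow> real) (j, n). sin (z j / real (Suc n)))"
  have K1: "fst k \<in> J" if "k \<in> K" for k using that by (auto simp: K_def)
  have eq: "distr M (PiM K (\<lambda>_. borel)) (\<lambda>\<omega>. \<lambda>k\<in>K. S (\<lambda>j. X j \<omega>) k) = distr N (PiM K (\<lambda>_. borel)) (\<lambda>\<omega>. \<lambda>k\<in>K. S (\<lambda>j. Y j \<omega>) k)"
  proof (rule moments_determine_law[OF M])
    fix ks assume ks: "set ks \<subseteq> K"
    define ks' where "ks' = map (\<lambda>(j, n). (j, 1 / real (Suc n))) ks"
    have "fst ` set ks' \<subseteq> J" using ks by (force simp: ks'_def K_def)
    from sin_products_expectations_eq[OF M J X Y cos_eq sin_eq this, of "\<lambda>_. 0"]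
    show "(\<integral>\<omega>. (\<Prod>k\<leftarrow>ks. S (\<lambda>j. X j \<omega>) k) \<partial>M) = (\<integral>\<omega>. (\<Prod>k\<leftarrow>ks. S (\<lambda>j. Y j \<omega>) k) \<partial>N)"
      by (simp add: ks'_def S_def case_prod_unfold o_def)
  qed (use X Y K1 in \<open>auto simp: S_def case_prod_unfold\<close>)
  \<comment> \<open>A measurable map on the space of sine values that returns the original
    variables; pushing the equal laws of the sines forward along \<open>h\<close> gives the
    claim.\<close>
  define h where "h = (\<lambda>s :: 'j \<times> nat \<Rightarrow> real. \<lambda>j\<in>J. lim (\<lambda>n. real (Suc n) * s (j, n)))"
  have h: "h \<in> measurable (PiM K (\<lambda>_. borel)) (PiM J (\<lambda>_. borel))"
    unfolding h_def
  proof (rule measurable_restrict)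
    fix j assume "j \<in> J"
    then have [measurable]: "(\<lambda>s. s (j, n)) \<in> borel_measurable (PiM K (\<lambda>_. borel :: real measure))" for n
      by (intro measurable_component_singleton) (auto simp: K_def)
    show "(\<lambda>s. lim (\<lambda>n. real (Suc n) * s (j, n))) \<in> borel_measurable (PiM K (\<lambda>_. borel :: real measure))"
      by measurable
  qed
  have lim_sin: "(\<lambda>n. real (Suc n) * sin (x / real (Suc n))) \<longlonglongrightarrow> x" for x :: real
  proof -
    have "((\<lambda>t. sin (x * t) / t) \<longlongrightarrow> x) (at 0)"
    proof -
      have "((\<lambda>t. sin (x * t)) has_field_derivative cos (x * 0) * x) (at 0)"
        by (auto intro!: derivative_eq_intros)
      then show ?thesis by (simp add: has_field_derivative_iff)
    qed
    moreover have "filterlim (\<lambda>n. 1 / real (Suc n)) (at 0) sequentially"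
      unfolding filterlim_at using LIMSEQ_Suc[OF lim_1_over_n[where 'a=real]] by auto
    ultimately have "(\<lambda>n. sin (x * (1 / real (Suc n))) / (1 / real (Suc n))) \<longlonglongrightarrow> x"
      by (rule filterlim_compose)
    then show ?thesis by (simp add: mult.commute)
  qed
  have hS: "h (\<lambda>k\<in>K. S z k) = (\<lambda>j\<in>J. z j)" for z
    using limI[OF lim_sin] by (auto simp: h_def K_def S_def fun_eq_iff restrict_def)
  have mX: "(\<lambda>\<omega>. \<lambda>k\<in>K. S (\<lambda>j. X j \<omega>) k) \<in> measurable M (PiM K (\<lambda>_. borel))"
    using X K1 by (intro measurable_restrict) (auto simp: S_def case_prod_unfold)
  have mY: "(\<lambda>\<omega>. \<lambda>k\<in>K. S (\<lambda>j. Y j \<omega>) k) \<in> measurable N (PiM K (\<lambda>_. borel))"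
    using Y K1 by (intro measurable_restrict) (auto simp: S_def case_prod_unfold)
  show ?thesis
    using arg_cong[OF eq, of "\<lambda>D. distr D (PiM J (\<lambda>_. borel)) h"]
    by (simp add: distr_distr[OF h mX] distr_distr[OF h mY] o_def hS)
qed

section \<open>Product measures and resampling of coordinates\<close>

lemma integral_PiM_prod:
  fixes f :: "'i \<Rightarrow> 'a \<Rightarrow> real"
  assumes "\<And>i. prob_space (M i)" "finite F" and f: "\<And>i. i \<in> F \<Longrightarrow> integrable (M i) (f i)"
  shows "(\<integral>x. (\<Prod>i\<in>F. f i (x i)) \<partial>PiM UNIV M) = (\<Prod>i\<in>F. \<integral>x. f i x \<partial>M i)"
proof -
  interpret product_prob_space M UNIV using assms(1) by (rule product_prob_spaceI)
  have meas: "(\<lambda>x. \<Prod>i\<in>F. f i (x i)) \<in> borel_measurable (PiM F M)"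
    using f by (intro borel_measurable_prod measurable_compose[OF measurable_component_singleton]) auto
  have "(\<integral>x. (\<Prod>i\<in>F. f i (x i)) \<partial>PiM F M) = (\<integral>x. (\<Prod>i\<in>F. f i (restrict x F i)) \<partial>PiM UNIV M)"
    using meas by (subst distr_PiM_restrict_finite[of F, symmetric], use assms in simp, simp)
      (subst integral_distr, auto intro!: measurable_restrict_subset)
  also have "\<dots> = (\<integral>x. (\<Prod>i\<in>F. f i (x i)) \<partial>PiM UNIV M)" by simp
  finally show ?thesis using product_integral_prod[of F f] assms by simp
qed

lemma measurable_fun_upd_UNIV[measurable (raw)]:
  assumes "f \<in> measurable N (PiM UNIV M)" "g \<in> measurable N (M i)"
  shows "(\<lambda>x. (f x)(i := g x)) \<in> measurable N (PiM UNIV M)"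
  using assms by (intro measurable_fun_upd[where J=UNIV]) auto

text \<open>Overwriting one coordinate by an independent draw of the same law preserves the product
  measure.\<close>

lemma nn_integral_PiM_upd:
  fixes A :: "'a measure" and F :: "('i \<Rightarrow> 'a) \<Rightarrow> ennreal"
  assumes A: "prob_space A" and F[measurable]: "F \<in> borel_measurable (PiM UNIV (\<lambda>_. A))"
  shows "(\<integral>\<^sup>+u. F u \<partial>PiM UNIV (\<lambda>_. A)) = (\<integral>\<^sup>+u. \<integral>\<^sup>+x. F (u(l := x)) \<partial>A \<partial>PiM UNIV (\<lambda>_. A))"
proof -
  interpret A: prob_space A by fact
  interpret P: prob_space "PiM UNIV (\<lambda>_::'i. A)" using A by (intro prob_space_PiM)
  interpret PA: pair_sigma_finite A "PiM UNIV (\<lambda>_::'i. A)" ..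
  have upd[measurable]: "(\<lambda>(x, u). u(l := x)) \<in> measurable (A \<Otimes>\<^sub>M PiM UNIV (\<lambda>_. A)) (PiM UNIV (\<lambda>_. A))"
    unfolding case_prod_unfold by (rule measurable_fun_upd[where J=UNIV]) auto
  have d: "distr (A \<Otimes>\<^sub>M PiM UNIV (\<lambda>_. A)) (PiM UNIV (\<lambda>_. A)) (\<lambda>(x, u). u(l := x)) = PiM UNIV (\<lambda>_. A)"
    using distr_pair_PiM_eq_PiM[of UNIV "\<lambda>_. A" l] A by simp
  have "(\<integral>\<^sup>+u. F u \<partial>PiM UNIV (\<lambda>_. A)) = (\<integral>\<^sup>+(x, u). F (u(l := x)) \<partial>(A \<Otimes>\<^sub>M PiM UNIV (\<lambda>_. A)))"
    by (subst d[symmetric], subst nn_integral_distr) (auto simp: case_prod_unfold)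
  also have "\<dots> = (\<integral>\<^sup>+u. \<integral>\<^sup>+x. F (u(l := x)) \<partial>A \<partial>PiM UNIV (\<lambda>_. A))"
    using measurable_compose[OF upd F] by (subst PA.nn_integral_snd[symmetric]) (auto simp: case_prod_unfold)
  finally show ?thesis .
qed

text \<open>The one-coordinate update is applied once in each of the two sequences. Working with
  nonnegative integrals of indicators lets Tonelli reorder the coordinates freely.\<close>

lemma distr_resample:
  fixes W :: "'w measure" and A :: "'a measure" and B :: "'b measure" and l :: 'i and i :: 'k
  assumes W: "prob_space W" and A: "prob_space A" and B: "prob_space B"
  defines "Q \<equiv> W \<Otimes>\<^sub>M PiM UNIV (\<lambda>_::'i. A) \<Otimes>\<^sub>M PiM UNIV (\<lambda>_::'k. B)"
  shows "(\<lambda>((w, u, v), (x, y)). (w, u(l := x), v(i := y))) \<in> measurable (Q \<Otimes>\<^sub>M (A \<Otimes>\<^sub>M B)) Q" (is "?T \<in> _")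
    and "distr (Q \<Otimes>\<^sub>M (A \<Otimes>\<^sub>M B)) Q (\<lambda>((w, u, v), (x, y)). (w, u(l := x), v(i := y))) = Q"
proof -
  interpret W: prob_space W by fact
  interpret A: prob_space A by fact
  interpret B: prob_space B by fact
  let ?PA = "PiM UNIV (\<lambda>_::'i. A)" and ?PB = "PiM UNIV (\<lambda>_::'k. B)"
  interpret PA: prob_space ?PA using A by (intro prob_space_PiM)
  interpret PB: prob_space ?PB using B by (intro prob_space_PiM)
  interpret PAB: pair_sigma_finite ?PA ?PB ..
  interpret PBA: pair_sigma_finite A ?PB ..
  interpret AB: pair_prob_space A B ..
  interpret PAPB: prob_space "?PA \<Otimes>\<^sub>M ?PB" by (intro prob_space_pair) unfold_locales
  interpret Q: prob_space Q unfolding Q_def by (intro prob_space_pair) unfold_locales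
  show T[measurable]: "?T \<in> measurable (Q \<Otimes>\<^sub>M (A \<Otimes>\<^sub>M B)) Q"
    unfolding Q_def case_prod_unfold
    by (intro measurable_Pair measurable_fun_upd[where J=UNIV]) auto
  show "distr (Q \<Otimes>\<^sub>M (A \<Otimes>\<^sub>M B)) Q ?T = Q"
  proof (rule measure_eqI)
    fix X assume "X \<in> sets (distr (Q \<Otimes>\<^sub>M (A \<Otimes>\<^sub>M B)) Q ?T)"
    then have X[measurable]: "X \<in> sets Q" by simp
    have Q_int: "(\<integral>\<^sup>+q. G q \<partial>Q) = (\<integral>\<^sup>+w. \<integral>\<^sup>+u. \<integral>\<^sup>+v. G (w, u, v) \<partial>?PB \<partial>?PA \<partial>W)"
      if [measurable]: "G \<in> borel_measurable Q" for G :: "_ \<Rightarrow> ennreal"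
    proof -
      have m: "G \<in> borel_measurable (W \<Otimes>\<^sub>M (?PA \<Otimes>\<^sub>M ?PB))" using that by (simp add: Q_def)
      have "(\<integral>\<^sup>+q. G q \<partial>Q) = (\<integral>\<^sup>+w. \<integral>\<^sup>+q. G (w, q) \<partial>(?PA \<Otimes>\<^sub>M ?PB) \<partial>W)"
        unfolding Q_def by (rule sigma_finite_measure.nn_integral_fst[OF prob_space_imp_sigma_finite[OF PAPB.prob_space_axioms], symmetric, OF m])
      also have "\<dots> = (\<integral>\<^sup>+w. \<integral>\<^sup>+u. \<integral>\<^sup>+v. G (w, u, v) \<partial>?PB \<partial>?PA \<partial>W)"
        by (intro nn_integral_cong PB.nn_integral_fst[symmetric] measurable_compose[OF _ m] measurable_Pair1') auto
      finally show ?thesis .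
    qed
    have i1: "(\<lambda>(w, u, v). indicator X (w, u, v) :: ennreal) \<in> borel_measurable (W \<Otimes>\<^sub>M ?PA \<Otimes>\<^sub>M ?PB)"
      using borel_measurable_indicator[OF X] by (simp add: Q_def)
    have "emeasure (distr (Q \<Otimes>\<^sub>M (A \<Otimes>\<^sub>M B)) Q ?T) X = (\<integral>\<^sup>+p. indicator X (?T p) \<partial>(Q \<Otimes>\<^sub>M (A \<Otimes>\<^sub>M B)))"
      by (subst nn_integral_distr[symmetric, OF T]) auto
    also have "\<dots> = (\<integral>\<^sup>+q. \<integral>\<^sup>+p. indicator X (?T (q, p)) \<partial>(A \<Otimes>\<^sub>M B) \<partial>Q)"
      by (rule sigma_finite_measure.nn_integral_fst[OF prob_space_imp_sigma_finite[OF AB.prob_space_axioms], symmetric]) measurable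
    also have "\<dots> = (\<integral>\<^sup>+w. \<integral>\<^sup>+u. \<integral>\<^sup>+v. \<integral>\<^sup>+p. indicator X (?T ((w, u, v), p)) \<partial>(A \<Otimes>\<^sub>M B) \<partial>?PB \<partial>?PA \<partial>W)"
      by (rule Q_int) measurable
    also have "\<dots> = (\<integral>\<^sup>+w. \<integral>\<^sup>+u. \<integral>\<^sup>+v. \<integral>\<^sup>+x. \<integral>\<^sup>+y. indicator X (w, u(l := x), v(i := y)) \<partial>B \<partial>A \<partial>?PB \<partial>?PA \<partial>W)"
    proof (intro nn_integral_cong)
      fix w u v assume sp: "w \<in> space W" "u \<in> space ?PA" "v \<in> space ?PB"
      have "(\<lambda>p. ?T ((w, u, v), p)) \<in> measurable (A \<Otimes>\<^sub>M B) Q"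
        using sp by (intro measurable_compose[OF measurable_Pair1' T]) (auto simp: Q_def space_pair_measure)
      then have "(\<lambda>p. indicator X (?T ((w, u, v), p)) :: ennreal) \<in> borel_measurable (A \<Otimes>\<^sub>M B)"
        by measurable
      from B.nn_integral_fst[OF this]
      show "(\<integral>\<^sup>+p. indicator X (?T ((w, u, v), p)) \<partial>(A \<Otimes>\<^sub>M B)) = (\<integral>\<^sup>+x. \<integral>\<^sup>+y. indicator X (w, u(l := x), v(i := y)) \<partial>B \<partial>A)"
        by simp
    qed
    \<comment> \<open>Exchanging \<open>x\<close> and \<open>v\<close> puts \<open>y\<close> next to
      \<open>v\<close>, so that the update of \<open>v\<close> can be absorbed before the update of
      \<open>u\<close>.\<close>
    also have "\<dots> = (\<integral>\<^sup>+w. \<integral>\<^sup>+u. \<integral>\<^sup>+x. \<integral>\<^sup>+v. \<integral>\<^sup>+y. indicator X (w, u(l := x), v(i := y)) \<partial>B \<partial>?PB \<partial>A \<partial>?PA \<partial>W)"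
    proof (intro nn_integral_cong PBA.Fubini')
      fix w u assume sp: "w \<in> space W" "u \<in> space ?PA"
      then show "(\<lambda>(x, v). \<integral>\<^sup>+y. indicator X (w, u(l := x), v(i := y)) \<partial>B) \<in> borel_measurable (A \<Otimes>\<^sub>M ?PB)"
        using i1 sp by measurable
    qed
    also have "\<dots> = (\<integral>\<^sup>+w. \<integral>\<^sup>+u. \<integral>\<^sup>+x. \<integral>\<^sup>+v. indicator X (w, u(l := x), v) \<partial>?PB \<partial>A \<partial>?PA \<partial>W)"
    proof (rule nn_integral_cong, rule nn_integral_cong, rule nn_integral_cong)
      fix w u x assume sp: "w \<in> space W" "u \<in> space ?PA" "x \<in> space A"
      then have "(\<lambda>v. indicator X (w, u(l := x), v) :: ennreal) \<in> borel_measurable ?PB"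
        using i1 by measurable
      from nn_integral_PiM_upd[OF B this, of i, symmetric]
      show "(\<integral>\<^sup>+v. \<integral>\<^sup>+y. indicator X (w, u(l := x), v(i := y)) \<partial>B \<partial>?PB) = (\<integral>\<^sup>+v. indicator X (w, u(l := x), v) \<partial>?PB)" .
    qed
    also have "\<dots> = (\<integral>\<^sup>+w. \<integral>\<^sup>+u. \<integral>\<^sup>+v. indicator X (w, u, v) \<partial>?PB \<partial>?PA \<partial>W)"
    proof (rule nn_integral_cong)
      fix w assume sp: "w \<in> space W"
      then have "(\<lambda>u. \<integral>\<^sup>+v. indicator X (w, u, v) \<partial>?PB) \<in> borel_measurable ?PA"
        using i1 by measurable
      from nn_integral_PiM_upd[OF A this, of l, symmetric]
      show "(\<integral>\<^sup>+u. \<integral>\<^sup>+x. \<integral>\<^sup>+v. indicator X (w, u(l := x), v) \<partial>?PB \<partial>A \<partial>?PA) = (\<integral>\<^sup>+u. \<integral>\<^sup>+v. indicator X (w, u, v) \<partial>?PB \<partial>?PA)" .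
    qed
    also have "\<dots> = (\<integral>\<^sup>+q. indicator X q \<partial>Q)" by (rule Q_int[symmetric]) measurable
    also have "\<dots> = emeasure Q X" by simp
    finally show "emeasure (distr (Q \<Otimes>\<^sub>M (A \<Otimes>\<^sub>M B)) Q ?T) X = emeasure Q X" .
  qed simp
qed

text \<open>Exposes an explicit integral over the two endpoints \<open>u l\<close> and
  \<open>v i\<close> of an edge while all other coordinates stay frozen. Both the identity for
  kernel squares and the weak limit of residuals are read off from this inner integral.\<close>

lemma integral_resample:
  fixes W :: "'w measure" and A :: "'a measure" and B :: "'b measure" and l :: 'i and i :: 'k and \<Phi> :: "_ \<Rightarrow> real"
  assumes W: "prob_space W" and A: "prob_space A" and B: "prob_space B"
  defines "Q \<equiv> W \<Otimes>\<^sub>M PiM UNIV (\<lambda>_::'i. A) \<Otimes>\<^sub>M PiM UNIV (\<lambda>_::'k. B)"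
  assumes \<Phi>: "\<Phi> \<in> borel_measurable Q" "\<And>q. q \<in> space Q \<Longrightarrow> \<bar>\<Phi> q\<bar> \<le> c"
  shows "(\<integral>q. \<Phi> q \<partial>Q) = (\<integral>(w, u, v). (\<integral>(x, y). \<Phi> (w, u(l := x), v(i := y)) \<partial>(A \<Otimes>\<^sub>M B)) \<partial>Q)"
proof -
  interpret W: prob_space W by fact
  interpret A: prob_space A by fact
  interpret B: prob_space B by fact
  interpret PA: prob_space "PiM UNIV (\<lambda>_::'i. A)" using A by (intro prob_space_PiM)
  interpret PB: prob_space "PiM UNIV (\<lambda>_::'k. B)" using B by (intro prob_space_PiM)
  interpret PAPB: prob_space "PiM UNIV (\<lambda>_::'i. A) \<Otimes>\<^sub>M PiM UNIV (\<lambda>_::'k. B)" by (intro prob_space_pair) unfold_locales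
  interpret Q: prob_space Q unfolding Q_def by (intro prob_space_pair) unfold_locales
  interpret AB: prob_space "A \<Otimes>\<^sub>M B" by (intro prob_space_pair) unfold_locales
  interpret QAB: pair_prob_space Q "A \<Otimes>\<^sub>M B" ..
  interpret QABp: prob_space "Q \<Otimes>\<^sub>M (A \<Otimes>\<^sub>M B)" by (intro prob_space_pair) unfold_locales
  note T = distr_resample[OF W A B, where l=l and i=i, folded Q_def]
  have "(\<integral>q. \<Phi> q \<partial>Q) = (\<integral>p. \<Phi> (case p of ((w, u, v), (x, y)) \<Rightarrow> (w, u(l := x), v(i := y))) \<partial>(Q \<Otimes>\<^sub>M (A \<Otimes>\<^sub>M B)))"
    by (subst T(2)[symmetric], subst integral_distr[OF T(1) \<Phi>(1)]) (simp add: case_prod_unfold)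
  also have "\<dots> = (\<integral>q. (\<integral>p. \<Phi> (case (q, p) of ((w, u, v), (x, y)) \<Rightarrow> (w, u(l := x), v(i := y))) \<partial>(A \<Otimes>\<^sub>M B)) \<partial>Q)"
    by (rule QAB.integral_fst'[symmetric], rule finite_measure.integrable_bounded[OF prob_space.finite_measure[OF prob_space_pair[OF Q.prob_space_axioms AB.prob_space_axioms]], where B=c])
      (use \<Phi> measurable_compose[OF T(1) \<Phi>(1)] measurable_space[OF T(1)] in \<open>auto simp: case_prod_unfold\<close>)
  finally show ?thesis by (simp add: case_prod_unfold)
qed

section \<open>Weak convergence of kernels\<close>

text \<open>The class is closed under products, sections and partial integrals, so every use of
  Fubini below finds its integrability condition by closure rules. Boundedness is asked only on
  \<open>space M\<close>, where the kernels are controlled.\<close>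

definition bounded_meas :: "'a measure \<Rightarrow> ('a \<Rightarrow> real) \<Rightarrow> bool" where
  "bounded_meas M f \<longleftrightarrow> f \<in> borel_measurable M \<and> (\<exists>c. \<forall>x\<in>space M. \<bar>f x\<bar> \<le> c)"

lemma bounded_measI:
  "f \<in> borel_measurable M \<Longrightarrow> (\<And>x. x \<in> space M \<Longrightarrow> \<bar>f x\<bar> \<le> c) \<Longrightarrow> bounded_meas M f"
  by (auto simp: bounded_meas_def)

lemma bounded_meas_measurable: "bounded_meas M f \<Longrightarrow> f \<in> borel_measurable M"
  by (simp add: bounded_meas_def)

lemma bounded_meas_const: "bounded_meas M (\<lambda>_. c)"
  by (auto simp: bounded_meas_def)

lemma bounded_meas_diff:
  assumes "bounded_meas M f" "bounded_meas M g"
  shows "bounded_meas M (\<lambda>x. f x - g x)"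
proof -
  from assms obtain c d where "\<And>x. x \<in> space M \<Longrightarrow> \<bar>f x\<bar> \<le> c" "\<And>x. x \<in> space M \<Longrightarrow> \<bar>g x\<bar> \<le> d"
    and [measurable]: "f \<in> borel_measurable M" "g \<in> borel_measurable M"
    unfolding bounded_meas_def by blast
  then show ?thesis by (intro bounded_measI[where c="c + d"]) (auto, smt (verit))
qed

lemma bounded_meas_mult:
  assumes "bounded_meas M f" "bounded_meas M g"
  shows "bounded_meas M (\<lambda>x. f x * g x)"
proof -
  from assms obtain c d where "\<And>x. x \<in> space M \<Longrightarrow> \<bar>f x\<bar> \<le> c" "\<And>x. x \<in> space M \<Longrightarrow> \<bar>g x\<bar> \<le> d"
    and [measurable]: "f \<in> borel_measurable M" "g \<in> borel_measurable M"
    unfolding bounded_meas_def by blast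
  moreover from this have "\<bar>f x * g x\<bar> \<le> max c 0 * max d 0" if "x \<in> space M" for x
    unfolding abs_mult using that by (intro mult_mono) (auto simp: le_max_iff_disj)
  ultimately show ?thesis by (intro bounded_measI[where c="max c 0 * max d 0"]) auto
qed

lemma bounded_meas_power2: "bounded_meas M f \<Longrightarrow> bounded_meas M (\<lambda>x. (f x)\<^sup>2)"
  unfolding power2_eq_square by (rule bounded_meas_mult)

lemma bounded_meas_compose:
  assumes "bounded_meas N f" "g \<in> measurable M N"
  shows "bounded_meas M (\<lambda>x. f (g x))"
  using assms measurable_space[OF assms(2)] by (auto simp: bounded_meas_def)

lemma (in finite_measure) bounded_meas_integrable: "bounded_meas M f \<Longrightarrow> integrable M f"
  by (auto simp: bounded_meas_def intro: integrable_bounded)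

text \<open>If \<open>f\<close> is not integrable, its integral is 0 by convention, and
  \<open>c\<close> is nonnegative because a probability space has a point.\<close>

lemma (in prob_space) abs_integral_le:
  fixes f :: "'a \<Rightarrow> real"
  assumes "\<And>x. x \<in> space M \<Longrightarrow> \<bar>f x\<bar> \<le> c"
  shows "\<bar>\<integral>x. f x \<partial>M\<bar> \<le> c"
proof (cases "integrable M f")
  case True
  have "\<bar>\<integral>x. f x \<partial>M\<bar> \<le> (\<integral>x. \<bar>f x\<bar> \<partial>M)" by (rule integral_abs_bound)
  also have "\<dots> \<le> (\<integral>x. c \<partial>M)" using True assms by (intro integral_mono) auto
  finally show ?thesis by (simp add: prob_space)
next
  case False
  obtain x where "x \<in> space M" using not_empty by auto
  then show ?thesis using assms[of x] False by (simp add: not_integrable_integral_eq)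
qed

lemma (in prob_space) bounded_meas_integral:
  assumes "bounded_meas (N \<Otimes>\<^sub>M M) (\<lambda>(y, x). f y x)"
  shows "bounded_meas N (\<lambda>y. \<integral>x. f y x \<partial>M)"
proof -
  from assms obtain c where c: "\<And>y x. y \<in> space N \<Longrightarrow> x \<in> space M \<Longrightarrow> \<bar>f y x\<bar> \<le> c"
    and [measurable]: "(\<lambda>(y, x). f y x) \<in> borel_measurable (N \<Otimes>\<^sub>M M)"
    by (auto simp: bounded_meas_def space_pair_measure)
  show ?thesis
    by (rule bounded_measI[where c=c]) (use c in \<open>auto intro: abs_integral_le\<close>)
qed

lemma (in prob_space) integral_power2_le:
  fixes f :: "'a \<Rightarrow> real"
  assumes "bounded_meas M f"
  shows "(\<integral>x. f x \<partial>M)\<^sup>2 \<le> (\<integral>x. (f x)\<^sup>2 \<partial>M)"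
  using variance_eq[of f] variance_positive[of f] assms
  by (simp add: bounded_meas_integrable bounded_meas_power2)

text \<open>With F the operator of \<open>f\<close> from L2(B) to L2(A), \<open>y = F x\<close> and
  \<open>z = F* y\<close>. Expanding the square, the mixed term is \<open>- 2 * |F x|^2\<close> and
  the last one at most \<open>|F x|^2\<close>, which leaves a gain of one full
  \<open>|F x|^2\<close>.\<close>

lemma residual_step:
  fixes f :: "'a \<Rightarrow> 'b \<Rightarrow> real" and x :: "'b \<Rightarrow> real"
  assumes A: "prob_space A" and B: "prob_space B"
    and f: "bounded_meas (A \<Otimes>\<^sub>M B) (\<lambda>(u, v). f u v)"
    and f1: "\<And>u v. u \<in> space A \<Longrightarrow> v \<in> space B \<Longrightarrow> \<bar>f u v\<bar> \<le> 1"
    and x: "bounded_meas B x"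
  defines "y \<equiv> \<lambda>u. \<integral>v. f u v * x v \<partial>B"
  defines "z \<equiv> \<lambda>v. \<integral>u. f u v * y u \<partial>A"
  shows "bounded_meas A y" "bounded_meas B z" "(\<integral>v. (x v - z v)\<^sup>2 \<partial>B) + (\<integral>u. (y u)\<^sup>2 \<partial>A) \<le> (\<integral>v. (x v)\<^sup>2 \<partial>B)"
proof -
  interpret A: prob_space A by fact
  interpret B: prob_space B by fact
  interpret AB: pair_prob_space A B ..
  have snd: "bounded_meas (A \<Otimes>\<^sub>M B) (\<lambda>(u, v). x v)"
    unfolding case_prod_unfold by (rule bounded_meas_compose[OF x measurable_snd])
  show y: "bounded_meas A y"
    unfolding y_def using bounded_meas_mult[OF f snd]
    by (intro B.bounded_meas_integral) (simp add: case_prod_unfold)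
  have fst: "bounded_meas (A \<Otimes>\<^sub>M B) (\<lambda>(u, v). y u)"
    unfolding case_prod_unfold by (rule bounded_meas_compose[OF y measurable_fst])
  have fy: "bounded_meas (A \<Otimes>\<^sub>M B) (\<lambda>(u, v). f u v * y u)"
    using bounded_meas_mult[OF f fst] by (simp add: case_prod_unfold)
  have fy': "bounded_meas (B \<Otimes>\<^sub>M A) (\<lambda>(v, u). f u v * y u)"
    using bounded_meas_compose[OF fy measurable_pair_swap'] by (simp add: case_prod_unfold)
  show z: "bounded_meas B z"
    unfolding z_def using fy' by (rule A.bounded_meas_integral)
  have xz: "(\<integral>v. x v * z v \<partial>B) = (\<integral>u. (y u)\<^sup>2 \<partial>A)"
  proof -
    have "(\<integral>v. x v * z v \<partial>B) = (\<integral>v. (\<integral>u. x v * (f u v * y u) \<partial>A) \<partial>B)"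
      by (simp add: z_def)
    also have "\<dots> = (\<integral>u. (\<integral>v. x v * (f u v * y u) \<partial>B) \<partial>A)"
      by (rule AB.Fubini_integral)
        (use bounded_meas_mult[OF snd fy] in \<open>simp add: AB.bounded_meas_integrable case_prod_unfold\<close>)
    also have "\<dots> = (\<integral>u. (\<integral>v. y u * (f u v * x v) \<partial>B) \<partial>A)" by (simp add: ac_simps)
    also have "\<dots> = (\<integral>u. (y u)\<^sup>2 \<partial>A)" by (simp add: y_def power2_eq_square)
    finally show ?thesis .
  qed
  \<comment> \<open>The adjoint is a contraction: Jensen and
    \<open>\<bar>f u v\<bar> \<le> 1\<close> bound \<open>(z v)\<^sup>2\<close> for each
    \<open>v\<close> separately, and averaging over \<open>v\<close> keeps the bound.\<close>
  have zz: "(\<integral>v. (z v)\<^sup>2 \<partial>B) \<le> (\<integral>u. (y u)\<^sup>2 \<partial>A)"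
  proof -
    have "(z v)\<^sup>2 \<le> (\<integral>u. (y u)\<^sup>2 \<partial>A)" if v: "v \<in> space B" for v
    proof -
      have bm: "bounded_meas A (\<lambda>u. f u v * y u)"
        using bounded_meas_compose[OF fy measurable_Pair2'[OF v]] by simp
      have "(z v)\<^sup>2 \<le> (\<integral>u. (f u v * y u)\<^sup>2 \<partial>A)"
        unfolding z_def by (rule A.integral_power2_le[OF bm])
      also have "\<dots> \<le> (\<integral>u. (y u)\<^sup>2 \<partial>A)"
      proof (intro integral_mono)
        fix u assume "u \<in> space A"
        then have "(f u v)\<^sup>2 \<le> 1" using f1[OF _ v] by (simp add: abs_square_le_1)
        then show "(f u v * y u)\<^sup>2 \<le> (y u)\<^sup>2"
          unfolding power_mult_distrib by (intro mult_left_le_one_le) auto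
      qed (use bm y in \<open>auto intro: A.bounded_meas_integrable bounded_meas_power2\<close>)
      finally show ?thesis .
    qed
    then have "(\<integral>v. (z v)\<^sup>2 \<partial>B) \<le> (\<integral>v. (\<integral>u. (y u)\<^sup>2 \<partial>A) \<partial>B)"
      using z by (intro integral_mono B.bounded_meas_integrable bounded_meas_power2 bounded_meas_const)
    then show ?thesis by (simp add: B.prob_space)
  qed
  have "(\<integral>v. (x v - z v)\<^sup>2 \<partial>B) = (\<integral>v. (x v)\<^sup>2 + (z v)\<^sup>2 - 2 * (x v * z v) \<partial>B)"
    by (simp add: power2_diff mult.assoc)
  also have "\<dots> = (\<integral>v. (x v)\<^sup>2 \<partial>B) + (\<integral>v. (z v)\<^sup>2 \<partial>B) - 2 * (\<integral>v. x v * z v \<partial>B)"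
    using x z by (subst Bochner_Integration.integral_diff Bochner_Integration.integral_add;
        simp add: B.bounded_meas_integrable bounded_meas_power2 bounded_meas_mult)+
  finally show "(\<integral>v. (x v - z v)\<^sup>2 \<partial>B) + (\<integral>u. (y u)\<^sup>2 \<partial>A) \<le> (\<integral>v. (x v)\<^sup>2 \<partial>B)"
    using xz zz by linarith
qed

text \<open>A sequence bounded in L2 is tested by an L2-closed set of functions: the error of
  replacing \<open>b\<close> by \<open>b'\<close> is controlled uniformly in
  \<open>n\<close>.\<close>

lemma weak_null_closure:
  fixes h :: "nat \<Rightarrow> 'a \<Rightarrow> real"
  assumes M: "prob_space M" and h: "\<And>n. bounded_meas M (h n)" and h1: "\<And>n. (\<integral>p. (h n p)\<^sup>2 \<partial>M) \<le> 1"
    and b: "bounded_meas M b"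
    and approx: "\<And>\<epsilon>. 0 < \<epsilon> \<Longrightarrow> \<exists>b'. bounded_meas M b' \<and> (\<lambda>n. \<integral>p. h n p * b' p \<partial>M) \<longlonglongrightarrow> 0 \<and> (\<integral>p. (b p - b' p)\<^sup>2 \<partial>M) \<le> \<epsilon>\<^sup>2"
  shows "(\<lambda>n. \<integral>p. h n p * b p \<partial>M) \<longlonglongrightarrow> 0"
proof (rule LIMSEQ_I)
  interpret prob_space M by fact
  fix r :: real assume "0 < r"
  then obtain b' where b': "bounded_meas M b'" "(\<lambda>n. \<integral>p. h n p * b' p \<partial>M) \<longlonglongrightarrow> 0"
    and d: "(\<integral>p. (b p - b' p)\<^sup>2 \<partial>M) \<le> (r / 2)\<^sup>2"
    using approx[of "r / 2"] by auto
  have "\<exists>N. \<forall>n\<ge>N. norm ((\<integral>p. h n p * b' p \<partial>M) - 0) < r / 2"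
    using \<open>0 < r\<close> by (intro LIMSEQ_D[OF b'(2)]) simp
  then obtain N where N: "\<And>n. n \<ge> N \<Longrightarrow> \<bar>\<integral>p. h n p * b' p \<partial>M\<bar> < r / 2" by auto
  have "\<bar>\<integral>p. h n p * b p \<partial>M\<bar> < r" if "n \<ge> N" for n
  proof -
    let ?d = "\<lambda>p. b p - b' p"
    have bm: "bounded_meas M ?d" by (rule bounded_meas_diff[OF b b'(1)])
    have "(\<integral>p. h n p * b p \<partial>M) = (\<integral>p. h n p * b' p + h n p * ?d p \<partial>M)" by (simp add: algebra_simps)
    also have "\<dots> = (\<integral>p. h n p * b' p \<partial>M) + (\<integral>p. h n p * ?d p \<partial>M)"
      by (intro Bochner_Integration.integral_add bounded_meas_integrable bounded_meas_mult h b' bm)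
    finally have e: "(\<integral>p. h n p * b p \<partial>M) = (\<integral>p. h n p * b' p \<partial>M) + (\<integral>p. h n p * ?d p \<partial>M)" .
    have "\<bar>\<integral>p. h n p * ?d p \<partial>M\<bar> \<le> (\<integral>p. \<bar>h n p * ?d p\<bar> \<partial>M)" by (rule integral_abs_bound)
    \<comment> \<open>Young's inequality, weighted so that the two bounds 1 and
      \<open>(r / 2)\<^sup>2\<close> contribute \<open>r / 4\<close> each. The remaining
      \<open>r / 2\<close> is left for the test function \<open>b'\<close>.\<close>
    also have "\<dots> \<le> (\<integral>p. (r / 4) * (h n p)\<^sup>2 + (1 / r) * (?d p)\<^sup>2 \<partial>M)"
    proof (rule integral_mono)
      fix p
      have "0 \<le> (r / 2 * \<bar>h n p\<bar> - \<bar>?d p\<bar>)\<^sup>2" by simp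
      then have "0 \<le> (1 / r) * (r / 2 * \<bar>h n p\<bar> - \<bar>?d p\<bar>)\<^sup>2" using \<open>0 < r\<close> by simp
      also have "\<dots> = (r / 4) * (h n p)\<^sup>2 + (1 / r) * (?d p)\<^sup>2 - \<bar>h n p\<bar> * \<bar>?d p\<bar>"
        using \<open>0 < r\<close> by (simp add: power2_diff power2_eq_square field_simps)
      finally show "\<bar>h n p * ?d p\<bar> \<le> (r / 4) * (h n p)\<^sup>2 + (1 / r) * (?d p)\<^sup>2" by (simp add: abs_mult)
    qed (intro integrable_abs Bochner_Integration.integrable_add integrable_mult_right bounded_meas_integrable bounded_meas_mult bounded_meas_power2 h bm)+
    also have "\<dots> = (r / 4) * (\<integral>p. (h n p)\<^sup>2 \<partial>M) + (1 / r) * (\<integral>p. (?d p)\<^sup>2 \<partial>M)"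
      by (simp add: bounded_meas_integrable bounded_meas_power2 h bm)
    also have "\<dots> \<le> (r / 4) * 1 + (1 / r) * (r / 2)\<^sup>2"
      using \<open>0 < r\<close> h1[of n] d by (intro add_mono mult_left_mono) auto
    also have "\<dots> = r / 2" using \<open>0 < r\<close> by (simp add: power2_eq_square field_simps)
    finally show ?thesis using N[OF that] e by linarith
  qed
  then show "\<exists>N. \<forall>n\<ge>N. norm ((\<integral>p. h n p * b p \<partial>M) - 0) < r" by auto
qed

text \<open>A pi-lambda argument passes from rectangles to measurable sets, and step functions pass
  from sets to bounded functions. Both limits, countable unions and vanishing mesh, use the
  L2-closure of the set of test functions.\<close>

lemma weak_null_from_rectangles:
  fixes h :: "nat \<Rightarrow> 'a \<times> 'b \<Rightarrow> real"
  assumes A: "prob_space A" and B: "prob_space B"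
    and h: "\<And>n. bounded_meas (A \<Otimes>\<^sub>M B) (h n)" and h1: "\<And>n. (\<integral>p. (h n p)\<^sup>2 \<partial>(A \<Otimes>\<^sub>M B)) \<le> 1"
    and rect: "\<And>X Y. X \<in> sets A \<Longrightarrow> Y \<in> sets B \<Longrightarrow> (\<lambda>n. \<integral>p. h n p * indicator (X \<times> Y) p \<partial>(A \<Otimes>\<^sub>M B)) \<longlonglongrightarrow> 0"
    and b: "bounded_meas (A \<Otimes>\<^sub>M B) b"
  shows "(\<lambda>n. \<integral>p. h n p * b p \<partial>(A \<Otimes>\<^sub>M B)) \<longlonglongrightarrow> 0"
proof -
  let ?M = "A \<Otimes>\<^sub>M B"
  interpret A: prob_space A by fact
  interpret B: prob_space B by fact
  interpret M: pair_prob_space A B ..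
  have M: "prob_space ?M" by unfold_locales
  have bm_ind: "bounded_meas ?M (indicator X)" if "X \<in> sets ?M" for X
    using that by (intro bounded_measI[where c=1]) (auto simp: indicator_def)
  have sets: "(\<lambda>n. \<integral>p. h n p * indicator X p \<partial>?M) \<longlonglongrightarrow> 0" if "X \<in> sets ?M" for X
  proof -
    have sets_M: "sets ?M = sigma_sets (space A \<times> space B) {a \<times> b | a b. a \<in> sets A \<and> b \<in> sets B}"
      by (rule sets_pair_measure)
    have Pow: "{a \<times> b | a b. a \<in> sets A \<and> b \<in> sets B} \<subseteq> Pow (space A \<times> space B)"
      by (rule pair_measure_closed)
    from Int_stable_pair_measure_generator Pow that[unfolded sets_M] show ?thesis
    proof (induction rule: sigma_sets_induct_disjoint)
      case (basic X)
      then show ?case using rect by auto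
    next
      case empty
      then show ?case by simp
    next
      case (compl X)
      then have X: "X \<in> sets ?M" by (simp add: sets_M)
      have top: "(\<lambda>n. \<integral>p. h n p * indicator (space A \<times> space B) p \<partial>?M) \<longlonglongrightarrow> 0"
        by (rule rect) auto
      have e: "(\<integral>p. h n p * indicator (space A \<times> space B - X) p \<partial>?M) =
          (\<integral>p. h n p * indicator (space A \<times> space B) p \<partial>?M) - (\<integral>p. h n p * indicator X p \<partial>?M)" for n
      proof -
        have "(\<integral>p. h n p * indicator (space A \<times> space B - X) p \<partial>?M) =
          (\<integral>p. h n p * indicator (space A \<times> space B) p - h n p * indicator X p \<partial>?M)"
          using sets.sets_into_space[OF X]
          by (intro Bochner_Integration.integral_cong) (auto simp: indicator_def space_pair_measure)
        also have "\<dots> = (\<integral>p. h n p * indicator (space A \<times> space B) p \<partial>?M) - (\<integral>p. h n p * indicator X p \<partial>?M)"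
          using X by (intro Bochner_Integration.integral_diff M.bounded_meas_integrable bounded_meas_mult h bm_ind) auto
        finally show ?thesis .
      qed
      show ?case unfolding e using tendsto_diff[OF top compl(2)] by simp
    next
      \<comment> \<open>Weak convergence along each \<open>X i\<close> is not uniform in
        \<open>i\<close>, so the sum over \<open>i\<close> cannot be exchanged with the limit
        directly. Finite partial unions approximate the whole union in L2, since the measure of the
        remainder tends to 0.\<close>
      case (union X)
      have Xm: "X i \<in> sets ?M" for i using union(2) by (auto simp: sets_M)
      show ?case
      proof (rule weak_null_closure[OF M h h1])
        show "bounded_meas ?M (indicator (\<Union> (range X)))" using Xm by (intro bm_ind) auto
        fix \<epsilon> :: real assume "0 < \<epsilon>"
        let ?Y = "\<lambda>N. \<Union>i<N. X i"
        have "(\<lambda>N. measure ?M (?Y N)) \<longlonglongrightarrow> measure ?M (\<Union>N. ?Y N)"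
          using Xm by (intro M.finite_Lim_measure_incseq incseq_SucI) (auto intro: less_SucI)
        also have "(\<Union>N. ?Y N) = \<Union> (range X)" by auto
        finally have "(\<lambda>N. measure ?M (\<Union> (range X)) - measure ?M (?Y N)) \<longlonglongrightarrow> 0"
          using tendsto_diff[OF tendsto_const[of "measure ?M (\<Union> (range X))"]] by fastforce
        moreover have "0 < \<epsilon>\<^sup>2" using \<open>0 < \<epsilon>\<close> by simp
        ultimately have "\<forall>\<^sub>F N in sequentially. measure ?M (\<Union> (range X)) - measure ?M (?Y N) < \<epsilon>\<^sup>2"
          by (rule order_tendstoD(2))
        then have "\<exists>N. measure ?M (\<Union> (range X)) - measure ?M (?Y N) < \<epsilon>\<^sup>2"
          by (rule eventually_happens'[OF sequentially_bot])
        then obtain N where N: "measure ?M (\<Union> (range X)) - measure ?M (?Y N) < \<epsilon>\<^sup>2" ..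
        have ind: "indicator (?Y N) p = (\<Sum>i<N. indicator (X i) p :: real)" for p
          using union(1) by (intro indicator_UN_disjoint) (auto simp: disjoint_family_on_def)
        have "(\<lambda>n. \<integral>p. h n p * indicator (?Y N) p \<partial>?M) = (\<lambda>n. \<Sum>i<N. \<integral>p. h n p * indicator (X i) p \<partial>?M)"
          unfolding ind sum_distrib_left
          by (intro ext Bochner_Integration.integral_sum M.bounded_meas_integrable bounded_meas_mult h bm_ind Xm)
        also have "\<dots> \<longlonglongrightarrow> 0" using tendsto_sum[of "{..<N}", OF union(3)] by simp
        finally have lim: "(\<lambda>n. \<integral>p. h n p * indicator (?Y N) p \<partial>?M) \<longlonglongrightarrow> 0" .
        have "(\<integral>p. (indicator (\<Union> (range X)) p - indicator (?Y N) p :: real)\<^sup>2 \<partial>?M) = (\<integral>p. indicator (\<Union> (range X) - ?Y N) p \<partial>?M)"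
          by (intro Bochner_Integration.integral_cong) (auto simp: indicator_def)
        also have "\<dots> = measure ?M (\<Union> (range X)) - measure ?M (?Y N)"
          using Xm sets.sets_into_space[OF Xm] by (subst M.finite_measure_Diff[symmetric]) (auto simp: Int_absorb2)
        finally show "\<exists>b'. bounded_meas ?M b' \<and> (\<lambda>n. \<integral>p. h n p * b' p \<partial>?M) \<longlonglongrightarrow> 0 \<and>
            (\<integral>p. (indicator (\<Union> (range X)) p - b' p)\<^sup>2 \<partial>?M) \<le> \<epsilon>\<^sup>2"
          using lim N Xm by (intro exI[of _ "indicator (?Y N)"]) (auto intro!: bm_ind)
      qed
    qed
  qed
  obtain c where c: "\<And>p. p \<in> space ?M \<Longrightarrow> \<bar>b p\<bar> \<le> c" and [measurable]: "b \<in> borel_measurable ?M"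
    using b by (auto simp: bounded_meas_def)
  show ?thesis
  proof (rule weak_null_closure[OF M h h1 b])
    fix \<epsilon> :: real assume "0 < \<epsilon>"
    define K where "K = \<lceil>c / \<epsilon>\<rceil> + 1"
    define E where "E k = {p \<in> space ?M. \<lfloor>b p / \<epsilon>\<rfloor> = k}" for k
    have E[measurable]: "E k \<in> sets ?M" for k unfolding E_def by measurable
    \<comment> \<open>\<open>b\<close> rounded down to a multiple of \<open>\<epsilon>\<close>; the
      range of levels up to \<open>K\<close> contains all values because
      \<open>\<bar>b\<bar> \<le> c\<close>.\<close>
    define b' where "b' p = (\<Sum>k\<in>{-K..K}. (\<epsilon> * of_int k) * indicator (E k) p)" for p
    have b'_eq: "b' p = \<epsilon> * of_int \<lfloor>b p / \<epsilon>\<rfloor>" if p: "p \<in> space ?M" for p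
    proof -
      have "b p / \<epsilon> \<le> c / \<epsilon>" "- (c / \<epsilon>) \<le> b p / \<epsilon>"
        using c[OF p] \<open>0 < \<epsilon>\<close> by (auto simp: abs_le_iff field_simps)
      then have "\<lfloor>b p / \<epsilon>\<rfloor> \<in> {-K..K}" unfolding K_def atLeastAtMost_iff by linarith
      moreover have "b' p = (\<Sum>k\<in>{-K..K}. if k = \<lfloor>b p / \<epsilon>\<rfloor> then \<epsilon> * of_int k else 0)"
        unfolding b'_def using p by (intro sum.cong) (auto simp: E_def indicator_def)
      ultimately show ?thesis by simp
    qed
    have diff: "\<bar>b p - b' p\<bar> \<le> \<epsilon>" if p: "p \<in> space ?M" for p
    proof -
      have "b p - b' p = \<epsilon> * (b p / \<epsilon> - of_int \<lfloor>b p / \<epsilon>\<rfloor>)"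
        unfolding b'_eq[OF p] using \<open>0 < \<epsilon>\<close> by (simp add: right_diff_distrib)
      moreover have "0 \<le> b p / \<epsilon> - of_int \<lfloor>b p / \<epsilon>\<rfloor>" "b p / \<epsilon> - of_int \<lfloor>b p / \<epsilon>\<rfloor> \<le> 1" by linarith+
      ultimately show ?thesis using \<open>0 < \<epsilon>\<close> by (simp add: abs_mult mult_left_le)
    qed
    have b': "bounded_meas ?M b'"
    proof (rule bounded_measI)
      show "b' \<in> borel_measurable ?M" unfolding b'_def[abs_def] by measurable
      fix p assume "p \<in> space ?M"
      from c[OF this] diff[OF this] show "\<bar>b' p\<bar> \<le> c + \<epsilon>" by linarith
    qed
    have "(\<integral>p. (b p - b' p)\<^sup>2 \<partial>?M) \<le> (\<integral>p. \<epsilon>\<^sup>2 \<partial>?M)"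
      using diff b b' \<open>0 < \<epsilon>\<close>
      by (intro integral_mono M.bounded_meas_integrable bounded_meas_power2 bounded_meas_diff bounded_meas_const)
        (auto simp: abs_le_square_iff[symmetric])
    then have d: "(\<integral>p. (b p - b' p)\<^sup>2 \<partial>?M) \<le> \<epsilon>\<^sup>2" by (simp add: M.prob_space)
    have "(\<lambda>n. \<integral>p. h n p * b' p \<partial>?M) = (\<lambda>n. \<Sum>k\<in>{-K..K}. (\<epsilon> * of_int k) * (\<integral>p. h n p * indicator (E k) p \<partial>?M))"
    proof
      fix n
      have "(\<integral>p. h n p * b' p \<partial>?M) = (\<integral>p. (\<Sum>k\<in>{-K..K}. (\<epsilon> * of_int k) * (h n p * indicator (E k) p)) \<partial>?M)"
        by (simp add: b'_def sum_distrib_left ac_simps)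
      also have "\<dots> = (\<Sum>k\<in>{-K..K}. \<integral>p. (\<epsilon> * of_int k) * (h n p * indicator (E k) p) \<partial>?M)"
        by (intro Bochner_Integration.integral_sum integrable_mult_right M.bounded_meas_integrable bounded_meas_mult h bm_ind E)
      finally show "(\<integral>p. h n p * b' p \<partial>?M) = (\<Sum>k\<in>{-K..K}. (\<epsilon> * of_int k) * (\<integral>p. h n p * indicator (E k) p \<partial>?M))"
        by simp
    qed
    also have "\<dots> \<longlonglongrightarrow> (\<Sum>k\<in>{-K..K}. (\<epsilon> * of_int k) * 0)"
      by (intro tendsto_sum tendsto_mult tendsto_const sets E)
    finally show "\<exists>b'. bounded_meas ?M b' \<and> (\<lambda>n. \<integral>p. h n p * b' p \<partial>?M) \<longlonglongrightarrow> 0 \<and> (\<integral>p. (b p - b' p)\<^sup>2 \<partial>?M) \<le> \<epsilon>\<^sup>2"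
      using b' d by auto
  qed
qed

section \<open>Residual kernels and their weak limit\<close>

definition kernel_square :: "'a measure \<Rightarrow> 'b measure \<Rightarrow> ('a \<Rightarrow> 'b \<Rightarrow> real) \<Rightarrow> ('a \<Rightarrow> 'b \<Rightarrow> real) \<Rightarrow> 'a \<Rightarrow> 'b \<Rightarrow> real" where
  "kernel_square A B f K u v = (\<integral>v'. f u v' * (\<integral>u'. f u' v' * K u' v \<partial>A) \<partial>B)"

text \<open>With F the operator of \<open>f\<close> and \<open>T = F F*\<close>,
  \<open>kernel_square A B f K\<close> is the kernel of \<open>T K\<close>, where T acts on the
  first argument and \<open>v\<close> is a parameter. Hence \<open>residual A B f n\<close> is the
  kernel of \<open>(1 - T)^n F\<close>.\<close>

primrec residual :: "'a measure \<Rightarrow> 'b measure \<Rightarrow> ('a \<Rightarrow> 'b \<Rightarrow> real) \<Rightarrow> nat \<Rightarrow> 'a \<Rightarrow> 'b \<Rightarrow> real" where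
  "residual A B f 0 = f"
| "residual A B f (Suc n) = (\<lambda>u v. residual A B f n u v - kernel_square A B f (residual A B f n) u v)"

lemma bounded_meas_kernel_square:
  assumes A: "prob_space A" and B: "prob_space B"
    and f: "bounded_meas (W \<Otimes>\<^sub>M A \<Otimes>\<^sub>M B) (\<lambda>(w, u, v). f w u v)"
    and K: "bounded_meas (W \<Otimes>\<^sub>M A \<Otimes>\<^sub>M B) (\<lambda>(w, u, v). K w u v)"
  shows "bounded_meas (W \<Otimes>\<^sub>M A \<Otimes>\<^sub>M B) (\<lambda>(w, u, v). kernel_square A B (f w) (K w) u v)"
proof -
  interpret A: prob_space A by fact
  interpret B: prob_space B by fact
  let ?N = "(W \<Otimes>\<^sub>M A \<Otimes>\<^sub>M B) \<Otimes>\<^sub>M B"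
  have "bounded_meas (?N \<Otimes>\<^sub>M A) (\<lambda>(((w, u, v), v'), u'). f w u' v' * K w u' v)"
    using bounded_meas_mult[OF
        bounded_meas_compose[OF f, of "\<lambda>(((w, u, v), v'), u'). (w, u', v')" "?N \<Otimes>\<^sub>M A"]
        bounded_meas_compose[OF K, of "\<lambda>(((w, u, v), v'), u'). (w, u', v)" "?N \<Otimes>\<^sub>M A"]]
    by (simp add: case_prod_unfold)
  then have 1: "bounded_meas ?N (\<lambda>((w, u, v), v'). \<integral>u'. f w u' v' * K w u' v \<partial>A)"
    using A.bounded_meas_integral[of ?N "\<lambda>((w, u, v), v') u'. f w u' v' * K w u' v"]
    by (simp add: case_prod_unfold)
  have "bounded_meas ?N (\<lambda>((w, u, v), v'). f w u v' * (\<integral>u'. f w u' v' * K w u' v \<partial>A))"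
    using bounded_meas_mult[OF bounded_meas_compose[OF f, of "\<lambda>((w, u, v), v'). (w, u, v')" ?N] 1]
    by (simp add: case_prod_unfold)
  then show ?thesis
    using B.bounded_meas_integral[of "W \<Otimes>\<^sub>M A \<Otimes>\<^sub>M B" "\<lambda>(w, u, v) v'. f w u v' * (\<integral>u'. f w u' v' * K w u' v \<partial>A)"]
    by (simp add: case_prod_unfold kernel_square_def)
qed

lemma bounded_meas_residual:
  assumes "prob_space A" "prob_space B" and f: "bounded_meas (W \<Otimes>\<^sub>M A \<Otimes>\<^sub>M B) (\<lambda>(w, u, v). f w u v)"
  shows "bounded_meas (W \<Otimes>\<^sub>M A \<Otimes>\<^sub>M B) (\<lambda>(w, u, v). residual A B (f w) n u v)"
proof (induction n)
  case (Suc n)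
  show ?case
    using bounded_meas_diff[OF Suc bounded_meas_kernel_square[OF assms Suc]]
    by (simp add: case_prod_unfold)
qed (use f in simp)

lemma bounded_meas_section:
  assumes "bounded_meas (W \<Otimes>\<^sub>M N) (\<lambda>(w, p). f w p)" "w \<in> space W"
  shows "bounded_meas N (f w)"
  using bounded_meas_compose[OF assms(1) measurable_Pair1'[OF assms(2)]] by simp

text \<open>On a rectangle the integral over \<open>Y\<close> is done before the one over
  \<open>X\<close>: by the identity \<open>(1 - F F* )^n F = F (1 - F* F)^n\<close> it equals
  \<open>F x_n\<close> for the iterates \<open>x_n\<close> of the energy estimate, and
  \<open>F x_n\<close> tends to 0 in L2. The L2 bounds supply what is needed to go from rectangles
  to bounded test functions and to dominate later limits.\<close>

lemma residual_weak_null: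
  fixes f :: "'a \<Rightarrow> 'b \<Rightarrow> real"
  assumes A: "prob_space A" and B: "prob_space B"
    and f: "bounded_meas (A \<Otimes>\<^sub>M B) (\<lambda>(u, v). f u v)"
    and f1: "\<And>u v. u \<in> space A \<Longrightarrow> v \<in> space B \<Longrightarrow> \<bar>f u v\<bar> \<le> 1"
  shows "bounded_meas (A \<Otimes>\<^sub>M B) (\<lambda>(u, v). residual A B f n u v)"
    and "v \<in> space B \<Longrightarrow> (\<integral>u. (residual A B f n u v)\<^sup>2 \<partial>A) \<le> 1"
    and "(\<integral>(u, v). (residual A B f n u v)\<^sup>2 \<partial>(A \<Otimes>\<^sub>M B)) \<le> 1"
    and "bounded_meas (A \<Otimes>\<^sub>M B) b \<Longrightarrow>
      (\<lambda>n. \<integral>p. (case p of (u, v) \<Rightarrow> residual A B f n u v) * b p \<partial>(A \<Otimes>\<^sub>M B)) \<longlonglongrightarrow> 0"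
proof -
  interpret A: prob_space A by fact
  interpret B: prob_space B by fact
  interpret AB: pair_prob_space A B ..
  let ?r = "residual A B f"
  show r: "bounded_meas (A \<Otimes>\<^sub>M B) (\<lambda>(u, v). ?r n u v)" for n
  proof -
    \<comment> \<open>The measurability lemma carries a parameter \<open>w\<close>; here
      \<open>A\<close> itself serves as a dummy parameter space and one of its points is
      fixed.\<close>
    obtain a where a: "a \<in> space A" using A.not_empty by auto
    have "bounded_meas (A \<Otimes>\<^sub>M A \<Otimes>\<^sub>M B) (\<lambda>(w, u, v). f u v)"
      using bounded_meas_compose[OF f measurable_snd] by (simp add: case_prod_unfold)
    from bounded_meas_section[OF bounded_meas_residual[OF A B this], OF a]
    show ?thesis by simp
  qed
  have r_u: "bounded_meas A (\<lambda>u. ?r n u v)" if "v \<in> space B" for n v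
    using bounded_meas_compose[OF r measurable_Pair2'[OF that]] by simp
  have r_v: "bounded_meas B (\<lambda>v. ?r n u v)" if "u \<in> space A" for n u
    using bounded_meas_compose[OF r measurable_Pair1'[OF that]] by simp
  have f_swap: "bounded_meas (B \<Otimes>\<^sub>M A) (\<lambda>(v, u). f u v)"
    using bounded_meas_compose[OF f measurable_pair_swap'] by (simp add: case_prod_unfold)
  show sq: "(\<integral>u. (?r n u v)\<^sup>2 \<partial>A) \<le> 1" if v: "v \<in> space B" for n v
  proof (induction n)
    case 0
    have "(\<integral>u. (f u v)\<^sup>2 \<partial>A) \<le> (\<integral>u. 1 \<partial>A)"
      using r_u[OF v, of 0] f1[OF _ v]
      by (intro integral_mono A.bounded_meas_integrable bounded_meas_power2 bounded_meas_const) (auto simp: abs_square_le_1)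
    then show ?case by (simp add: A.prob_space)
  next
    case (Suc n)
    have "0 \<le> (\<integral>v'. (\<integral>u'. f u' v' * ?r n u' v \<partial>A)\<^sup>2 \<partial>B)" by simp
    \<comment> \<open>For fixed \<open>v\<close> a column of the residual evolves by the same
      iteration with the two spaces exchanged, so the energy estimate is applied to the transposed
      kernel.\<close>
    moreover have "(\<integral>u. (?r n u v - (\<integral>v'. f u v' * (\<integral>u'. f u' v' * ?r n u' v \<partial>A) \<partial>B))\<^sup>2 \<partial>A)
        + (\<integral>v'. (\<integral>u'. f u' v' * ?r n u' v \<partial>A)\<^sup>2 \<partial>B) \<le> (\<integral>u. (?r n u v)\<^sup>2 \<partial>A)"
      using residual_step(3)[OF B A f_swap, of "\<lambda>u. ?r n u v"] f1 r_u[OF v] by simp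
    ultimately show ?case using Suc unfolding residual.simps kernel_square_def by linarith
  qed
  show sq2: "(\<integral>(u, v). (?r n u v)\<^sup>2 \<partial>(A \<Otimes>\<^sub>M B)) \<le> 1" for n
  proof -
    have i: "integrable (A \<Otimes>\<^sub>M B) (\<lambda>(u, v). (?r n u v)\<^sup>2)"
      using AB.bounded_meas_integrable[OF bounded_meas_power2[OF r]] by (simp add: case_prod_unfold)
    have "(\<integral>(u, v). (?r n u v)\<^sup>2 \<partial>(A \<Otimes>\<^sub>M B)) = (\<integral>v. (\<integral>u. (?r n u v)\<^sup>2 \<partial>A) \<partial>B)"
      using AB.integral_snd[OF i] by simp
    also have "\<dots> \<le> (\<integral>v. 1 \<partial>B)"
      using sq AB.integrable_snd[OF i] by (intro integral_mono) auto
    finally show ?thesis by (simp add: B.prob_space)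
  qed
  assume b: "bounded_meas (A \<Otimes>\<^sub>M B) b"
  show "(\<lambda>n. \<integral>p. (case p of (u, v) \<Rightarrow> ?r n u v) * b p \<partial>(A \<Otimes>\<^sub>M B)) \<longlonglongrightarrow> 0"
  proof (rule weak_null_from_rectangles[OF A B r _ _ b])
    show "(\<integral>p. (case p of (u, v) \<Rightarrow> ?r n u v)\<^sup>2 \<partial>(A \<Otimes>\<^sub>M B)) \<le> 1" for n
      using sq2 by (simp add: case_prod_unfold)
    fix X Y assume X: "X \<in> sets A" and Y: "Y \<in> sets B"
    \<comment> \<open>The iterates \<open>(1 - F* F)^n\<close> applied to the indicator of
      \<open>Y\<close>; \<open>y n\<close> is \<open>F\<close> applied to them.\<close>
    define x where "x = rec_nat (indicator Y :: 'b \<Rightarrow> real) (\<lambda>_ x v. x v - (\<integral>u. f u v * (\<integral>v'. f u v' * x v' \<partial>B) \<partial>A))"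
    define y where "y n u = (\<integral>v. f u v * x n v \<partial>B)" for n u
    have x0: "x 0 = indicator Y" and xSuc: "x (Suc n) v = x n v - (\<integral>u. f u v * y n u \<partial>A)" for n v
      by (simp_all add: x_def y_def)
    have x: "bounded_meas B (x n)" for n
    proof (induction n)
      case 0
      then show ?case using Y by (auto simp: x0 intro!: bounded_measI[where c=1])
    next
      case (Suc n)
      show ?case unfolding xSuc[abs_def] y_def
        by (intro bounded_meas_diff Suc residual_step(2)[OF A B f f1])
    qed
    have y: "bounded_meas A (y n)" for n
      unfolding y_def using residual_step(1)[OF A B f f1 x] by simp
    \<comment> \<open>The energy estimate telescopes: the total energy lost never exceeds the
      initial energy.\<close>
    have "(\<Sum>k<n. \<integral>u. (y k u)\<^sup>2 \<partial>A) + (\<integral>v. (x n v)\<^sup>2 \<partial>B) \<le> (\<integral>v. (x 0 v)\<^sup>2 \<partial>B)" for n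
    proof (induction n)
      case (Suc n)
      then show ?case using residual_step(3)[OF A B f f1 x, of n] by (simp add: xSuc y_def)
    qed simp
    then have "(\<Sum>k<n. \<integral>u. (y k u)\<^sup>2 \<partial>A) \<le> (\<integral>v. (x 0 v)\<^sup>2 \<partial>B)" for n
      by (smt (verit) Bochner_Integration.integral_nonneg zero_le_power2)
    then have "summable (\<lambda>k. \<integral>u. (y k u)\<^sup>2 \<partial>A)"
      by (intro summableI_nonneg_bounded) auto
    then have y0: "(\<lambda>k. \<integral>u. (y k u)\<^sup>2 \<partial>A) \<longlonglongrightarrow> 0" by (rule summable_LIMSEQ_zero)
    \<comment> \<open>The intertwining of the two iterations, proved by induction: the recursion of
      the residual acts on the \<open>u\<close> side, that of \<open>x\<close> on the
      \<open>v\<close> side, and two exchanges of integrals match them.\<close>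
    have ry: "(\<integral>v. ?r n u v * indicator Y v \<partial>B) = y n u" if "u \<in> space A" for n u
      using that
    proof (induction n arbitrary: u)
      case 0
      then show ?case by (simp add: y_def x0)
    next
      case (Suc n)
      have IY: "bounded_meas B (indicator Y :: 'b \<Rightarrow> real)" using Y by (intro bounded_measI[where c=1]) auto
      have fu: "bounded_meas B (\<lambda>v. f u v)" using r_v[OF Suc.prems, of 0] by simp
      let ?z = "\<lambda>v. \<integral>u. f u v * y n u \<partial>A"
      have z: "bounded_meas B ?z" unfolding y_def by (rule residual_step(2)[OF A B f f1 x])
      have g: "bounded_meas (B \<Otimes>\<^sub>M B) (\<lambda>(v, v'). \<integral>u'. f u' v' * ?r n u' v \<partial>A)"
      proof -
        have "bounded_meas ((B \<Otimes>\<^sub>M B) \<Otimes>\<^sub>M A) (\<lambda>((v, v'), u'). f u' v' * ?r n u' v)"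
          using bounded_meas_mult[OF
            bounded_meas_compose[OF f, of "\<lambda>((v, v'), u'). (u', v')" "(B \<Otimes>\<^sub>M B) \<Otimes>\<^sub>M A"]
            bounded_meas_compose[OF r, of "\<lambda>((v, v'), u'). (u', v)" "(B \<Otimes>\<^sub>M B) \<Otimes>\<^sub>M A" n]]
          by (simp add: case_prod_unfold)
        then show ?thesis
          using A.bounded_meas_integral[of "B \<Otimes>\<^sub>M B" "\<lambda>(v, v') u'. f u' v' * ?r n u' v"] by (simp add: case_prod_unfold)
      qed
      have fg: "bounded_meas (B \<Otimes>\<^sub>M B) (\<lambda>(v, v'). f u v' * (\<integral>u'. f u' v' * ?r n u' v \<partial>A))"
        using bounded_meas_mult[OF bounded_meas_compose[OF fu measurable_snd] g]
        by (simp add: case_prod_unfold)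
      interpret BB: pair_prob_space B B ..
      have ks: "bounded_meas B (\<lambda>v. kernel_square A B f (?r n) u v)"
        unfolding kernel_square_def using fg by (rule B.bounded_meas_integral)
      have "(\<integral>v. ?r (Suc n) u v * indicator Y v \<partial>B) =
          (\<integral>v. ?r n u v * indicator Y v - kernel_square A B f (?r n) u v * indicator Y v \<partial>B)"
        by (simp add: left_diff_distrib)
      also have "\<dots> = (\<integral>v. ?r n u v * indicator Y v \<partial>B) - (\<integral>v. kernel_square A B f (?r n) u v * indicator Y v \<partial>B)"
        by (intro Bochner_Integration.integral_diff B.bounded_meas_integrable bounded_meas_mult r_v Suc.prems IY ks)
      also have "(\<integral>v. kernel_square A B f (?r n) u v * indicator Y v \<partial>B) =
          (\<integral>v. (\<integral>v'. f u v' * (\<integral>u'. f u' v' * ?r n u' v \<partial>A) * indicator Y v \<partial>B) \<partial>B)"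
        by (simp add: kernel_square_def)
      also have "\<dots> = (\<integral>v'. (\<integral>v. f u v' * (\<integral>u'. f u' v' * ?r n u' v \<partial>A) * indicator Y v \<partial>B) \<partial>B)"
        using bounded_meas_mult[OF fg bounded_meas_compose[OF IY measurable_fst]]
        by (intro BB.Fubini_integral[symmetric] BB.bounded_meas_integrable) (simp add: case_prod_unfold)
      also have "\<dots> = (\<integral>v'. f u v' * (\<integral>v. (\<integral>u'. f u' v' * ?r n u' v * indicator Y v \<partial>A) \<partial>B) \<partial>B)"
        by (simp only: integral_mult_left_zero) (simp only: mult.assoc integral_mult_right_zero)
      also have "\<dots> = (\<integral>v'. f u v' * (\<integral>u'. (\<integral>v. f u' v' * ?r n u' v * indicator Y v \<partial>B) \<partial>A) \<partial>B)"
      proof (rule Bochner_Integration.integral_cong[OF refl])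
        fix v' assume v': "v' \<in> space B"
        have fv: "bounded_meas A (\<lambda>u. f u v')" using r_u[OF v', of 0] by simp
        have "bounded_meas (A \<Otimes>\<^sub>M B) (\<lambda>(u', v). f u' v' * ?r n u' v * indicator Y v)"
          using bounded_meas_mult[OF bounded_meas_mult[OF bounded_meas_compose[OF fv measurable_fst] r]
              bounded_meas_compose[OF IY measurable_snd]]
          by (simp add: case_prod_unfold)
        then show "f u v' * (\<integral>v. (\<integral>u'. f u' v' * ?r n u' v * indicator Y v \<partial>A) \<partial>B) =
            f u v' * (\<integral>u'. (\<integral>v. f u' v' * ?r n u' v * indicator Y v \<partial>B) \<partial>A)"
          by (subst AB.Fubini_integral) (auto intro: AB.bounded_meas_integrable)
      qed
      also have "\<dots> = (\<integral>v'. f u v' * (\<integral>u'. f u' v' * y n u' \<partial>A) \<partial>B)"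
      proof -
        have "(\<integral>u'. (\<integral>v. f u' v' * ?r n u' v * indicator Y v \<partial>B) \<partial>A) = (\<integral>u'. f u' v' * y n u' \<partial>A)" for v'
          by (rule Bochner_Integration.integral_cong[OF refl]) (simp add: mult.assoc Suc.IH)
        then show ?thesis by simp
      qed
      also have "(\<integral>v. ?r n u v * indicator Y v \<partial>B) = (\<integral>v. f u v * x n v \<partial>B)"
        using Suc.IH[OF Suc.prems] by (simp add: y_def)
      also have "(\<integral>v. f u v * x n v \<partial>B) - (\<integral>v'. f u v' * ?z v' \<partial>B) = (\<integral>v. f u v * x n v - f u v * ?z v \<partial>B)"
        by (intro Bochner_Integration.integral_diff[symmetric] B.bounded_meas_integrable bounded_meas_mult fu x z)
      also have "\<dots> = y (Suc n) u" by (simp add: y_def[of "Suc n"] xSuc right_diff_distrib)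
      finally show ?case .
    qed
    have eq: "(\<integral>p. (case p of (u, v) \<Rightarrow> ?r n u v) * indicator (X \<times> Y) p \<partial>(A \<Otimes>\<^sub>M B)) = (\<integral>u. indicator X u * y n u \<partial>A)" for n
    proof -
      have "bounded_meas (A \<Otimes>\<^sub>M B) (\<lambda>p. (case p of (u, v) \<Rightarrow> ?r n u v) * indicator (X \<times> Y) p)"
        using X Y by (intro bounded_meas_mult[OF r] bounded_measI[where c=1]) auto
      from AB.integral_fst'[OF AB.bounded_meas_integrable[OF this], symmetric]
      have "(\<integral>p. (case p of (u, v) \<Rightarrow> ?r n u v) * indicator (X \<times> Y) p \<partial>(A \<Otimes>\<^sub>M B)) =
          (\<integral>u. (\<integral>v. indicator X u * (?r n u v * indicator Y v) \<partial>B) \<partial>A)"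
        by (simp add: indicator_times ac_simps)
      also have "\<dots> = (\<integral>u. indicator X u * y n u \<partial>A)"
        by (rule Bochner_Integration.integral_cong[OF refl]) (simp add: ry)
      finally show ?thesis .
    qed
    have "(\<lambda>n. (\<integral>u. indicator X u * y n u \<partial>A)\<^sup>2) \<longlonglongrightarrow> 0"
    proof (rule Lim_null_comparison[OF always_eventually y0], rule allI)
      fix n
      have bm: "bounded_meas A (\<lambda>u. indicator X u * y n u)"
        using X by (intro bounded_meas_mult[OF _ y] bounded_measI[where c=1]) auto
      have "(\<integral>u. indicator X u * y n u \<partial>A)\<^sup>2 \<le> (\<integral>u. (indicator X u * y n u)\<^sup>2 \<partial>A)"
        by (rule A.integral_power2_le[OF bm])
      also have "\<dots> \<le> (\<integral>u. (y n u)\<^sup>2 \<partial>A)"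
        by (intro integral_mono A.bounded_meas_integrable bounded_meas_power2 bm y) (auto simp: indicator_def)
      finally show "norm ((\<integral>u. indicator X u * y n u \<partial>A)\<^sup>2) \<le> (\<integral>u. (y n u)\<^sup>2 \<partial>A)" by simp
    qed
    then have "(\<lambda>n. sqrt ((\<integral>u. indicator X u * y n u \<partial>A)\<^sup>2)) \<longlonglongrightarrow> sqrt 0" by (rule tendsto_real_sqrt)
    then have "(\<lambda>n. \<integral>u. indicator X u * y n u \<partial>A) \<longlonglongrightarrow> 0" by (simp add: tendsto_rabs_zero_iff)
    then show "(\<lambda>n. \<integral>p. (case p of (u, v) \<Rightarrow> ?r n u v) * indicator (X \<times> Y) p \<partial>(A \<Otimes>\<^sub>M B)) \<longlonglongrightarrow> 0"
      unfolding eq .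
  qed
qed

section \<open>Repeated edges\<close>

text \<open>The randomness \<open>w\<close> is shared by the whole array, while sites and replicas
  carry independent labels \<open>v i\<close> and \<open>u l\<close>. The label spaces are kept
  abstract; the spin magnetization is one instance.\<close>

locale random_kernel = W: prob_space W + A: prob_space A + B: prob_space B
  for W :: "'w measure" and A :: "'a measure" and B :: "'b measure" +
  fixes f :: "'w \<Rightarrow> 'a \<Rightarrow> 'b \<Rightarrow> real"
  assumes kernel_measurable: "(\<lambda>(w, u, v). f w u v) \<in> borel_measurable (W \<Otimes>\<^sub>M A \<Otimes>\<^sub>M B)"
    and kernel_le_1: "w \<in> space W \<Longrightarrow> u \<in> space A \<Longrightarrow> v \<in> space B \<Longrightarrow> \<bar>f w u v\<bar> \<le> 1"
begin

definition sample_space :: "('w \<times> (nat \<Rightarrow> 'a) \<times> (nat \<Rightarrow> 'b)) measure" where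
  "sample_space = W \<Otimes>\<^sub>M PiM UNIV (\<lambda>_. A) \<Otimes>\<^sub>M PiM UNIV (\<lambda>_. B)"

definition edge_prod :: "(nat \<times> nat) list \<Rightarrow> 'w \<times> (nat \<Rightarrow> 'a) \<times> (nat \<Rightarrow> 'b) \<Rightarrow> real" where
  "edge_prod es = (\<lambda>(w, u, v). \<Prod>(i, l)\<leftarrow>es. f w (u l) (v i))"

text \<open>The homomorphism density of a bipartite graph, sites against replicas, in the kernel
  \<open>f w\<close>, averaged over \<open>w\<close>. Edges form a list and not a set because
  multiplicities matter: a repeated edge contributes a power of \<open>f\<close>.\<close>

definition edge_moment :: "(nat \<times> nat) list \<Rightarrow> real" where
  "edge_moment es = (\<integral>q. edge_prod es q \<partial>sample_space)"

text \<open>One distinguished edge carries a kernel \<open>K\<close> in place of \<open>f\<close>.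
  The residuals and their squares take the role of \<open>K\<close>; they need not be bounded by
  1.\<close>

definition weighted_moment :: "('w \<Rightarrow> 'a \<Rightarrow> 'b \<Rightarrow> real) \<Rightarrow> nat \<Rightarrow> nat \<Rightarrow> (nat \<times> nat) list \<Rightarrow> real" where
  "weighted_moment K i l es = (\<integral>q. (case q of (w, u, v) \<Rightarrow> K w (u l) (v i)) * edge_prod es q \<partial>sample_space)"

lemma prob_seq_A: "prob_space (PiM UNIV (\<lambda>_::nat. A))" and prob_seq_B: "prob_space (PiM UNIV (\<lambda>_::nat. B))"
  by (intro prob_space_PiM A.prob_space_axioms B.prob_space_axioms)+

sublocale Q: prob_space sample_space
  unfolding sample_space_def by (intro prob_space_pair prob_seq_A prob_seq_B W.prob_space_axioms)

lemma space_sample_space: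
  "(w, u, v) \<in> space sample_space \<longleftrightarrow> w \<in> space W \<and> (\<forall>l. u l \<in> space A) \<and> (\<forall>i. v i \<in> space B)"
  by (auto simp: sample_space_def space_pair_measure space_PiM)

lemma bounded_meas_kernel: "bounded_meas (W \<Otimes>\<^sub>M A \<Otimes>\<^sub>M B) (\<lambda>(w, u, v). f w u v)"
  using kernel_measurable kernel_le_1 by (intro bounded_measI[where c=1]) (auto simp: space_pair_measure)

lemma evaluation_measurable[measurable]:
  "(\<lambda>(w, u, v). (w, u l, v i)) \<in> measurable sample_space (W \<Otimes>\<^sub>M A \<Otimes>\<^sub>M B)"
  unfolding sample_space_def by measurable

lemma bounded_meas_at_edge:
  assumes "bounded_meas (W \<Otimes>\<^sub>M A \<Otimes>\<^sub>M B) (\<lambda>(w, u, v). K w u v)"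
  shows "bounded_meas sample_space (\<lambda>(w, u, v). K w (u l) (v i))"
  using bounded_meas_compose[OF assms evaluation_measurable] by (simp add: case_prod_unfold)

lemma edge_prod_Cons: "edge_prod ((i, l) # es) q = (case q of (w, u, v) \<Rightarrow> f w (u l) (v i)) * edge_prod es q"
  by (auto simp: edge_prod_def split: prod.split)

lemma bounded_meas_edge_prod: "bounded_meas sample_space (edge_prod es)"
proof (induction es)
  case Nil
  then show ?case by (simp add: edge_prod_def case_prod_unfold bounded_meas_const)
next
  case (Cons e es)
  then show ?case
    using bounded_meas_mult[OF bounded_meas_at_edge[OF bounded_meas_kernel]]
    by (cases e) (simp add: edge_prod_Cons[abs_def])
qed

lemma edge_prod_le_1: "q \<in> space sample_space \<Longrightarrow> \<bar>edge_prod es q\<bar> \<le> 1"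
  unfolding edge_prod_def case_prod_unfold
  by (rule abs_prod_list_le_1) (cases q, auto simp: space_sample_space intro: kernel_le_1)

lemma edge_moment_Cons: "edge_moment ((i, l) # es) = weighted_moment f i l es"
  by (simp add: edge_moment_def weighted_moment_def edge_prod_Cons)

lemma edge_moment_mset_cong: "mset es = mset es' \<Longrightarrow> edge_moment es = edge_moment es'"
  unfolding edge_moment_def edge_prod_def case_prod_unfold
  by (intro Bochner_Integration.integral_cong refl) (metis (no_types, lifting) mset_map prod_mset_prod_list)

lemma weighted_moment_diff:
  assumes "bounded_meas (W \<Otimes>\<^sub>M A \<Otimes>\<^sub>M B) (\<lambda>(w, u, v). K w u v)" "bounded_meas (W \<Otimes>\<^sub>M A \<Otimes>\<^sub>M B) (\<lambda>(w, u, v). L w u v)"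
  shows "weighted_moment (\<lambda>w u v. K w u v - L w u v) i l es = weighted_moment K i l es - weighted_moment L i l es"
proof -
  have "weighted_moment (\<lambda>w u v. K w u v - L w u v) i l es =
    (\<integral>q. (case q of (w, u, v) \<Rightarrow> K w (u l) (v i)) * edge_prod es q - (case q of (w, u, v) \<Rightarrow> L w (u l) (v i)) * edge_prod es q \<partial>sample_space)"
    by (simp add: weighted_moment_def case_prod_unfold left_diff_distrib)
  also have "\<dots> = weighted_moment K i l es - weighted_moment L i l es"
    unfolding weighted_moment_def
    by (intro Bochner_Integration.integral_diff Q.bounded_meas_integrable bounded_meas_mult bounded_meas_edge_prod bounded_meas_at_edge assms)
  finally show ?thesis .
qed

lemma edge_prod_upd:
  assumes "l \<notin> snd ` set es" "i \<notin> fst ` set es"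
  shows "edge_prod es (w, u(l := x), v(i := y)) = edge_prod es (w, u, v)"
proof -
  have "map (\<lambda>(j, k). f w ((u(l := x)) k) ((v(i := y)) j)) es = map (\<lambda>(j, k). f w (u k) (v j)) es"
    using assms by (intro map_cong) force+
  then show ?thesis unfolding edge_prod_def prod.case by (simp only:)
qed

lemma integral_sample_space_resample:
  fixes \<Phi> :: "'w \<times> (nat \<Rightarrow> 'a) \<times> (nat \<Rightarrow> 'b) \<Rightarrow> real"
  assumes "bounded_meas sample_space \<Phi>"
  shows "(\<integral>q. \<Phi> q \<partial>sample_space) =
    (\<integral>(w, u, v). (\<integral>(x, y). \<Phi> (w, u(l := x), v(i := y)) \<partial>(A \<Otimes>\<^sub>M B)) \<partial>sample_space)"
proof -
  obtain c where "\<And>q. q \<in> space sample_space \<Longrightarrow> \<bar>\<Phi> q\<bar> \<le> c" "\<Phi> \<in> borel_measurable sample_space"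
    using assms unfolding bounded_meas_def by blast
  then show ?thesis
    using integral_resample[OF W.prob_space_axioms A.prob_space_axioms B.prob_space_axioms, of \<Phi> c l i]
    unfolding sample_space_def by blast
qed

lemma weighted_moment_kernel_square:
  assumes K: "bounded_meas (W \<Otimes>\<^sub>M A \<Otimes>\<^sub>M B) (\<lambda>(w, u, v). K w u v)"
    and fresh: "l' \<noteq> l" "i' \<noteq> i" "l' \<notin> snd ` set es" "i' \<notin> fst ` set es"
  shows "weighted_moment (\<lambda>w. kernel_square A B (f w) (K w)) i l es = weighted_moment K i l' ((i', l) # (i', l') # es)"
proof -
  interpret AB: pair_prob_space A B ..
  let ?\<Phi> = "\<lambda>q. (case q of (w, u, v) \<Rightarrow> K w (u l') (v i)) * edge_prod ((i', l) # (i', l') # es) q"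
  have bm: "bounded_meas sample_space ?\<Phi>"
    by (intro bounded_meas_mult bounded_meas_at_edge K bounded_meas_edge_prod)
  have "weighted_moment K i l' ((i', l) # (i', l') # es) =
    (\<integral>(w, u, v). (\<integral>(x, y). ?\<Phi> (w, u(l' := x), v(i' := y)) \<partial>(A \<Otimes>\<^sub>M B)) \<partial>sample_space)"
    unfolding weighted_moment_def by (rule integral_sample_space_resample[OF bm])
  also have "\<dots> = weighted_moment (\<lambda>w. kernel_square A B (f w) (K w)) i l es"
    unfolding weighted_moment_def
  proof (rule Bochner_Integration.integral_cong[OF refl])
    fix q assume q': "q \<in> space sample_space"
    obtain w u v where quv: "q = (w, u, v)" by (cases q)
    have q: "(w, u, v) \<in> space sample_space" using q' quv by simp
    then have sp: "w \<in> space W" "u l \<in> space A" "v i \<in> space B" by (auto simp: space_sample_space)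
    let ?g = "\<lambda>x y. f w (u l) y * (f w x y * K w x (v i)) * edge_prod es (w, u, v)"
    have fw: "bounded_meas (A \<Otimes>\<^sub>M B) (\<lambda>(x, y). f w x y)" and Kw: "bounded_meas (A \<Otimes>\<^sub>M B) (\<lambda>(x, y). K w x y)"
      using bounded_meas_section[OF _ sp(1), of "A \<Otimes>\<^sub>M B" "\<lambda>w (u, v). f w u v"]
        bounded_meas_section[OF _ sp(1), of "A \<Otimes>\<^sub>M B" "\<lambda>w (u, v). K w u v"] bounded_meas_kernel K by auto
    have 1: "bounded_meas (A \<Otimes>\<^sub>M B) (\<lambda>(x, y). f w (u l) y)"
      using bounded_meas_compose[OF fw, of "\<lambda>(x, y). (u l, y)" "A \<Otimes>\<^sub>M B"] sp by (simp add: case_prod_unfold)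
    have 2: "bounded_meas (A \<Otimes>\<^sub>M B) (\<lambda>(x, y). K w x (v i))"
      using bounded_meas_compose[OF Kw, of "\<lambda>(x, y). (x, v i)" "A \<Otimes>\<^sub>M B"] sp by (simp add: case_prod_unfold)
    have i: "integrable (A \<Otimes>\<^sub>M B) (\<lambda>(x, y). ?g x y)"
      using AB.bounded_meas_integrable[OF bounded_meas_mult[OF bounded_meas_mult[OF 1 bounded_meas_mult[OF fw 2]] bounded_meas_const[of _ "edge_prod es (w, u, v)"]]]
      by (simp add: case_prod_unfold)
    have "(\<integral>(x, y). ?\<Phi> (w, u(l' := x), v(i' := y)) \<partial>(A \<Otimes>\<^sub>M B)) = (\<integral>(x, y). ?g x y \<partial>(A \<Otimes>\<^sub>M B))"
      using fresh by (simp add: edge_prod_Cons edge_prod_upd ac_simps)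
    also have "\<dots> = (\<integral>y. (\<integral>x. ?g x y \<partial>A) \<partial>B)" by (rule AB.integral_snd[OF i, symmetric])
    also have "\<dots> = kernel_square A B (f w) (K w) (u l) (v i) * edge_prod es (w, u, v)"
      by (simp add: kernel_square_def)
    finally show "(case q of (w, u, v) \<Rightarrow> \<integral>(x, y). ?\<Phi> (w, u(l' := x), v(i' := y)) \<partial>(A \<Otimes>\<^sub>M B)) =
        (case q of (w, u, v) \<Rightarrow> kernel_square A B (f w) (K w) (u l) (v i)) * edge_prod es q"
      unfolding quv prod.case .
  qed
  finally show ?thesis ..
qed

abbreviation res :: "nat \<Rightarrow> 'w \<Rightarrow> 'a \<Rightarrow> 'b \<Rightarrow> real" where
  "res n w \<equiv> residual A B (f w) n"

abbreviation sq_res :: "nat \<Rightarrow> 'w \<Rightarrow> 'a \<Rightarrow> 'b \<Rightarrow> real" where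
  "sq_res n w \<equiv> kernel_square A B (f w) (res n w)"

lemma bounded_meas_res:
  "bounded_meas (W \<Otimes>\<^sub>M A \<Otimes>\<^sub>M B) (\<lambda>(w, u, v). res n w u v)"
  "bounded_meas (W \<Otimes>\<^sub>M A \<Otimes>\<^sub>M B) (\<lambda>(w, u, v). sq_res n w u v)"
  by (intro bounded_meas_residual bounded_meas_kernel_square A.prob_space_axioms B.prob_space_axioms bounded_meas_kernel)+

lemma weighted_moment_telescope:
  "weighted_moment f i l es = weighted_moment (res n) i l es + (\<Sum>j<n. weighted_moment (sq_res j) i l es)"
proof (induction n)
  case (Suc n)
  have "weighted_moment (res (Suc n)) i l es = weighted_moment (res n) i l es - weighted_moment (sq_res n) i l es"
    using weighted_moment_diff[OF bounded_meas_res] by simp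
  then show ?case using Suc by simp
qed simp

text \<open>After resampling the endpoints \<open>u l\<close> and \<open>v i\<close>, the remaining
  edges are a bounded test function of them, so the inner integral tends to 0 for every frozen
  configuration. It is dominated by 1 through the L2 norm of the residual.\<close>

lemma weighted_moment_res_null: "(\<lambda>n. weighted_moment (res n) i l es) \<longlonglongrightarrow> 0"
proof -
  interpret AB: pair_prob_space A B ..
  let ?\<Phi> = "\<lambda>n q. (case q of (w, u, v) \<Rightarrow> res n w (u l) (v i)) * edge_prod es q"
  let ?\<Psi> = "\<lambda>n (w, u, v). (\<integral>(x, y). ?\<Phi> n (w, u(l := x), v(i := y)) \<partial>(A \<Otimes>\<^sub>M B))"
  have bm: "bounded_meas sample_space (?\<Phi> n)" for n
    by (intro bounded_meas_mult bounded_meas_at_edge bounded_meas_res bounded_meas_edge_prod)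
  have eq: "weighted_moment (res n) i l es = (\<integral>q. ?\<Psi> n q \<partial>sample_space)" for n
    unfolding weighted_moment_def by (rule integral_sample_space_resample[OF bm])
  have T: "(\<lambda>((w, u, v), x, y). (w, u(l := x), v(i := y))) \<in> measurable (sample_space \<Otimes>\<^sub>M (A \<Otimes>\<^sub>M B)) sample_space"
    using distr_resample(1)[OF W.prob_space_axioms A.prob_space_axioms B.prob_space_axioms, where l=l and i=i, folded sample_space_def] .
  have \<Psi>: "bounded_meas sample_space (?\<Psi> n)" for n
    using AB.bounded_meas_integral[of sample_space "\<lambda>(w, u, v) (x, y). ?\<Phi> n (w, u(l := x), v(i := y))"]
      bounded_meas_compose[OF bm T] by (simp add: case_prod_unfold)
  have "(\<lambda>n. \<integral>q. ?\<Psi> n q \<partial>sample_space) \<longlonglongrightarrow> (\<integral>q. 0 \<partial>sample_space)"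
  proof (rule integral_dominated_convergence[where w="\<lambda>_. 1"])
    show "?\<Psi> n \<in> borel_measurable sample_space" for n using \<Psi> by (rule bounded_meas_measurable)
    have main: "(\<lambda>n. ?\<Psi> n q) \<longlonglongrightarrow> 0 \<and> (\<forall>n. \<bar>?\<Psi> n q\<bar> \<le> 1)" if q: "q \<in> space sample_space" for q
    proof -
      obtain w u v where quv: "q = (w, u, v)" by (cases q)
      then have w: "w \<in> space W" using q by (simp add: space_sample_space)
      have fw: "bounded_meas (A \<Otimes>\<^sub>M B) (\<lambda>(x, y). f w x y)"
        using bounded_meas_section[OF _ w, of "A \<Otimes>\<^sub>M B" "\<lambda>w (u, v). f w u v"] bounded_meas_kernel by auto
      let ?b = "\<lambda>(x, y). edge_prod es (w, u(l := x), v(i := y))"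
      have b: "bounded_meas (A \<Otimes>\<^sub>M B) ?b"
        using bounded_meas_compose[OF bounded_meas_edge_prod[of es] measurable_compose[OF measurable_Pair1'[OF q] T]]
        by (simp add: quv case_prod_unfold)
      have b1: "\<bar>?b p\<bar> \<le> 1" if "p \<in> space (A \<Otimes>\<^sub>M B)" for p
        using that q by (auto simp: space_pair_measure quv space_sample_space intro!: edge_prod_le_1)
      have R1: "bounded_meas (A \<Otimes>\<^sub>M B) (\<lambda>(x, y). res n w x y)" for n
        by (rule residual_weak_null(1)[OF A.prob_space_axioms B.prob_space_axioms fw]) (rule kernel_le_1[OF w])
      have R3: "(\<integral>(x, y). (res n w x y)\<^sup>2 \<partial>(A \<Otimes>\<^sub>M B)) \<le> 1" for n
        by (rule residual_weak_null(3)[OF A.prob_space_axioms B.prob_space_axioms fw]) (rule kernel_le_1[OF w])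
      have R4: "(\<lambda>n. \<integral>p. (case p of (x, y) \<Rightarrow> res n w x y) * ?b p \<partial>(A \<Otimes>\<^sub>M B)) \<longlonglongrightarrow> 0"
        by (rule residual_weak_null(4)[OF A.prob_space_axioms B.prob_space_axioms fw _ b]) (rule kernel_le_1[OF w])
      have \<Psi>_eq: "?\<Psi> n q = (\<integral>p. (case p of (x, y) \<Rightarrow> res n w x y) * ?b p \<partial>(A \<Otimes>\<^sub>M B))" for n
        by (simp add: quv case_prod_unfold)
      have "(?\<Psi> n q)\<^sup>2 \<le> 1" for n
      proof -
        have rb: "bounded_meas (A \<Otimes>\<^sub>M B) (\<lambda>p. (case p of (x, y) \<Rightarrow> res n w x y) * ?b p)"
          by (intro bounded_meas_mult R1 b)
        have "(?\<Psi> n q)\<^sup>2 \<le> (\<integral>p. ((case p of (x, y) \<Rightarrow> res n w x y) * ?b p)\<^sup>2 \<partial>(A \<Otimes>\<^sub>M B))"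
          unfolding \<Psi>_eq by (rule AB.integral_power2_le[OF rb])
        also have "\<dots> \<le> (\<integral>p. (case p of (x, y) \<Rightarrow> (res n w x y)\<^sup>2) \<partial>(A \<Otimes>\<^sub>M B))"
        proof (rule integral_mono)
          show "integrable (A \<Otimes>\<^sub>M B) (\<lambda>p. ((case p of (x, y) \<Rightarrow> res n w x y) * ?b p)\<^sup>2)"
            by (intro AB.bounded_meas_integrable bounded_meas_power2 rb)
          show "integrable (A \<Otimes>\<^sub>M B) (\<lambda>(x, y). (res n w x y)\<^sup>2)"
            using AB.bounded_meas_integrable[OF bounded_meas_power2[OF R1]] by (simp add: case_prod_unfold)
          fix p assume "p \<in> space (A \<Otimes>\<^sub>M B)"
          then have "(?b p)\<^sup>2 \<le> 1" using b1 by (simp only: abs_square_le_1)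
          then have "((case p of (x, y) \<Rightarrow> res n w x y) * ?b p)\<^sup>2 \<le> (case p of (x, y) \<Rightarrow> res n w x y)\<^sup>2"
            unfolding power_mult_distrib by (intro mult_right_le_one_le) auto
          then show "((case p of (x, y) \<Rightarrow> res n w x y) * ?b p)\<^sup>2 \<le> (case p of (x, y) \<Rightarrow> (res n w x y)\<^sup>2)"
            by (simp add: case_prod_unfold)
        qed
        also have "\<dots> \<le> 1" by (rule R3)
        finally show ?thesis .
      qed
      moreover have "(\<lambda>n. ?\<Psi> n q) \<longlonglongrightarrow> 0" unfolding \<Psi>_eq by (rule R4)
      ultimately show ?thesis by (simp only: abs_square_le_1) simp
    qed
    show "AE q in sample_space. (\<lambda>n. ?\<Psi> n q) \<longlonglongrightarrow> 0" using main by (intro AE_I2) blast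
    show "AE q in sample_space. norm (?\<Psi> n q) \<le> 1" for n using main by (intro AE_I2) (simp only: real_norm_def)
  qed auto
  then show ?thesis unfolding eq by simp
qed

end

text \<open>Induction on the number of repeated edges. Peeling off one copy of a repeated edge and replacing its
  kernel \<open>f\<close> by \<open>F F\<^sup>* h\<close> trades that copy for two new edges at fresh vertices, and \<open>f\<close> is the weak limit
  of sums of such kernels.\<close>

theorem edge_moments_determined_by_distinct:
  fixes f :: "'w \<Rightarrow> 'a \<Rightarrow> 'b \<Rightarrow> real" and f' :: "'w' \<Rightarrow> 'c \<Rightarrow> 'd \<Rightarrow> real"
  assumes "random_kernel W A B f" "random_kernel W' A' B' f'"
    and distinct_eq: "\<And>es. distinct es \<Longrightarrow> random_kernel.edge_moment W A B f es = random_kernel.edge_moment W' A' B' f' es"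
  shows "random_kernel.edge_moment W A B f es = random_kernel.edge_moment W' A' B' f' es"
proof -
  interpret X: random_kernel W A B f by fact
  interpret Y: random_kernel W' A' B' f' by fact
  have "length es \<le> card (set es) + m \<Longrightarrow> X.edge_moment es = Y.edge_moment es" for m es
  proof (induction m arbitrary: es)
    case 0
    then have "distinct es" using card_length[of es] by (intro card_distinct) simp
    then show ?case by (rule distinct_eq)
  next
    case (Suc m)
    show ?case
    proof (cases "distinct es")
      case True
      then show ?thesis by (rule distinct_eq)
    next
      case False
      then obtain xs ys zs e where es: "es = xs @ [e] @ ys @ [e] @ zs" using not_distinct_decomp by blast
      define ds where "ds = xs @ ys @ e # zs"
      obtain i l where e: "e = (i, l)" by (cases e)
      have mset: "mset es = mset (e # ds)" by (simp add: es ds_def)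
      have "set es = set ds" by (auto simp: es ds_def)
      then have len: "length ds \<le> card (set ds) + m" using Suc.prems by (simp add: es ds_def)
      have step: "X.weighted_moment (X.sq_res n) i l es = Y.weighted_moment (Y.sq_res n) i l es"
        if res: "\<And>i l es. length es \<le> card (set es) + m \<Longrightarrow> (i, l) \<notin> set es \<Longrightarrow>
            X.weighted_moment (X.res n) i l es = Y.weighted_moment (Y.res n) i l es"
          and es: "length es \<le> card (set es) + m" for n i l and es :: "(nat \<times> nat) list"
      proof -
        obtain l' where l': "l' \<notin> insert l (snd ` set es)"
          using ex_new_if_finite[of "insert l (snd ` set es)"] by auto
        obtain i' where i': "i' \<notin> insert i (fst ` set es)"
          using ex_new_if_finite[of "insert i (fst ` set es)"] by auto
        let ?es = "(i', l) # (i', l') # es"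
        have "(i', l) \<notin> set es" "(i', l') \<notin> set es" "(i, l') \<notin> set es" using i' l' by force+
        then have "length ?es \<le> card (set ?es) + m" "(i, l') \<notin> set ?es" using i' l' es by auto
        from res[OF this] show ?thesis
          using i' l' X.weighted_moment_kernel_square[OF X.bounded_meas_res(1), of l' l i' i es n]
            Y.weighted_moment_kernel_square[OF Y.bounded_meas_res(1), of l' l i' i es n] by simp
      qed
      have res: "X.weighted_moment (X.res n) i l es = Y.weighted_moment (Y.res n) i l es"
        if "length es \<le> card (set es) + m" "(i, l) \<notin> set es" for n i l and es :: "(nat \<times> nat) list"
        using that
      proof (induction n arbitrary: i l es)
        case 0
        then have "X.edge_moment ((i, l) # es) = Y.edge_moment ((i, l) # es)" by (intro Suc.IH) simp
        then show ?case by (simp add: X.edge_moment_Cons Y.edge_moment_Cons)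
      next
        case (Suc n)
        then show ?case
          using step[of n es i l] X.weighted_moment_diff[OF X.bounded_meas_res, of n n i l es]
            Y.weighted_moment_diff[OF Y.bounded_meas_res, of n n i l es] by simp
      qed
      have eqX: "(\<Sum>j<n. X.weighted_moment (X.sq_res j) i l ds) = X.weighted_moment f i l ds - X.weighted_moment (X.res n) i l ds"
        and eqY: "(\<Sum>j<n. Y.weighted_moment (Y.sq_res j) i l ds) = Y.weighted_moment f' i l ds - Y.weighted_moment (Y.res n) i l ds" for n
        using X.weighted_moment_telescope[of i l ds n] Y.weighted_moment_telescope[of i l ds n] by simp_all
      have X: "(\<lambda>n. \<Sum>j<n. X.weighted_moment (X.sq_res j) i l ds) \<longlonglongrightarrow> X.weighted_moment f i l ds"
        using tendsto_diff[OF tendsto_const[of "X.weighted_moment f i l ds"] X.weighted_moment_res_null[of i l ds]]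
          eqX by simp
      have Y: "(\<lambda>n. \<Sum>j<n. Y.weighted_moment (Y.sq_res j) i l ds) \<longlonglongrightarrow> Y.weighted_moment f' i l ds"
        using tendsto_diff[OF tendsto_const[of "Y.weighted_moment f' i l ds"] Y.weighted_moment_res_null[of i l ds]]
          eqY by simp
      \<comment> \<open>The edge \<open>(i, l)\<close> does occur in \<open>ds\<close>. Only squares
        of residuals appear in these sums, and for them \<open>step\<close> tolerates this.\<close>
      have "(\<lambda>n. \<Sum>j<n. X.weighted_moment (X.sq_res j) i l ds) = (\<lambda>n. \<Sum>j<n. Y.weighted_moment (Y.sq_res j) i l ds)"
        using step[OF res len] by simp
      from LIMSEQ_unique[OF X[unfolded this] Y] have "X.weighted_moment f i l ds = Y.weighted_moment f' i l ds" .
      then show ?thesis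
        using X.edge_moment_mset_cong[OF mset] Y.edge_moment_mset_cong[OF mset]
        by (simp add: e X.edge_moment_Cons Y.edge_moment_Cons)
    qed
  qed
  from this[of es "length es"] show ?thesis by simp
qed

section \<open>Spin arrays and overlaps\<close>

lemma space_I01: "space I01 = {0..1}"
  by (simp add: I01_def space_restrict_space)

interpretation I01: prob_space I01
  by (rule prob_spaceI) (simp add: I01_def space_restrict_space emeasure_restrict_space)

lemma bounded_meas_integral_pair:
  assumes "prob_space M" "prob_space N" "bounded_meas (M \<Otimes>\<^sub>M N) F"
  shows "(\<integral>p. F p \<partial>(M \<Otimes>\<^sub>M N)) = (\<integral>x. (\<integral>y. F (x, y) \<partial>N) \<partial>M)"
proof -
  interpret M: prob_space M by fact
  interpret N: prob_space N by fact
  interpret MN: pair_prob_space M N ..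
  show ?thesis by (rule MN.integral_fst'[symmetric, OF MN.bounded_meas_integrable[OF assms(3)]])
qed

lemma bounded_meas_Pair1:
  "bounded_meas (M \<Otimes>\<^sub>M N) F \<Longrightarrow> x \<in> space M \<Longrightarrow> bounded_meas N (\<lambda>y. F (x, y))"
  by (erule bounded_meas_compose) (rule measurable_Pair1')

abbreviation seq_I01 :: "('i \<Rightarrow> real) measure" where
  "seq_I01 \<equiv> PiM UNIV (\<lambda>_. I01)"

lemma prob_seq_I01: "prob_space (seq_I01 :: ('i \<Rightarrow> real) measure)"
  by (intro prob_space_PiM I01.prob_space_axioms)

abbreviation spin_space :: "(real \<times> (nat \<Rightarrow> real) \<times> (nat \<Rightarrow> real) \<times> (nat \<times> nat \<Rightarrow> real)) measure" where
  "spin_space \<equiv> I01 \<Otimes>\<^sub>M seq_I01 \<Otimes>\<^sub>M seq_I01 \<Otimes>\<^sub>M seq_I01"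

lemma prob_spin_space: "prob_space spin_space"
  by (intro prob_space_pair prob_seq_I01 I01.prob_space_axioms)

definition spin_at :: "spin_fun \<Rightarrow> nat \<times> nat \<Rightarrow> real \<times> (nat \<Rightarrow> real) \<times> (nat \<Rightarrow> real) \<times> (nat \<times> nat \<Rightarrow> real) \<Rightarrow> real" where
  "spin_at \<sigma> = (\<lambda>(i, l) (w, u, v, x). \<sigma> w (u l) (v i) (x (i, l)))"

lemma spin_law_eq: "spin_law \<sigma> = distr spin_space (PiM UNIV (\<lambda>_. borel)) (\<lambda>q. \<lambda>e\<in>UNIV. spin_at \<sigma> e q)"
  unfolding spin_law_def by (rule distr_cong) (auto simp: spin_at_def fun_eq_iff)

lemma space_seq_I01: "x \<in> space seq_I01 \<longleftrightarrow> (\<forall>i. x i \<in> {0..1})"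
  by (auto simp: space_PiM space_I01 PiE_iff)

text \<open>Equal factors of value -1 or 1 cancel in pairs, so \<open>ds\<close> consists of the
  entries of odd multiplicity. The list \<open>ds\<close> depends on \<open>es\<close> alone and
  hence works for all outcomes at once.\<close>

lemma signs_prod_list_distinct:
  obtains ds where "distinct ds" "\<And>s :: 'e \<Rightarrow> real. (\<And>e. s e \<in> {-1, 1}) \<Longrightarrow> (\<Prod>e\<leftarrow>es. s e) = (\<Prod>e\<leftarrow>ds. s e)"
proof -
  have "\<exists>ds. distinct ds \<and> (\<forall>s :: 'e \<Rightarrow> real. (\<forall>e. s e \<in> {-1, 1}) \<longrightarrow> (\<Prod>e\<leftarrow>es. s e) = (\<Prod>e\<leftarrow>ds. s e))"
  proof (induction es)
    case Nil
    show ?case by (rule exI[of _ "[]"]) simp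
  next
    case (Cons e es)
    then obtain ds where ds: "distinct ds" "\<And>s :: 'e \<Rightarrow> real. \<forall>e. s e \<in> {-1, 1} \<Longrightarrow> (\<Prod>e\<leftarrow>es. s e) = (\<Prod>e\<leftarrow>ds. s e)"
      by blast
    show ?case
    proof (cases "e \<in> set ds")
      case False
      then show ?thesis using ds by (intro exI[of _ "e # ds"]) auto
    next
      case True
      then obtain xs ys where d: "ds = xs @ e # ys" by (meson split_list)
      have "s e * (\<Prod>e\<leftarrow>ds. s e) = (\<Prod>e\<leftarrow>xs @ ys. s e)" if "\<forall>e. s e \<in> {-1, 1}" for s :: "'e \<Rightarrow> real"
      proof -
        have "s e * s e = 1" using that[rule_format, of e] by auto
        then have "s e * (a * (s e * b)) = a * b" for a b by (simp add: mult.left_commute[of "s e"] mult.assoc[symmetric])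
        then show ?thesis by (simp add: d)
      qed
      then show ?thesis using ds by (intro exI[of _ "xs @ ys"]) (auto simp: d)
    qed
  qed
  then show thesis using that by blast
qed

lemma prod_list_map_concat:
  "(\<Prod>y\<leftarrow>concat (map h xs). g y) = (\<Prod>x\<leftarrow>xs. \<Prod>y\<leftarrow>h x. (g y :: real))"
  by (induction xs) auto

context
  fixes \<sigma> :: spin_fun
  assumes spin: "spin_function \<sigma>"
begin

lemma spin_measurable: "(\<lambda>(w, u, v, x). \<sigma> w u v x) \<in> borel_measurable (I01 \<Otimes>\<^sub>M I01 \<Otimes>\<^sub>M I01 \<Otimes>\<^sub>M I01)"
proof -
  have "(\<lambda>x. x) \<in> borel_measurable (count_space {-1, 1 :: real})" by simp
  from measurable_compose[OF spin[unfolded spin_function_def] this] show ?thesis by simp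
qed

lemma spin_sign:
  assumes "w \<in> {0..1}" "u \<in> {0..1}" "v \<in> {0..1}" "x \<in> {0..1}"
  shows "\<sigma> w u v x \<in> {-1, 1}"
  using measurable_space[OF spin[unfolded spin_function_def], of "(w, u, v, x)"] assms
  by (simp add: space_pair_measure space_I01)

lemma random_kernel_mag: "random_kernel I01 I01 I01 (mag \<sigma>)"
proof
  have "(\<lambda>((w, u, v), x). \<sigma> w u v x) \<in> borel_measurable ((I01 \<Otimes>\<^sub>M I01 \<Otimes>\<^sub>M I01) \<Otimes>\<^sub>M I01)"
    using measurable_compose[OF _ spin_measurable, of "\<lambda>((w, u, v), x). (w, u, v, x)" "(I01 \<Otimes>\<^sub>M I01 \<Otimes>\<^sub>M I01) \<Otimes>\<^sub>M I01"]
    by (simp add: case_prod_unfold)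
  then show "(\<lambda>(w, u, v). mag \<sigma> w u v) \<in> borel_measurable (I01 \<Otimes>\<^sub>M I01 \<Otimes>\<^sub>M I01)"
    unfolding mag_def case_prod_unfold by measurable
  fix w u v :: real assume "w \<in> space I01" "u \<in> space I01" "v \<in> space I01"
  then show "\<bar>mag \<sigma> w u v\<bar> \<le> 1"
    unfolding mag_def using spin_sign[of w u v] by (intro I01.abs_integral_le) (fastforce simp: space_I01)
qed

interpretation K: random_kernel I01 I01 I01 "mag \<sigma>" by (rule random_kernel_mag)

lemma spin_at_measurable: "spin_at \<sigma> e \<in> borel_measurable spin_space"
proof -
  have "(\<lambda>(w, u, v, x). (w, u (snd e), v (fst e), x e)) \<in> measurable spin_space (I01 \<Otimes>\<^sub>M I01 \<Otimes>\<^sub>M I01 \<Otimes>\<^sub>M I01)"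
    by measurable
  from measurable_compose[OF this spin_measurable] show ?thesis
    by (simp add: spin_at_def case_prod_unfold)
qed

lemma spin_at_sign: "q \<in> space spin_space \<Longrightarrow> spin_at \<sigma> e q \<in> {-1, 1}"
  unfolding spin_at_def case_prod_unfold
  by (rule spin_sign; cases q; cases e) (auto simp: space_pair_measure space_I01 space_seq_I01)

lemma spin_at_le_1: "q \<in> space spin_space \<Longrightarrow> \<bar>spin_at \<sigma> e q\<bar> \<le> 1"
  using spin_at_sign[of q e] by auto

lemma edge_moment_iterated:
  "K.edge_moment es = (\<integral>w. (\<integral>u. (\<integral>v. K.edge_prod es (w, u, v) \<partial>seq_I01) \<partial>seq_I01) \<partial>I01)"
proof -
  have b: "bounded_meas (I01 \<Otimes>\<^sub>M (seq_I01 \<Otimes>\<^sub>M seq_I01)) (K.edge_prod es)"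
    using K.bounded_meas_edge_prod by (simp add: K.sample_space_def)
  have "K.edge_moment es = (\<integral>w. (\<integral>p. K.edge_prod es (w, p) \<partial>(seq_I01 \<Otimes>\<^sub>M seq_I01)) \<partial>I01)"
    unfolding K.edge_moment_def K.sample_space_def
    by (rule bounded_meas_integral_pair[OF _ _ b]) (intro prob_space_pair prob_seq_I01 I01.prob_space_axioms)+
  also have "\<dots> = (\<integral>w. (\<integral>u. (\<integral>v. K.edge_prod es (w, u, v) \<partial>seq_I01) \<partial>seq_I01) \<partial>I01)"
    by (intro Bochner_Integration.integral_cong[OF refl] bounded_meas_integral_pair prob_seq_I01 bounded_meas_Pair1[OF b])
  finally show ?thesis .
qed

text \<open>Distinct edges use different coordinates of \<open>x\<close>, so given
  \<open>w, u, v\<close> the spins are independent and each averages to its magnetization. On a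
  repeated edge the left-hand side would contain the square of a spin, which is 1, and the
  right-hand side the square of the magnetization.\<close>

lemma spin_moment:
  assumes "distinct es"
  shows "(\<integral>q. (\<Prod>e\<leftarrow>es. spin_at \<sigma> e q) \<partial>spin_space) = K.edge_moment es"
proof -
  let ?F = "\<lambda>q. \<Prod>e\<leftarrow>es. spin_at \<sigma> e q"
  have b: "bounded_meas spin_space ?F"
    by (intro bounded_measI[where c=1] borel_measurable_prod_list spin_at_measurable abs_prod_list_le_1 spin_at_le_1)
  have "(\<integral>q. ?F q \<partial>spin_space) = (\<integral>w. (\<integral>q. ?F (w, q) \<partial>(seq_I01 \<Otimes>\<^sub>M seq_I01 \<Otimes>\<^sub>M seq_I01)) \<partial>I01)"
    by (rule bounded_meas_integral_pair[OF _ _ b]) (intro prob_space_pair prob_seq_I01 I01.prob_space_axioms)+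
  also have "\<dots> = (\<integral>w. (\<integral>u. (\<integral>v. K.edge_prod es (w, u, v) \<partial>seq_I01) \<partial>seq_I01) \<partial>I01)"
  proof (rule Bochner_Integration.integral_cong[OF refl])
    fix w assume w: "w \<in> space I01"
    note bw = bounded_meas_Pair1[OF b w]
    have "(\<integral>q. ?F (w, q) \<partial>(seq_I01 \<Otimes>\<^sub>M seq_I01 \<Otimes>\<^sub>M seq_I01)) = (\<integral>u. (\<integral>q. ?F (w, u, q) \<partial>(seq_I01 \<Otimes>\<^sub>M seq_I01)) \<partial>seq_I01)"
      by (rule bounded_meas_integral_pair[OF _ _ bw]) (intro prob_space_pair prob_seq_I01)+
    also have "\<dots> = (\<integral>u. (\<integral>v. K.edge_prod es (w, u, v) \<partial>seq_I01) \<partial>seq_I01)"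
    proof (rule Bochner_Integration.integral_cong[OF refl])
      fix u :: "nat \<Rightarrow> real" assume u: "u \<in> space seq_I01"
      have "(\<integral>q. ?F (w, u, q) \<partial>(seq_I01 \<Otimes>\<^sub>M seq_I01)) = (\<integral>v. (\<integral>x. ?F (w, u, v, x) \<partial>seq_I01) \<partial>seq_I01)"
        by (rule bounded_meas_integral_pair[OF _ _ bounded_meas_Pair1[OF bw u]]) (intro prob_seq_I01)+
      also have "\<dots> = (\<integral>v. K.edge_prod es (w, u, v) \<partial>seq_I01)"
      proof (rule Bochner_Integration.integral_cong[OF refl])
        fix v :: "nat \<Rightarrow> real" assume v: "v \<in> space seq_I01"
        have int: "integrable I01 (\<lambda>x. \<sigma> w (u (snd e)) (v (fst e)) x)" for e
        proof (rule I01.integrable_bounded[where B=1])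
          have "(\<lambda>x. (w, u (snd e), v (fst e), x)) \<in> measurable I01 (I01 \<Otimes>\<^sub>M I01 \<Otimes>\<^sub>M I01 \<Otimes>\<^sub>M I01)"
            using w u v by (auto simp: space_seq_I01 space_I01)
          from measurable_compose[OF this spin_measurable]
          show "(\<lambda>x. \<sigma> w (u (snd e)) (v (fst e)) x) \<in> borel_measurable I01" by simp
          fix x assume "x \<in> space I01"
          then show "\<bar>\<sigma> w (u (snd e)) (v (fst e)) x\<bar> \<le> 1"
            using spin_sign[of w "u (snd e)" "v (fst e)" x] w u v by (auto simp: space_seq_I01 space_I01)
        qed
        have "(\<integral>x. ?F (w, u, v, x) \<partial>seq_I01) = (\<integral>x. (\<Prod>e\<in>set es. \<sigma> w (u (snd e)) (v (fst e)) (x e)) \<partial>seq_I01)"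
          using assms by (simp add: prod.distinct_set_conv_list spin_at_def case_prod_unfold)
        also have "\<dots> = (\<Prod>e\<in>set es. mag \<sigma> w (u (snd e)) (v (fst e)))"
          unfolding mag_def by (rule integral_PiM_prod) (auto intro: int I01.prob_space_axioms)
        also have "\<dots> = K.edge_prod es (w, u, v)"
          using assms by (simp add: prod.distinct_set_conv_list K.edge_prod_def case_prod_unfold)
        finally show "(\<integral>x. ?F (w, u, v, x) \<partial>seq_I01) = K.edge_prod es (w, u, v)" .
      qed
      finally show "(\<integral>q. ?F (w, u, q) \<partial>(seq_I01 \<Otimes>\<^sub>M seq_I01)) = (\<integral>v. K.edge_prod es (w, u, v) \<partial>seq_I01)" .
    qed
    finally show "(\<integral>q. ?F (w, q) \<partial>(seq_I01 \<Otimes>\<^sub>M seq_I01 \<Otimes>\<^sub>M seq_I01)) = (\<integral>u. (\<integral>v. K.edge_prod es (w, u, v) \<partial>seq_I01) \<partial>seq_I01)" .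
  qed
  finally show ?thesis by (simp add: edge_moment_iterated)
qed

lemma spin_law_moment:
  assumes "distinct es"
  shows "(\<integral>s. (\<Prod>e\<leftarrow>es. s e) \<partial>spin_law \<sigma>) = K.edge_moment es"
proof -
  have "(\<lambda>s. \<Prod>e\<leftarrow>es. s e :: real) \<in> borel_measurable (PiM UNIV (\<lambda>_. borel))"
    by (intro borel_measurable_prod_list) auto
  moreover have "(\<lambda>q. \<lambda>e\<in>UNIV. spin_at \<sigma> e q) \<in> measurable spin_space (PiM UNIV (\<lambda>_. borel))"
    by (intro measurable_restrict spin_at_measurable)
  ultimately show ?thesis
    unfolding spin_law_eq spin_moment[OF assms, symmetric] by (subst integral_distr) (simp_all add: restrict_def)
qed

section \<open>Multi-overlaps as edge moments\<close>

definition edges_of :: "nat list list \<Rightarrow> (nat \<times> nat) list" where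
  "edges_of Ls = concat (map (\<lambda>j. map (Pair j) (Ls ! j)) [0..<length Ls])"

lemma multi_overlap_measurable: "(\<lambda>(w, u). multi_overlap \<sigma> w u ls) \<in> borel_measurable (I01 \<Otimes>\<^sub>M seq_I01)"
  and multi_overlap_le_1: "p \<in> space (I01 \<Otimes>\<^sub>M seq_I01) \<Longrightarrow> \<bar>case p of (w, u) \<Rightarrow> multi_overlap \<sigma> w u ls\<bar> \<le> 1"
proof -
  have m: "(\<lambda>((w, u), v). mag \<sigma> w (u l) v) \<in> borel_measurable ((I01 \<Otimes>\<^sub>M seq_I01) \<Otimes>\<^sub>M I01)" for l :: nat
    using measurable_compose[OF _ K.kernel_measurable, of "\<lambda>((w, u), v). (w, u l, v)" "(I01 \<Otimes>\<^sub>M seq_I01) \<Otimes>\<^sub>M I01"]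
    by (simp add: case_prod_unfold)
  have "(\<lambda>((w, u), v). \<Prod>l\<leftarrow>ls. mag \<sigma> w (u l) v) \<in> borel_measurable ((I01 \<Otimes>\<^sub>M seq_I01) \<Otimes>\<^sub>M I01)"
    using m unfolding case_prod_unfold by (intro borel_measurable_prod_list)
  then show "(\<lambda>(w, u). multi_overlap \<sigma> w u ls) \<in> borel_measurable (I01 \<Otimes>\<^sub>M seq_I01)"
    unfolding multi_overlap_def case_prod_unfold by measurable
  show "\<bar>case p of (w, u) \<Rightarrow> multi_overlap \<sigma> w u ls\<bar> \<le> 1" if "p \<in> space (I01 \<Otimes>\<^sub>M seq_I01)"
    using that unfolding multi_overlap_def case_prod_unfold
    by (intro I01.abs_integral_le abs_prod_list_le_1 K.kernel_le_1)
      (auto simp: space_pair_measure space_seq_I01 space_I01)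
qed

text \<open>Each multi-overlap in the product gets a site of its own: the integrals over
  \<open>v\<close> become one integral over independent labels \<open>v j\<close>, with
  \<open>j\<close> the position in \<open>Ls\<close>. A replica index that is repeated within a list
  produces a repeated edge.\<close>

lemma multi_overlap_moment:
  "(\<integral>p. (\<Prod>ls\<leftarrow>Ls. case p of (w, u) \<Rightarrow> multi_overlap \<sigma> w u ls) \<partial>(I01 \<Otimes>\<^sub>M seq_I01)) = K.edge_moment (edges_of Ls)"
proof -
  let ?F = "\<lambda>p. \<Prod>ls\<leftarrow>Ls. case p of (w, u) \<Rightarrow> multi_overlap \<sigma> w u ls"
  have b: "bounded_meas (I01 \<Otimes>\<^sub>M seq_I01) ?F"
    by (intro bounded_measI[where c=1] borel_measurable_prod_list multi_overlap_measurable abs_prod_list_le_1 multi_overlap_le_1)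
  have "(\<integral>p. ?F p \<partial>(I01 \<Otimes>\<^sub>M seq_I01)) = (\<integral>w. (\<integral>u. ?F (w, u) \<partial>seq_I01) \<partial>I01)"
    by (rule bounded_meas_integral_pair[OF I01.prob_space_axioms prob_seq_I01 b])
  also have "\<dots> = (\<integral>w. (\<integral>u. (\<integral>v. K.edge_prod (edges_of Ls) (w, u, v) \<partial>seq_I01) \<partial>seq_I01) \<partial>I01)"
  proof (intro Bochner_Integration.integral_cong[OF refl])
    fix w and u :: "nat \<Rightarrow> real" assume w: "w \<in> space I01" and u: "u \<in> space seq_I01"
    have int: "integrable I01 (\<lambda>v. \<Prod>l\<leftarrow>ls. mag \<sigma> w (u l) v)" for ls
    proof (rule I01.integrable_bounded[where B=1])
      have "(\<lambda>v. mag \<sigma> w (u l) v) \<in> borel_measurable I01" for l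
        using measurable_compose[OF _ K.kernel_measurable, of "\<lambda>v. (w, u l, v)" I01] w u
        by (simp add: space_seq_I01 space_I01)
      then show "(\<lambda>v. \<Prod>l\<leftarrow>ls. mag \<sigma> w (u l) v) \<in> borel_measurable I01" by (intro borel_measurable_prod_list)
      fix v assume "v \<in> space I01"
      then show "\<bar>\<Prod>l\<leftarrow>ls. mag \<sigma> w (u l) v\<bar> \<le> 1"
        using w u by (intro abs_prod_list_le_1 K.kernel_le_1) (auto simp: space_seq_I01 space_I01)
    qed
    have "?F (w, u) = (\<Prod>j<length Ls. \<integral>v. (\<Prod>l\<leftarrow>Ls ! j. mag \<sigma> w (u l) v) \<partial>I01)"
      by (simp add: prod.list_conv_set_nth multi_overlap_def atLeast0LessThan)
    also have "\<dots> = (\<integral>v. (\<Prod>j<length Ls. \<Prod>l\<leftarrow>Ls ! j. mag \<sigma> w (u l) (v j)) \<partial>seq_I01)"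
      by (rule integral_PiM_prod[symmetric]) (auto intro: int I01.prob_space_axioms)
    also have "\<dots> = (\<integral>v. K.edge_prod (edges_of Ls) (w, u, v) \<partial>seq_I01)"
      by (simp add: K.edge_prod_def edges_of_def prod_list_map_concat o_def prod.distinct_set_conv_list[symmetric] atLeast0LessThan)
    finally show "?F (w, u) = (\<integral>v. K.edge_prod (edges_of Ls) (w, u, v) \<partial>seq_I01)" .
  qed
  finally show ?thesis by (simp add: edge_moment_iterated)
qed

lemma overlap_eq_multi_overlap: "overlap \<sigma> w (u l) (u l') = multi_overlap \<sigma> w u [l, l']"
  by (simp add: overlap_def multi_overlap_def)

lemma overlap_law_eq: "overlap_law \<sigma> = distr (multi_overlap_law \<sigma>) (PiM UNIV (\<lambda>_. borel)) (\<lambda>R (l, l'). R [l, l'])"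
proof -
  have 1: "(\<lambda>R (l, l'). R [l, l']) \<in> measurable (PiM {ls. ls \<noteq> []} (\<lambda>_. borel :: real measure)) (PiM UNIV (\<lambda>_. borel))"
    by (rule measurable_PiM_single') (auto intro!: measurable_component_singleton)
  have 2: "(\<lambda>(w, u). \<lambda>ls\<in>{ls. ls \<noteq> []}. multi_overlap \<sigma> w u ls) \<in> measurable (I01 \<Otimes>\<^sub>M seq_I01) (PiM {ls. ls \<noteq> []} (\<lambda>_. borel))"
    using multi_overlap_measurable unfolding case_prod_unfold by (intro measurable_restrict)
  show ?thesis
    unfolding multi_overlap_law_def overlap_law_def distr_distr[OF 1 2]
    by (rule distr_cong) (auto simp: overlap_eq_multi_overlap fun_eq_iff)
qed

end

abbreviation spin_edge_moment :: "spin_fun \<Rightarrow> (nat \<times> nat) list \<Rightarrow> real" where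
  "spin_edge_moment \<sigma> \<equiv> random_kernel.edge_moment I01 I01 I01 (mag \<sigma>)"

text \<open>Moments of the array with repeated entries reduce to those without, because the entries
  are signs.\<close>

lemma spin_law_eqI:
  assumes spin: "spin_function \<sigma>" "spin_function \<sigma>'"
    and eq: "\<And>es. distinct es \<Longrightarrow> spin_edge_moment \<sigma> es = spin_edge_moment \<sigma>' es"
  shows "spin_law \<sigma> = spin_law \<sigma>'"
  unfolding spin_law_eq
proof (rule moments_determine_law[OF prob_spin_space prob_spin_space])
  fix es :: "(nat \<times> nat) list"
  obtain ds where ds: "distinct ds"
    "\<And>s :: nat \<times> nat \<Rightarrow> real. (\<And>e. s e \<in> {-1, 1}) \<Longrightarrow> (\<Prod>e\<leftarrow>es. s e) = (\<Prod>e\<leftarrow>ds. s e)"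
    by (rule signs_prod_list_distinct[of es]) blast
  have *: "(\<integral>q. (\<Prod>e\<leftarrow>es. spin_at \<tau> e q) \<partial>spin_space) = spin_edge_moment \<tau> ds" if "spin_function \<tau>" for \<tau>
    unfolding spin_moment[OF that ds(1), symmetric]
    by (intro Bochner_Integration.integral_cong refl ds spin_at_sign that)
  show "(\<integral>q. (\<Prod>e\<leftarrow>es. spin_at \<sigma> e q) \<partial>spin_space) = (\<integral>q. (\<Prod>e\<leftarrow>es. spin_at \<sigma>' e q) \<partial>spin_space)"
    using eq[OF ds(1)] * spin by simp
qed (use spin in \<open>auto intro: spin_at_measurable spin_at_le_1\<close>)

text \<open>The law of the array gives the edge moments without repetitions; these give all edge
  moments, among which are all joint moments of the multi-overlaps.\<close>

lemma multi_overlap_law_cong: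
  assumes spin: "spin_function \<sigma>" "spin_function \<sigma>'" and eq: "spin_law \<sigma> = spin_law \<sigma>'"
  shows "multi_overlap_law \<sigma> = multi_overlap_law \<sigma>'"
proof -
  have "spin_edge_moment \<sigma> es = spin_edge_moment \<sigma>' es" for es
  proof (rule edge_moments_determined_by_distinct[OF random_kernel_mag[OF spin(1)] random_kernel_mag[OF spin(2)]])
    fix es :: "(nat \<times> nat) list" assume "distinct es"
    then show "spin_edge_moment \<sigma> es = spin_edge_moment \<sigma>' es"
      using spin_law_moment[OF spin(1)] spin_law_moment[OF spin(2)] eq by metis
  qed
  note em = this
  have "distr (I01 \<Otimes>\<^sub>M seq_I01) (PiM {ls. ls \<noteq> []} (\<lambda>_. borel)) (\<lambda>p. \<lambda>ls\<in>{ls. ls \<noteq> []}. case p of (w, u) \<Rightarrow> multi_overlap \<sigma> w u ls)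
    = distr (I01 \<Otimes>\<^sub>M seq_I01) (PiM {ls. ls \<noteq> []} (\<lambda>_. borel)) (\<lambda>p. \<lambda>ls\<in>{ls. ls \<noteq> []}. case p of (w, u) \<Rightarrow> multi_overlap \<sigma>' w u ls)"
  proof (rule moments_determine_law)
    show "prob_space (I01 \<Otimes>\<^sub>M (seq_I01 :: (nat \<Rightarrow> real) measure))" "prob_space (I01 \<Otimes>\<^sub>M (seq_I01 :: (nat \<Rightarrow> real) measure))"
      by (intro prob_space_pair prob_seq_I01 I01.prob_space_axioms)+
  qed (use em spin in \<open>simp_all only: multi_overlap_measurable multi_overlap_le_1 multi_overlap_moment\<close>)
  then show ?thesis by (simp add: multi_overlap_law_def case_prod_unfold)
qed

corollary overlap_law_cong:
  assumes "spin_function \<sigma>" "spin_function \<sigma>'" "spin_law \<sigma> = spin_law \<sigma>'"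
  shows "overlap_law \<sigma> = overlap_law \<sigma>'"
  using multi_overlap_law_cong[OF assms] assms by (simp add: overlap_law_eq)

section \<open>The Gaussian fields\<close>

text \<open>The summability condition makes \<xi> a power series that converges at 2. Its termwise
  derivative is therefore continuous on [-1, 1], the range of the overlaps, and bounded there by
  compactness.\<close>

lemma xi_deriv_bounded_measurable:
  assumes "(\<lambda>p. 2 ^ p * (\<beta> p)\<^sup>2) summable_on spin_degrees"
  obtains \<phi> b where "\<phi> \<in> borel_measurable borel" "\<And>x. \<bar>x\<bar> \<le> 1 \<Longrightarrow> deriv (xi \<beta>) x = \<phi> x" "\<And>x. \<bar>\<phi> x\<bar> \<le> b"
proof -
  \<comment> \<open>Padding with zeros outside \<open>spin_degrees\<close> turns the unordered sum
    into an ordinary power series.\<close>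
  define a where "a p = (if p \<in> spin_degrees then (\<beta> p)\<^sup>2 else 0)" for p
  have "(\<lambda>p. 2 ^ p * (\<beta> p)\<^sup>2) summable_on spin_degrees \<longleftrightarrow> (\<lambda>p. a p * 2 ^ p) summable_on UNIV"
    by (rule summable_on_cong_neutral) (auto simp: a_def)
  then obtain t where "((\<lambda>p. a p * 2 ^ p) has_sum t) UNIV" using assms unfolding summable_on_def by blast
  then have a2: "summable (\<lambda>p. a p * 2 ^ p)" by (rule sums_summable[OF has_sum_imp_sums])
  have xi_eq: "xi \<beta> x = (\<Sum>p. a p * x ^ p)" if "\<bar>x\<bar> < 2" for x
  proof -
    have "summable (\<lambda>p. norm (a p * x ^ p))" using powser_insidea[OF a2, of x] that by simp
    from norm_summable_imp_has_sum[OF this summable_sums[OF summable_norm_cancel[OF this]]]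
    have "((\<lambda>p. a p * x ^ p) has_sum (\<Sum>p. a p * x ^ p)) UNIV" .
    then have "(\<Sum>\<^sub>\<infinity>p. a p * x ^ p) = (\<Sum>p. a p * x ^ p)" by (rule infsumI)
    moreover have "xi \<beta> x = (\<Sum>\<^sub>\<infinity>p. a p * x ^ p)"
      unfolding xi_def by (rule infsum_cong_neutral) (auto simp: a_def)
    ultimately show ?thesis by simp
  qed
  define D where "D x = (\<Sum>p. diffs a p * x ^ p)" for x :: real
  have deriv: "deriv (xi \<beta>) x = D x" if "\<bar>x\<bar> \<le> 1" for x
  proof (rule DERIV_imp_deriv)
    have "((\<lambda>x. \<Sum>p. a p * x ^ p) has_real_derivative D x) (at x)"
      unfolding D_def using that by (intro termdiffs_strong[OF a2]) auto
    then show "(xi \<beta> has_real_derivative D x) (at x)"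
      using that xi_eq
      by (elim has_field_derivative_transform_within_open[where S="ball 0 2"]) (auto simp: dist_real_def)
  qed
  \<comment> \<open>A radius strictly between 1 and 2: inside the disc where the derived series is
    known to converge, and large enough for continuity at the endpoints of [-1, 1].\<close>
  have "summable (\<lambda>p. diffs a p * (3/2) ^ p)"
    using powser_inside[OF a2] by (intro termdiff_converges[where K=2]) auto
  then have "isCont D x" if "\<bar>x\<bar> \<le> 1" for x
    unfolding D_def using that by (intro isCont_powser[where K="3/2"]) auto
  then have cont: "continuous_on {-1..1} D" by (intro continuous_at_imp_continuous_on ballI) (simp add: abs_le_iff)
  then have "bounded (D ` {-1..1})" by (intro compact_imp_bounded compact_continuous_image) auto
  then obtain b where b: "\<forall>x\<in>{-1..1}. \<bar>D x\<bar> \<le> b" unfolding bounded_iff by auto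
  define \<phi> where "\<phi> x = indicator {-1..1} x *\<^sub>R D x" for x
  show thesis
  proof
    show "\<phi> \<in> borel_measurable borel"
      unfolding \<phi>_def using cont by (intro borel_measurable_continuous_on_indicator) auto
    show "deriv (xi \<beta>) x = \<phi> x" if "\<bar>x\<bar> \<le> 1" for x
      using deriv[OF that] that by (auto simp: \<phi>_def indicator_def)
    show "\<bar>\<phi> x\<bar> \<le> \<bar>b\<bar>" for x
      using b by (force simp: \<phi>_def indicator_def)
  qed
qed

interpretation std_gauss: prob_space std_gauss
  by (rule prob_space_normal_density) simp

lemma gaussian_multiple_second_moment:
  fixes Y :: "'a \<Rightarrow> real"
  assumes Y: "Y \<in> borel_measurable M" and d: "distr M borel Y = distr std_gauss borel (\<lambda>x. s * x)"
  shows "(\<integral>\<omega>. (Y \<omega>)\<^sup>2 \<partial>M) = s\<^sup>2" "integrable M (\<lambda>\<omega>. (Y \<omega>)\<^sup>2)"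
proof -
  have m: "(\<integral>x. x\<^sup>2 \<partial>std_gauss) = 1" "integrable std_gauss (\<lambda>x. x\<^sup>2)"
    using std_normal_distribution_even_moments[of 1] by simp_all
  have "(\<integral>\<omega>. (Y \<omega>)\<^sup>2 \<partial>M) = (\<integral>x. (s * x)\<^sup>2 \<partial>std_gauss)"
    using arg_cong[OF d, of "\<lambda>D. \<integral>x. x\<^sup>2 \<partial>D"] Y by (simp add: integral_distr)
  then show "(\<integral>\<omega>. (Y \<omega>)\<^sup>2 \<partial>M) = s\<^sup>2" using m by (simp add: power_mult_distrib)
  have "integrable (distr std_gauss borel (\<lambda>x. s * x)) (\<lambda>x. x\<^sup>2)"
    using m by (subst integrable_distr_eq) (auto simp: power_mult_distrib)
  then have "integrable (distr M borel Y) (\<lambda>x. x\<^sup>2)" by (simp add: d)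
  then show "integrable M (\<lambda>\<omega>. (Y \<omega>)\<^sup>2)" using Y by (subst (asm) integrable_distr_eq) auto
qed

text \<open>A linear combination of the process is \<open>s\<close> times a standard Gaussian, and
  expanding its second moment identifies \<open>s\<^sup>2\<close> with the quadratic form of the
  covariance. Square integrability of the single variables follows from the one-point case.\<close>

lemma gaussian_char:
  assumes M: "prob_space M" and X: "centered_gaussian_process M T X K" and A: "finite A" "u ` A \<subseteq> T"
  shows "char (distr M borel (\<lambda>\<omega>. \<Sum>k\<in>A. a k * X (u k) \<omega>)) 1 =
    complex_of_real (exp (- (\<Sum>k\<in>A. \<Sum>k'\<in>A. a k * a k' * K (u k) (u k')) / 2))"
proof -
  interpret M: prob_space M by fact
  have X_meas: "X t \<in> borel_measurable M" if "t \<in> T" for t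
    using X that by (simp add: centered_gaussian_process_def)
  have cov: "(\<integral>\<omega>. X t \<omega> * X t' \<omega> \<partial>M) = K t t'" if "t \<in> T" "t' \<in> T" for t t'
    using X that by (simp add: centered_gaussian_process_def)
  have lin: "\<exists>s. distr M borel (\<lambda>\<omega>. \<Sum>t\<in>F. a t * X t \<omega>) = distr std_gauss borel (\<lambda>x. s * x)"
    if "finite F" "F \<subseteq> T" for F a
    using X that by (simp add: centered_gaussian_process_def)
  note sq = gaussian_multiple_second_moment
  have sq_int: "integrable M (\<lambda>\<omega>. (X t \<omega>)\<^sup>2)" if t: "t \<in> T" for t
  proof -
    obtain s where "distr M borel (\<lambda>\<omega>. \<Sum>t\<in>{t}. 1 * X t \<omega>) = distr std_gauss borel (\<lambda>x. s * x)"
      using lin[of "{t}" "\<lambda>_. 1"] t by blast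
    then show ?thesis using sq(2)[OF X_meas[OF t]] by simp
  qed
  have prod_int: "integrable M (\<lambda>\<omega>. X t \<omega> * X t' \<omega>)" if "t \<in> T" "t' \<in> T" for t t'
  proof (rule Bochner_Integration.integrable_bound)
    show "integrable M (\<lambda>\<omega>. (X t \<omega>)\<^sup>2 + (X t' \<omega>)\<^sup>2)" using sq_int that by simp
    show "(\<lambda>\<omega>. X t \<omega> * X t' \<omega>) \<in> borel_measurable M" using X_meas that by simp
    have "\<bar>x * y\<bar> \<le> x\<^sup>2 + y\<^sup>2" for x y :: real
    proof -
      have "2 * (\<bar>x\<bar> * \<bar>y\<bar>) \<le> x\<^sup>2 + y\<^sup>2" using sum_squares_bound[of "\<bar>x\<bar>" "\<bar>y\<bar>"] by simp
      moreover have "0 \<le> \<bar>x\<bar> * \<bar>y\<bar>" by simp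
      ultimately show ?thesis unfolding abs_mult by linarith
    qed
    then show "AE \<omega> in M. norm (X t \<omega> * X t' \<omega>) \<le> norm ((X t \<omega>)\<^sup>2 + (X t' \<omega>)\<^sup>2)" by simp
  qed
  let ?Y = "\<lambda>\<omega>. \<Sum>k\<in>A. a k * X (u k) \<omega>"
  have uT: "u k \<in> T" if "k \<in> A" for k using A that by auto
  have Y_meas: "?Y \<in> borel_measurable M" using X_meas uT by auto
  \<comment> \<open>Different \<open>k\<close> may share the same index \<open>u k\<close>, whereas
    the definition of the process speaks of sums over sets; so coefficients with equal index are
    collected.\<close>
  have "?Y = (\<lambda>\<omega>. \<Sum>t\<in>u ` A. (\<Sum>k\<in>{k\<in>A. u k = t}. a k) * X t \<omega>)"
    using A by (simp add: sum.image_gen[of A _ u] sum_distrib_right)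
  then obtain s where s: "distr M borel ?Y = distr std_gauss borel (\<lambda>x. s * x)"
    using lin[of "u ` A" "\<lambda>t. \<Sum>k\<in>{k\<in>A. u k = t}. a k"] A by auto
  have "s\<^sup>2 = (\<integral>\<omega>. (?Y \<omega>)\<^sup>2 \<partial>M)" using sq(1)[OF Y_meas s] by simp
  also have "\<dots> = (\<integral>\<omega>. (\<Sum>k\<in>A. \<Sum>k'\<in>A. a k * a k' * (X (u k) \<omega> * X (u k') \<omega>)) \<partial>M)"
    by (simp add: power2_eq_square sum_product ac_simps)
  also have "\<dots> = (\<Sum>k\<in>A. \<Sum>k'\<in>A. a k * a k' * K (u k) (u k'))"
    using prod_int uT cov by simp
  finally have s2: "s\<^sup>2 = (\<Sum>k\<in>A. \<Sum>k'\<in>A. a k * a k' * K (u k) (u k'))" .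
  have "char (distr M borel ?Y) 1 = char std_gauss s"
    unfolding s by (simp add: char_def integral_distr mult.commute)
  then show ?thesis by (simp add: char_std_normal_distribution s2)
qed

text \<open>The real characteristic value says that \<open>cos S\<close> has mean \<open>c\<close>
  and \<open>sin S\<close> mean 0; the addition formulas do the rest. The shift \<open>b\<close>
  will be the contribution of the extra Gaussians \<open>z\<close>, which are frozen while the
  fields are averaged.\<close>

lemma (in prob_space) expectation_trig_shift:
  fixes S :: "'a \<Rightarrow> real"
  assumes S: "S \<in> borel_measurable M" and c: "char (distr M borel S) 1 = complex_of_real c"
  shows "(\<integral>\<omega>. cos (S \<omega> + b) \<partial>M) = c * cos b" "(\<integral>\<omega>. sin (S \<omega> + b) \<partial>M) = c * sin b"
proof -
  have i: "complex_integrable M (\<lambda>\<omega>. iexp (S \<omega>))" using S by (intro integrable_iexp) auto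
  have "(\<integral>\<omega>. iexp (S \<omega>) \<partial>M) = complex_of_real c"
    using c S by (simp add: char_def integral_distr)
  then have "(\<integral>\<omega>. Re (iexp (S \<omega>)) \<partial>M) = c" "(\<integral>\<omega>. Im (iexp (S \<omega>)) \<partial>M) = 0"
    using i by (simp_all only: integral_Re[OF i] integral_Im[OF i]) simp_all
  then have 1: "(\<integral>\<omega>. cos (S \<omega>) \<partial>M) = c" "(\<integral>\<omega>. sin (S \<omega>) \<partial>M) = 0"
    by (simp_all add: Re_exp Im_exp)
  have 2: "integrable M (\<lambda>\<omega>. cos (S \<omega>))" "integrable M (\<lambda>\<omega>. sin (S \<omega>))"
    using S by (auto intro!: integrable_bounded[where B=1])
  show "(\<integral>\<omega>. cos (S \<omega> + b) \<partial>M) = c * cos b" "(\<integral>\<omega>. sin (S \<omega> + b) \<partial>M) = c * sin b"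
    using 1 2 by (simp_all add: cos_add sin_add)
qed

text \<open>Different copies of the process are independent, so the characteristic function is the
  product over the copies of the Gaussian ones. It depends on \<open>w\<close> and the
  \<open>u k\<close> through their overlaps only.\<close>

lemma gaussian_fields_char:
  fixes n N :: nat and a :: "nat \<Rightarrow> nat \<Rightarrow> real"
  assumes G: "gaussian_fields \<beta> \<sigma> \<Omega> g" and w: "w \<in> {0..1}" and u: "\<And>k. u k \<in> {0..1}"
  defines "S \<equiv> \<lambda>\<omega>. \<Sum>i<n. \<Sum>k<N. a k i * g (Inl i) w (u k) \<omega>"
  shows "S \<in> borel_measurable \<Omega>"
    and "char (distr \<Omega> borel S) 1 = complex_of_real
      (\<Prod>i<n. exp (- (\<Sum>k<N. \<Sum>k'<N. a k i * a k' i * deriv (xi \<beta>) (overlap \<sigma> w (u k) (u k'))) / 2))"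
proof -
  interpret \<Omega>: prob_space \<Omega> using G by (simp add: gaussian_fields_def)
  have proc: "centered_gaussian_process \<Omega> {0..1} (g (Inl i) w) (\<lambda>u u'. deriv (xi \<beta>) (overlap \<sigma> w u u'))" for i
    using G w by (simp add: gaussian_fields_def)
  have ind: "\<Omega>.indep_vars (\<lambda>_. PiM {0..1} (\<lambda>_. borel)) (\<lambda>j \<omega>. \<lambda>u\<in>{0..1}. g j w u \<omega>) UNIV"
    using G w by (simp add: gaussian_fields_def)
  \<comment> \<open>A linear functional of the path of copy \<open>j\<close>; independence of whole
    paths passes to these. The \<open>Inr\<close> branch only makes \<open>h\<close> total, as the
    family is restricted to \<open>Inl\<close> indices afterwards.\<close>
  define h where "h j x = (case j of Inl i \<Rightarrow> (\<Sum>k<N. a k i * x (u k)) | Inr _ \<Rightarrow> 0)"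
    for j :: "nat + nat" and x :: "real \<Rightarrow> real"
  have h: "h j \<in> borel_measurable (PiM {0..1} (\<lambda>_. borel))" for j
  proof (cases j)
    case (Inl i)
    have "(\<lambda>x. x (u k)) \<in> borel_measurable (PiM {0..1} (\<lambda>_. borel :: real measure))" for k
      using u by (intro measurable_component_singleton) auto
    then show ?thesis unfolding h_def Inl by simp
  next
    case (Inr i)
    then have "h j = (\<lambda>_. 0)" by (simp add: h_def fun_eq_iff)
    then show ?thesis by simp
  qed
  have "\<Omega>.indep_vars (\<lambda>_. borel) (\<lambda>j \<omega>. h j (\<lambda>u\<in>{0..1}. g j w u \<omega>)) (Inl ` {..<n})"
    using \<Omega>.indep_vars_compose2[OF ind h] by (rule \<Omega>.indep_vars_subset) auto
  from \<Omega>.char_distr_sum[OF this, of 1]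
  have "char (distr \<Omega> borel S) 1 = (\<Prod>i<n. char (distr \<Omega> borel (\<lambda>\<omega>. \<Sum>k<N. a k i * g (Inl i) w (u k) \<omega>)) 1)"
    using u by (simp add: sum.reindex prod.reindex h_def S_def)
  also have "\<dots> = (\<Prod>i<n. complex_of_real (exp (- (\<Sum>k<N. \<Sum>k'<N. a k i * a k' i * deriv (xi \<beta>) (overlap \<sigma> w (u k) (u k'))) / 2)))"
    using u by (intro prod.cong refl gaussian_char[OF \<Omega>.prob_space_axioms proc]) auto
  finally show "char (distr \<Omega> borel S) 1 = complex_of_real
      (\<Prod>i<n. exp (- (\<Sum>k<N. \<Sum>k'<N. a k i * a k' i * deriv (xi \<beta>) (overlap \<sigma> w (u k) (u k'))) / 2))"
    by simp
  show "S \<in> borel_measurable \<Omega>"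
  proof -
    have [measurable]: "g (Inl i) w (u k) \<in> borel_measurable \<Omega>" for i k
      using proc[of i] u[of k] unfolding centered_gaussian_process_def by blast
    show ?thesis unfolding S_def by measurable
  qed
qed

lemma bounded_meas_integral_pair_snd:
  assumes "prob_space M" "prob_space N" "bounded_meas (M \<Otimes>\<^sub>M N) F"
  shows "(\<integral>p. F p \<partial>(M \<Otimes>\<^sub>M N)) = (\<integral>y. (\<integral>x. F (x, y) \<partial>M) \<partial>N)"
proof -
  interpret M: prob_space M by fact
  interpret N: prob_space N by fact
  interpret MN: pair_prob_space M N ..
  have "integrable (M \<Otimes>\<^sub>M N) (\<lambda>(x, y). F (x, y))" using MN.bounded_meas_integrable[OF assms(3)] by simp
  from MN.integral_snd[OF this] show ?thesis by simp
qed

lemma (in prob_space) bounded_meas_integral_snd: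
  assumes "bounded_meas (M \<Otimes>\<^sub>M N) F"
  shows "bounded_meas N (\<lambda>y. \<integral>x. F (x, y) \<partial>M)"
proof (rule bounded_meas_integral)
  show "bounded_meas (N \<Otimes>\<^sub>M M) (\<lambda>(y, x). F (x, y))"
    using bounded_meas_compose[OF assms measurable_pair_swap'] by (simp add: case_prod_unfold)
qed

text \<open>Cut off outside \<open>[-1, 1]\<close>, where \<open>deriv\<close> need not be measurable.\<close>

definition xi_deriv :: "(nat \<Rightarrow> real) \<Rightarrow> real \<Rightarrow> real" where
  "xi_deriv \<beta> x = (if \<bar>x\<bar> \<le> 1 then deriv (xi \<beta>) x else 0)"

abbreviation gauss_seq :: "(nat \<Rightarrow> real) measure" where
  "gauss_seq \<equiv> PiM UNIV (\<lambda>_. std_gauss)"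

text \<open>Each replica has its own pair \<open>(z, z')\<close>, because \<open>E_prime\<close>
  integrates over these as well as over \<open>u\<close>.\<close>

abbreviation noise_seq :: "(nat \<Rightarrow> (nat \<Rightarrow> real) \<times> (nat \<Rightarrow> real)) measure" where
  "noise_seq \<equiv> PiM UNIV (\<lambda>_. gauss_seq \<Otimes>\<^sub>M gauss_seq)"

lemma prob_gauss_seq: "prob_space gauss_seq"
  by (intro prob_space_PiM std_gauss.prob_space_axioms)

lemma prob_gauss_pair: "prob_space (gauss_seq \<Otimes>\<^sub>M gauss_seq)"
  by (intro prob_space_pair prob_gauss_seq)

lemma prob_noise_seq: "prob_space noise_seq"
  by (intro prob_space_PiM prob_gauss_pair)

section \<open>Replicas of the cavity field\<close>

locale cavity_field =
  fixes \<beta> :: "nat \<Rightarrow> real" and \<sigma> :: spin_fun and \<Omega> :: "'a measure"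
    and g :: "nat + nat \<Rightarrow> real \<Rightarrow> real \<Rightarrow> 'a \<Rightarrow> real"
  assumes summable: "(\<lambda>p. 2 ^ p * (\<beta> p)\<^sup>2) summable_on spin_degrees"
    and spin: "spin_function \<sigma>"
    and fields: "gaussian_fields \<beta> \<sigma> \<Omega> g"
begin

sublocale \<Omega>: prob_space \<Omega>
  using fields by (simp add: gaussian_fields_def)

sublocale K: random_kernel I01 I01 I01 "mag \<sigma>"
  by (rule random_kernel_mag[OF spin])

lemma xi_deriv_measurable[measurable]: "xi_deriv \<beta> \<in> borel_measurable borel"
proof -
  obtain \<phi> b where [measurable]: "\<phi> \<in> borel_measurable borel"
    and \<phi>: "\<And>x. \<bar>x\<bar> \<le> 1 \<Longrightarrow> deriv (xi \<beta>) x = \<phi> x" "\<And>x. \<bar>\<phi> x\<bar> \<le> b"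
    by (rule xi_deriv_bounded_measurable[OF summable]) blast
  have "xi_deriv \<beta> = (\<lambda>x. if \<bar>x\<bar> \<le> 1 then \<phi> x else 0)" by (auto simp: xi_deriv_def \<phi> fun_eq_iff)
  then show ?thesis by simp
qed

lemma xi_deriv_bounded: obtains b where "\<And>x. \<bar>xi_deriv \<beta> x\<bar> \<le> b"
proof -
  obtain \<phi> b where "\<And>x. \<bar>x\<bar> \<le> 1 \<Longrightarrow> deriv (xi \<beta>) x = \<phi> x" "\<And>x. \<bar>\<phi> x\<bar> \<le> b"
    by (rule xi_deriv_bounded_measurable[OF summable]) blast
  then have "\<bar>xi_deriv \<beta> x\<bar> \<le> \<bar>b\<bar>" for x by (auto simp: xi_deriv_def intro: order_trans[OF _ abs_ge_self])
  then show thesis by (rule that)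
qed

lemma overlap_le_1: "w \<in> {0..1} \<Longrightarrow> u \<in> {0..1} \<Longrightarrow> u' \<in> {0..1} \<Longrightarrow> \<bar>overlap \<sigma> w u u'\<bar> \<le> 1"
  unfolding overlap_def
  by (rule I01.abs_integral_le) (auto simp: abs_mult space_I01 intro!: mult_le_one K.kernel_le_1)

lemma overlap_measurable[measurable]: "(\<lambda>(w, u, u'). overlap \<sigma> w u u') \<in> borel_measurable (I01 \<Otimes>\<^sub>M I01 \<Otimes>\<^sub>M I01)"
proof -
  have m1: "(\<lambda>((w, u, u'), v). mag \<sigma> w u v) \<in> borel_measurable ((I01 \<Otimes>\<^sub>M I01 \<Otimes>\<^sub>M I01) \<Otimes>\<^sub>M I01)"
    using measurable_compose[OF _ K.kernel_measurable, of "\<lambda>((w, u, u'), v). (w, u, v)" "(I01 \<Otimes>\<^sub>M I01 \<Otimes>\<^sub>M I01) \<Otimes>\<^sub>M I01"]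
    by (simp add: case_prod_unfold)
  have m2: "(\<lambda>((w, u, u'), v). mag \<sigma> w u' v) \<in> borel_measurable ((I01 \<Otimes>\<^sub>M I01 \<Otimes>\<^sub>M I01) \<Otimes>\<^sub>M I01)"
    using measurable_compose[OF _ K.kernel_measurable, of "\<lambda>((w, u, u'), v). (w, u', v)" "(I01 \<Otimes>\<^sub>M I01 \<Otimes>\<^sub>M I01) \<Otimes>\<^sub>M I01"]
    by (simp add: case_prod_unfold)
  show ?thesis
    using borel_measurable_times[OF m1 m2] unfolding overlap_def case_prod_unfold by measurable
qed

lemma deriv_overlap:
  "w \<in> {0..1} \<Longrightarrow> u \<in> {0..1} \<Longrightarrow> u' \<in> {0..1} \<Longrightarrow> deriv (xi \<beta>) (overlap \<sigma> w u u') = xi_deriv \<beta> (overlap \<sigma> w u u')"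
  using overlap_le_1 by (simp add: xi_deriv_def)

definition noise_scale :: "real \<Rightarrow> real \<Rightarrow> real" where
  "noise_scale w u = sqrt (xi_deriv \<beta> 1 - xi_deriv \<beta> (overlap \<sigma> w u u))"

lemma G_xi_eq: "w \<in> {0..1} \<Longrightarrow> u \<in> {0..1} \<Longrightarrow> G_xi \<beta> \<sigma> g i w u \<omega> z = g (Inl i) w u \<omega> + z i * noise_scale w u"
  by (simp add: G_xi_def noise_scale_def deriv_overlap) (simp add: xi_deriv_def)

lemma noise_scale_measurable[measurable]: "(\<lambda>(w, u). noise_scale w u) \<in> borel_measurable (I01 \<Otimes>\<^sub>M I01)"
proof -
  have "(\<lambda>(w, u). overlap \<sigma> w u u) \<in> borel_measurable (I01 \<Otimes>\<^sub>M I01)"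
    using measurable_compose[OF _ overlap_measurable, of "\<lambda>(w, u). (w, u, u)" "I01 \<Otimes>\<^sub>M I01"]
    by (simp add: case_prod_unfold)
  then show ?thesis unfolding noise_scale_def case_prod_unfold by measurable
qed

lemma field_measurable: "(\<lambda>(w, u, \<omega>). g j w u \<omega>) \<in> borel_measurable (I01 \<Otimes>\<^sub>M I01 \<Otimes>\<^sub>M \<Omega>)"
  using fields by (simp add: gaussian_fields_def)

lemma G_xi_measurable:
  assumes W[measurable]: "W \<in> measurable N I01" and U[measurable]: "U \<in> measurable N I01"
    and O[measurable]: "Om \<in> measurable N \<Omega>" and Z[measurable]: "(\<lambda>x. Z x i) \<in> borel_measurable N"
  shows "(\<lambda>x. G_xi \<beta> \<sigma> g i (W x) (U x) (Om x) (Z x)) \<in> borel_measurable N"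
proof -
  have "(\<lambda>x. g (Inl i) (W x) (U x) (Om x)) \<in> borel_measurable N"
    using measurable_compose[OF _ field_measurable, of "\<lambda>x. (W x, U x, Om x)" N "Inl i"] by simp
  moreover have "(\<lambda>x. noise_scale (W x) (U x)) \<in> borel_measurable N"
    using measurable_compose[OF _ noise_scale_measurable, of "\<lambda>x. (W x, U x)" N] by simp
  ultimately have "(\<lambda>x. g (Inl i) (W x) (U x) (Om x) + Z x i * noise_scale (W x) (U x)) \<in> borel_measurable N"
    by measurable
  moreover have "W x \<in> {0..1}" "U x \<in> {0..1}" if "x \<in> space N" for x
    using measurable_space[OF W that] measurable_space[OF U that] by (auto simp: space_I01)
  ultimately show ?thesis by (subst measurable_cong[OF G_xi_eq]) auto
qed

text \<open>The pair \<open>(w, \<omega>)\<close> is shared by all replicas, while \<open>u\<close>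
  and the extra Gaussians are drawn afresh for each. A product of averages \<open>E_prime\<close>
  for the same \<open>(w, \<omega>)\<close> is an average over this space.\<close>

definition replicas :: "((real \<times> 'a) \<times> (nat \<Rightarrow> real) \<times> (nat \<Rightarrow> (nat \<Rightarrow> real) \<times> (nat \<Rightarrow> real))) measure" where
  "replicas = (I01 \<Otimes>\<^sub>M \<Omega>) \<Otimes>\<^sub>M (seq_I01 \<Otimes>\<^sub>M noise_seq)"

lemma prob_base: "prob_space (I01 \<Otimes>\<^sub>M \<Omega>)"
  by (intro prob_space_pair I01.prob_space_axioms \<Omega>.prob_space_axioms)

lemma prob_seq_noise: "prob_space (seq_I01 \<Otimes>\<^sub>M noise_seq)"
  by (intro prob_space_pair prob_seq_I01 prob_noise_seq)

lemma prob_replicas: "prob_space replicas"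
  unfolding replicas_def by (intro prob_space_pair prob_base prob_seq_noise)

definition replica_field :: "nat \<times> nat \<Rightarrow> (real \<times> 'a) \<times> (nat \<Rightarrow> real) \<times> (nat \<Rightarrow> (nat \<Rightarrow> real) \<times> (nat \<Rightarrow> real)) \<Rightarrow> real" where
  "replica_field = (\<lambda>(k, i) ((w, \<omega>), (u, \<zeta>)). G_xi \<beta> \<sigma> g i w (u k) \<omega> (fst (\<zeta> k)))"

lemma replica_field_measurable[measurable]: "replica_field j \<in> borel_measurable replicas"
proof -
  obtain k i where "j = (k, i)" by (cases j)
  moreover have "(\<lambda>p. G_xi \<beta> \<sigma> g i (fst (fst p)) (fst (snd p) k) (snd (fst p)) (fst (snd (snd p) k))) \<in> borel_measurable replicas"
    unfolding replicas_def
  proof (rule G_xi_measurable)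
    have [measurable]: "(\<lambda>p. snd (snd p) k) \<in> measurable ((I01 \<Otimes>\<^sub>M \<Omega>) \<Otimes>\<^sub>M (seq_I01 \<Otimes>\<^sub>M noise_seq)) (gauss_seq \<Otimes>\<^sub>M gauss_seq)"
      by (rule measurable_compose[OF _ measurable_component_singleton[where I=UNIV]]) auto
    have "(\<lambda>p. fst (snd (snd p) k)) \<in> measurable ((I01 \<Otimes>\<^sub>M \<Omega>) \<Otimes>\<^sub>M (seq_I01 \<Otimes>\<^sub>M noise_seq)) gauss_seq"
      by measurable
    from measurable_compose[OF this measurable_component_singleton[of i UNIV]]
    show "(\<lambda>p. fst (snd (snd p) k) i) \<in> borel_measurable ((I01 \<Otimes>\<^sub>M \<Omega>) \<Otimes>\<^sub>M (seq_I01 \<Otimes>\<^sub>M noise_seq))" by simp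
  qed measurable
  ultimately show ?thesis by (simp add: replica_field_def case_prod_unfold)
qed

definition averaged_trig :: "nat \<Rightarrow> (nat \<times> nat \<Rightarrow> real) \<Rightarrow> (real \<Rightarrow> real) \<Rightarrow> (nat \<times> nat \<Rightarrow> real) \<Rightarrow> (nat \<Rightarrow> (nat \<Rightarrow> real) \<times> (nat \<Rightarrow> real)) \<Rightarrow> real" where
  "averaged_trig N a trig R \<zeta> =
    (\<Prod>i<N. exp (- (\<Sum>k<N. \<Sum>k'<N. a (k, i) * a (k', i) * xi_deriv \<beta> (R (k, k'))) / 2)) *
    trig (\<Sum>i<N. \<Sum>k<N. a (k, i) * (fst (\<zeta> k) i * sqrt (xi_deriv \<beta> 1 - xi_deriv \<beta> (R (k, k)))))"

text \<open>This is where the spin function disappears: the right-hand side knows \<sigma> only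
  through \<open>overlap_law \<sigma>\<close>, while the law of the noise is universal.\<close>

lemma replica_trig:
  assumes trig: "trig = cos \<or> trig = sin"
  shows "(\<integral>p. trig (\<Sum>j\<in>{..<N} \<times> {..<N}. a j * replica_field j p) \<partial>replicas) =
    (\<integral>\<zeta>. (\<integral>R. averaged_trig N a trig R \<zeta> \<partial>overlap_law \<sigma>) \<partial>noise_seq)"
proof -
  let ?J = "{..<N} \<times> {..<N}"
  let ?F = "\<lambda>p. trig (\<Sum>j\<in>?J. a j * replica_field j p)"
  have tm[measurable]: "trig \<in> borel_measurable borel" using trig by auto
  have t1: "\<bar>trig x\<bar> \<le> 1" for x using trig by auto
  have b: "bounded_meas ((I01 \<Otimes>\<^sub>M \<Omega>) \<Otimes>\<^sub>M (seq_I01 \<Otimes>\<^sub>M noise_seq)) ?F"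
    using t1 unfolding replicas_def[symmetric] by (intro bounded_measI[where c=1]) auto
  let ?H = "\<lambda>w u \<zeta>. \<integral>\<omega>. ?F ((w, \<omega>), (u, \<zeta>)) \<partial>\<Omega>"
  have H: "bounded_meas ((I01 \<Otimes>\<^sub>M seq_I01) \<Otimes>\<^sub>M noise_seq) (\<lambda>((w, u), \<zeta>). ?H w u \<zeta>)"
  proof -
    have "bounded_meas (((I01 \<Otimes>\<^sub>M seq_I01) \<Otimes>\<^sub>M noise_seq) \<Otimes>\<^sub>M \<Omega>) (\<lambda>(((w, u), \<zeta>), \<omega>). ?F ((w, \<omega>), (u, \<zeta>)))"
      using bounded_meas_compose[OF b, of "\<lambda>(((w, u), \<zeta>), \<omega>). ((w, \<omega>), (u, \<zeta>))" "((I01 \<Otimes>\<^sub>M seq_I01) \<Otimes>\<^sub>M noise_seq) \<Otimes>\<^sub>M \<Omega>"]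
      by (simp add: case_prod_unfold)
    then show ?thesis
      using \<Omega>.bounded_meas_integral[of "(I01 \<Otimes>\<^sub>M seq_I01) \<Otimes>\<^sub>M noise_seq" "\<lambda>((w, u), \<zeta>) \<omega>. ?F ((w, \<omega>), (u, \<zeta>))"]
      by (simp add: case_prod_unfold)
  qed
  \<comment> \<open>The integrals are ordered with \<omega> innermost, where the Gaussian formula
    applies, then \<open>(w, u)\<close>, which is mapped to the overlap array, and \<zeta>
    outermost.\<close>
  have "(\<integral>p. ?F p \<partial>replicas) = (\<integral>q. (\<integral>p. ?F (p, q) \<partial>(I01 \<Otimes>\<^sub>M \<Omega>)) \<partial>(seq_I01 \<Otimes>\<^sub>M noise_seq))"
    unfolding replicas_def by (rule bounded_meas_integral_pair_snd[OF prob_base prob_seq_noise b])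
  also have "\<dots> = (\<integral>\<zeta>. (\<integral>u. (\<integral>p. ?F (p, (u, \<zeta>)) \<partial>(I01 \<Otimes>\<^sub>M \<Omega>)) \<partial>seq_I01) \<partial>noise_seq)"
    by (rule bounded_meas_integral_pair_snd[OF prob_seq_I01 prob_noise_seq])
      (rule prob_space.bounded_meas_integral_snd[OF prob_base b])
  also have "\<dots> = (\<integral>\<zeta>. (\<integral>u. (\<integral>w. ?H w u \<zeta> \<partial>I01) \<partial>seq_I01) \<partial>noise_seq)"
  proof (intro Bochner_Integration.integral_cong[OF refl] bounded_meas_integral_pair I01.prob_space_axioms \<Omega>.prob_space_axioms)
    fix \<zeta> :: "nat \<Rightarrow> (nat \<Rightarrow> real) \<times> (nat \<Rightarrow> real)" and u :: "nat \<Rightarrow> real"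
    assume "\<zeta> \<in> space noise_seq" "u \<in> space seq_I01"
    then have "(u, \<zeta>) \<in> space (seq_I01 \<Otimes>\<^sub>M noise_seq)" by (simp add: space_pair_measure)
    from bounded_meas_compose[OF b measurable_Pair2'[OF this]]
    show "bounded_meas (I01 \<Otimes>\<^sub>M \<Omega>) (\<lambda>p. ?F (p, u, \<zeta>))" .
  qed
  also have "\<dots> = (\<integral>\<zeta>. (\<integral>R. averaged_trig N a trig R \<zeta> \<partial>overlap_law \<sigma>) \<partial>noise_seq)"
  proof (rule Bochner_Integration.integral_cong[OF refl])
    fix \<zeta> assume \<zeta>: "\<zeta> \<in> space noise_seq"
    have "bounded_meas (I01 \<Otimes>\<^sub>M seq_I01) (\<lambda>(w, u). ?H w u \<zeta>)"
      using bounded_meas_compose[OF H measurable_Pair2'[OF \<zeta>]] by (simp add: case_prod_unfold)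
    from bounded_meas_integral_pair_snd[OF I01.prob_space_axioms prob_seq_I01 this]
    have "(\<integral>u. (\<integral>w. ?H w u \<zeta> \<partial>I01) \<partial>seq_I01) = (\<integral>(w, u). ?H w u \<zeta> \<partial>(I01 \<Otimes>\<^sub>M seq_I01))"
      by simp
    also have "\<dots> = (\<integral>p. averaged_trig N a trig (case p of (w, u) \<Rightarrow> \<lambda>(l, l'). overlap \<sigma> w (u l) (u l')) \<zeta> \<partial>(I01 \<Otimes>\<^sub>M seq_I01))"
    proof (rule Bochner_Integration.integral_cong[OF refl])
      fix p assume p: "p \<in> space (I01 \<Otimes>\<^sub>M (seq_I01 :: (nat \<Rightarrow> real) measure))"
      then obtain w u where wu: "p = (w, u)" "w \<in> {0..1}" "\<And>k. u k \<in> {0..1}"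
        by (auto simp: space_pair_measure space_I01 space_seq_I01)
      let ?S = "\<lambda>\<omega>. \<Sum>i<N. \<Sum>k<N. a (k, i) * g (Inl i) w (u k) \<omega>"
      let ?B = "\<Sum>i<N. \<Sum>k<N. a (k, i) * (fst (\<zeta> k) i * noise_scale w (u k))"
      have sum: "(\<Sum>j\<in>?J. a j * replica_field j ((w, \<omega>), (u, \<zeta>))) = ?S \<omega> + ?B" for \<omega>
      proof -
        have "(\<Sum>j\<in>?J. a j * replica_field j ((w, \<omega>), (u, \<zeta>))) =
            (\<Sum>k<N. \<Sum>i<N. a (k, i) * replica_field (k, i) ((w, \<omega>), (u, \<zeta>)))"
          by (simp add: sum.cartesian_product)
        also have "\<dots> = (\<Sum>i<N. \<Sum>k<N. a (k, i) * replica_field (k, i) ((w, \<omega>), (u, \<zeta>)))"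
          by (rule sum.swap)
        also have "\<dots> = ?S \<omega> + ?B"
          using wu by (simp add: replica_field_def G_xi_eq distrib_left sum.distrib)
        finally show ?thesis .
      qed
      note char = gaussian_fields_char[where u=u and n=N and N=N and a="\<lambda>k i. a (k, i)", OF fields wu(2) wu(3)]
      have "(\<integral>\<omega>. trig (?S \<omega> + ?B) \<partial>\<Omega>) =
          (\<Prod>i<N. exp (- (\<Sum>k<N. \<Sum>k'<N. a (k, i) * a (k', i) * deriv (xi \<beta>) (overlap \<sigma> w (u k) (u k'))) / 2)) * trig ?B"
        using trig by (elim disjE) (simp_all only: \<Omega>.expectation_trig_shift[OF char])
      then show "(case p of (w, u) \<Rightarrow> ?H w u \<zeta>) = averaged_trig N a trig (case p of (w, u) \<Rightarrow> \<lambda>(l, l'). overlap \<sigma> w (u l) (u l')) \<zeta>"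
        using wu by (simp add: sum averaged_trig_def deriv_overlap noise_scale_def)
    qed
    also have "\<dots> = (\<integral>R. averaged_trig N a trig R \<zeta> \<partial>overlap_law \<sigma>)"
    proof -
      have 1: "(\<lambda>(w, u) (l, l'). overlap \<sigma> w (u l) (u l')) \<in> measurable (I01 \<Otimes>\<^sub>M seq_I01) (PiM (UNIV :: (nat \<times> nat) set) (\<lambda>_. borel))"
      proof (rule measurable_PiM_single')
        fix e :: "nat \<times> nat"
        show "(\<lambda>p. (case p of (w, u) \<Rightarrow> \<lambda>(l, l'). overlap \<sigma> w (u l) (u l')) e) \<in> borel_measurable (I01 \<Otimes>\<^sub>M seq_I01)"
          using measurable_compose[OF _ overlap_measurable, of "\<lambda>(w, u). (w, u (fst e), u (snd e))" "I01 \<Otimes>\<^sub>M seq_I01"]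
          by (simp add: case_prod_unfold)
      qed auto
      have [measurable]: "(\<lambda>R. R e) \<in> borel_measurable (PiM UNIV (\<lambda>_. borel :: real measure))" for e :: "nat \<times> nat"
        by (rule measurable_component_singleton) simp
      have 2: "(\<lambda>R. averaged_trig N a trig R \<zeta>) \<in> borel_measurable (PiM UNIV (\<lambda>_. borel))"
        unfolding averaged_trig_def by measurable
      show ?thesis unfolding overlap_law_def by (rule integral_distr[OF 1 2, symmetric])
    qed
    finally show "(\<integral>u. (\<integral>w. ?H w u \<zeta> \<partial>I01) \<partial>seq_I01) = (\<integral>R. averaged_trig N a trig R \<zeta> \<partial>overlap_law \<sigma>)" .
  qed
  finally show ?thesis .
qed

end

section \<open>The cavity equations\<close>

lemma replica_field_law:
  assumes X: "cavity_field \<beta> \<sigma> \<Omega> g" and Y: "cavity_field \<beta> \<sigma>' \<Omega>' g'" and law: "overlap_law \<sigma> = overlap_law \<sigma>'"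
  shows "distr (cavity_field.replicas \<Omega>) (PiM ({..<N} \<times> {..<N}) (\<lambda>_. borel)) (\<lambda>p. \<lambda>j\<in>{..<N} \<times> {..<N}. cavity_field.replica_field \<beta> \<sigma> g j p)
    = distr (cavity_field.replicas \<Omega>') (PiM ({..<N} \<times> {..<N}) (\<lambda>_. borel)) (\<lambda>p. \<lambda>j\<in>{..<N} \<times> {..<N}. cavity_field.replica_field \<beta> \<sigma>' g' j p)"
proof -
  interpret X: cavity_field \<beta> \<sigma> \<Omega> g by fact
  interpret Y: cavity_field \<beta> \<sigma>' \<Omega>' g' by fact
  show ?thesis
    by (rule trig_determines_law[OF X.prob_replicas Y.prob_replicas])
      (simp_all add: X.replica_trig Y.replica_trig law)
qed

lemma cosh_measurable[measurable]: "cosh \<in> borel_measurable (borel :: real measure)"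
  and tanh_measurable[measurable]: "tanh \<in> borel_measurable (borel :: real measure)"
  by (auto intro!: borel_measurable_continuous_onI continuous_intros)

text \<open>The weight of the cavity equations is not bounded, and its moments do not determine its law; hence
  the truncation at \<open>L + 1\<close>. The division makes the values lie in \<open>[-1, 1]\<close>.\<close>

definition truncated_weight :: "nat \<Rightarrow> nat set \<times> nat \<Rightarrow> (nat \<Rightarrow> real) \<Rightarrow> real" where
  "truncated_weight n = (\<lambda>(C, L) x. (\<Prod>i\<in>C. tanh (x i)) * (min (\<Prod>i<n. cosh (x i)) (real (Suc L)) / real (Suc L)))"

lemma abs_prod_tanh_le_1: "\<bar>\<Prod>i\<in>C. tanh (x i :: real)\<bar> \<le> 1"
  unfolding abs_prod using tanh_real_bounds
  by (intro prod_le_1) (auto simp: abs_le_iff less_imp_le intro: order.strict_implies_order)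

lemma prod_cosh_ge_1: "1 \<le> (\<Prod>i<n. cosh (x i :: real))"
  by (intro prod_ge_1 cosh_real_ge_1)

lemma truncated_weight_le_1: "\<bar>truncated_weight n c x\<bar> \<le> 1"
proof -
  obtain C L where c: "c = (C, L)" by (cases c)
  have "\<bar>min (\<Prod>i<n. cosh (x i)) (real (Suc L)) / real (Suc L)\<bar> \<le> 1"
    using prod_cosh_ge_1[of x n] by (simp add: abs_le_iff divide_simps)
  then show ?thesis
    unfolding c truncated_weight_def prod.case abs_mult[of "\<Prod>i\<in>C. tanh (x i)"]
    by (intro mult_le_one abs_prod_tanh_le_1 abs_ge_zero)
qed

lemma truncated_weight_measurable:
  assumes "fst c \<subseteq> {..<n}" "\<And>i. i < n \<Longrightarrow> (\<lambda>y. x y i) \<in> borel_measurable M"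
  shows "(\<lambda>y. truncated_weight n c (x y)) \<in> borel_measurable M"
proof -
  have "(\<lambda>y. tanh (x y i)) \<in> borel_measurable M" if "i \<in> fst c" for i
    using that assms by (intro measurable_compose[OF _ tanh_measurable]) auto
  moreover have "(\<lambda>y. cosh (x y i)) \<in> borel_measurable M" if "i < n" for i
    using that assms by (intro measurable_compose[OF _ cosh_measurable]) auto
  ultimately show ?thesis unfolding truncated_weight_def case_prod_unfold by auto
qed

lemma truncated_weight_cong:
  assumes "fst c \<subseteq> {..<n}" "\<And>i. i < n \<Longrightarrow> x i = y i"
  shows "truncated_weight n c x = truncated_weight n c y"
proof -
  have "(\<Prod>i\<in>fst c. tanh (x i)) = (\<Prod>i\<in>fst c. tanh (y i))" "(\<Prod>i<n. cosh (x i)) = (\<Prod>i<n. cosh (y i))"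
    using assms by (auto intro!: prod.cong)
  then show ?thesis unfolding truncated_weight_def case_prod_unfold by simp
qed

abbreviation inner_space :: "(real \<times> (nat \<Rightarrow> real) \<times> (nat \<Rightarrow> real)) measure" where
  "inner_space \<equiv> I01 \<Otimes>\<^sub>M gauss_seq \<Otimes>\<^sub>M gauss_seq"

lemma prob_inner_space: "prob_space inner_space"
  by (intro prob_space_pair prob_gauss_seq I01.prob_space_axioms)

context cavity_field
begin

definition inner_field :: "nat \<Rightarrow> real \<times> 'a \<Rightarrow> real \<times> (nat \<Rightarrow> real) \<times> (nat \<Rightarrow> real) \<Rightarrow> real" where
  "inner_field i = (\<lambda>(w, \<omega>) (u, z, z'). G_xi \<beta> \<sigma> g i w u \<omega> z)"

lemma inner_field_measurable[measurable]:
  "(\<lambda>(p, y). inner_field i p y) \<in> borel_measurable ((I01 \<Otimes>\<^sub>M \<Omega>) \<Otimes>\<^sub>M inner_space)"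
proof -
  have "(\<lambda>q. G_xi \<beta> \<sigma> g i (fst (fst q)) (fst (snd q)) (snd (fst q)) (fst (snd (snd q)))) \<in> borel_measurable ((I01 \<Otimes>\<^sub>M \<Omega>) \<Otimes>\<^sub>M inner_space)"
  proof (rule G_xi_measurable)
    have "(\<lambda>q. fst (snd (snd q))) \<in> measurable ((I01 \<Otimes>\<^sub>M \<Omega>) \<Otimes>\<^sub>M inner_space) gauss_seq" by measurable
    from measurable_compose[OF this measurable_component_singleton[of i UNIV]]
    show "(\<lambda>q. fst (snd (snd q)) i) \<in> borel_measurable ((I01 \<Otimes>\<^sub>M \<Omega>) \<Otimes>\<^sub>M inner_space)" by simp
  qed measurable
  then show ?thesis by (simp add: inner_field_def case_prod_unfold)
qed

lemma inner_field_section_measurable: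
  assumes "p \<in> space (I01 \<Otimes>\<^sub>M \<Omega>)" shows "inner_field i p \<in> borel_measurable inner_space"
  using measurable_compose[OF measurable_Pair1'[OF assms] inner_field_measurable] by simp

definition mean_truncated :: "nat \<Rightarrow> nat set \<times> nat \<Rightarrow> real \<times> 'a \<Rightarrow> real" where
  "mean_truncated n c p = (\<integral>y. truncated_weight n c (\<lambda>i. inner_field i p y) \<partial>inner_space)"

lemma bounded_meas_truncated:
  assumes "fst c \<subseteq> {..<n}"
  shows "bounded_meas ((I01 \<Otimes>\<^sub>M \<Omega>) \<Otimes>\<^sub>M inner_space) (\<lambda>(p, y). truncated_weight n c (\<lambda>i. inner_field i p y))"
proof (rule bounded_measI[where c=1])
  show "(\<lambda>(p, y). truncated_weight n c (\<lambda>i. inner_field i p y)) \<in> borel_measurable ((I01 \<Otimes>\<^sub>M \<Omega>) \<Otimes>\<^sub>M inner_space)"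
    using truncated_weight_measurable[OF assms, of "\<lambda>(p, y) i. inner_field i p y"] inner_field_measurable
    by (simp add: case_prod_unfold)
qed (simp add: case_prod_unfold truncated_weight_le_1)

lemma mean_truncated_measurable:
  assumes "fst c \<subseteq> {..<n}" shows "mean_truncated n c \<in> borel_measurable (I01 \<Otimes>\<^sub>M \<Omega>)"
  using prob_space.bounded_meas_integral[OF prob_inner_space bounded_meas_truncated[OF assms]]
  unfolding mean_truncated_def[abs_def] by (rule bounded_meas_measurable)

lemma mean_truncated_le_1: "\<bar>mean_truncated n c p\<bar> \<le> 1"
  unfolding mean_truncated_def
  by (rule prob_space.abs_integral_le[OF prob_inner_space]) (rule truncated_weight_le_1)

text \<open>The position \<open>k\<close> in the list serves as replica number: the product of
  averages equals the average of the product over independent replicas, with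
  \<open>(w, \<omega>)\<close> fixed. Integration over the noise and over \<open>u\<close>
  factorizes in turn.\<close>

lemma mean_truncated_moment:
  assumes cs: "\<And>c. c \<in> set cs \<Longrightarrow> fst c \<subseteq> {..<n}"
  shows "(\<integral>p. (\<Prod>c\<leftarrow>cs. mean_truncated n c p) \<partial>(I01 \<Otimes>\<^sub>M \<Omega>)) =
    (\<integral>q. (\<Prod>k<length cs. truncated_weight n (cs ! k) (\<lambda>i. replica_field (k, i) q)) \<partial>replicas)"
proof -
  let ?\<tau> = "\<lambda>k p y. truncated_weight n (cs ! k) (\<lambda>i. inner_field i p y)"
  let ?H = "\<lambda>q. \<Prod>k<length cs. truncated_weight n (cs ! k) (\<lambda>i. replica_field (k, i) q)"
  have csk: "fst (cs ! k) \<subseteq> {..<n}" if "k < length cs" for k using cs that by auto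
  have H_eq: "?H (p, (u, \<zeta>)) = (\<Prod>k<length cs. ?\<tau> k p (u k, \<zeta> k))" for p u \<zeta>
    by (simp add: replica_field_def inner_field_def case_prod_unfold)
  have b: "bounded_meas ((I01 \<Otimes>\<^sub>M \<Omega>) \<Otimes>\<^sub>M (seq_I01 \<Otimes>\<^sub>M noise_seq)) ?H"
    unfolding replicas_def[symmetric]
  proof (rule bounded_measI[where c=1])
    show "?H \<in> borel_measurable replicas"
      using csk by (intro borel_measurable_prod truncated_weight_measurable replica_field_measurable) auto
    show "\<bar>?H q\<bar> \<le> 1" for q
      unfolding abs_prod by (intro prod_le_1) (auto simp: truncated_weight_le_1)
  qed
  have "(\<integral>q. ?H q \<partial>replicas) = (\<integral>p. (\<integral>q. ?H (p, q) \<partial>(seq_I01 \<Otimes>\<^sub>M noise_seq)) \<partial>(I01 \<Otimes>\<^sub>M \<Omega>))"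
    unfolding replicas_def by (rule bounded_meas_integral_pair[OF prob_base prob_seq_noise b])
  also have "\<dots> = (\<integral>p. (\<Prod>c\<leftarrow>cs. mean_truncated n c p) \<partial>(I01 \<Otimes>\<^sub>M \<Omega>))"
  proof (rule Bochner_Integration.integral_cong[OF refl])
    fix p assume p: "p \<in> space (I01 \<Otimes>\<^sub>M \<Omega>)"
    have \<tau>: "bounded_meas (I01 \<Otimes>\<^sub>M (gauss_seq \<Otimes>\<^sub>M gauss_seq)) (?\<tau> k p)" if "k < length cs" for k
      using bounded_meas_section[OF bounded_meas_truncated[OF csk[OF that]] p] .
    have bp: "bounded_meas (seq_I01 \<Otimes>\<^sub>M noise_seq) (\<lambda>q. ?H (p, q))" by (rule bounded_meas_Pair1[OF b p])
    have "(\<integral>q. ?H (p, q) \<partial>(seq_I01 \<Otimes>\<^sub>M noise_seq)) = (\<integral>u. (\<integral>\<zeta>. ?H (p, (u, \<zeta>)) \<partial>noise_seq) \<partial>seq_I01)"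
      by (rule bounded_meas_integral_pair[OF prob_seq_I01 prob_noise_seq bp])
    also have "\<dots> = (\<integral>u. (\<Prod>k<length cs. \<integral>zz. ?\<tau> k p (u k, zz) \<partial>(gauss_seq \<Otimes>\<^sub>M gauss_seq)) \<partial>seq_I01)"
    proof (rule Bochner_Integration.integral_cong[OF refl])
      fix u :: "nat \<Rightarrow> real" assume u: "u \<in> space seq_I01"
      then have uk: "u k \<in> space I01" for k by (auto simp: space_PiM)
      show "(\<integral>\<zeta>. ?H (p, (u, \<zeta>)) \<partial>noise_seq) = (\<Prod>k<length cs. \<integral>zz. ?\<tau> k p (u k, zz) \<partial>(gauss_seq \<Otimes>\<^sub>M gauss_seq))"
        unfolding H_eq
      proof (rule integral_PiM_prod)
        fix k assume "k \<in> {..<length cs}"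
        then show "integrable (gauss_seq \<Otimes>\<^sub>M gauss_seq) (\<lambda>zz. ?\<tau> k p (u k, zz))"
          by (intro finite_measure.bounded_meas_integrable[OF prob_space.finite_measure[OF prob_gauss_pair]] bounded_meas_Pair1[OF \<tau> uk]) simp
      qed (auto intro: prob_gauss_pair)
    qed
    also have "\<dots> = (\<Prod>k<length cs. \<integral>u. (\<integral>zz. ?\<tau> k p (u, zz) \<partial>(gauss_seq \<Otimes>\<^sub>M gauss_seq)) \<partial>I01)"
    proof (rule integral_PiM_prod)
      fix k assume "k \<in> {..<length cs}"
      then show "integrable I01 (\<lambda>u. \<integral>zz. ?\<tau> k p (u, zz) \<partial>(gauss_seq \<Otimes>\<^sub>M gauss_seq))"
        using \<tau>[of k] by (intro I01.bounded_meas_integrable prob_space.bounded_meas_integral[OF prob_gauss_pair]) (simp add: case_prod_unfold)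
    qed (auto intro: I01.prob_space_axioms)
    also have "\<dots> = (\<Prod>k<length cs. mean_truncated n (cs ! k) p)"
      unfolding mean_truncated_def
      by (intro prod.cong refl bounded_meas_integral_pair[symmetric] I01.prob_space_axioms prob_gauss_pair \<tau>) simp
    also have "\<dots> = (\<Prod>c\<leftarrow>cs. mean_truncated n c p)"
      by (simp add: prod.list_conv_set_nth atLeast0LessThan)
    finally show "(\<integral>q. ?H (p, q) \<partial>(seq_I01 \<Otimes>\<^sub>M noise_seq)) = (\<Prod>c\<leftarrow>cs. mean_truncated n c p)" .
  qed
  finally show ?thesis ..
qed

text \<open>All truncation levels are kept in one joint law, so that the limit in the level is a
  function of a sample from it.\<close>

definition mean_truncated_law :: "nat \<Rightarrow> (nat set \<times> nat \<Rightarrow> real) measure" where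
  "mean_truncated_law n = distr (I01 \<Otimes>\<^sub>M \<Omega>) (PiM {c. fst c \<subseteq> {..<n}} (\<lambda>_. borel)) (\<lambda>p. \<lambda>c\<in>{c. fst c \<subseteq> {..<n}}. mean_truncated n c p)"

end

text \<open>The averages lie in [-1, 1], so their moments decide; each moment is an expectation over
  finitely many replica fields, whose joint law is determined by the overlaps.\<close>

lemma mean_truncated_law_cong:
  assumes X: "cavity_field \<beta> \<sigma> \<Omega> g" and Y: "cavity_field \<beta> \<sigma>' \<Omega>' g'" and law: "overlap_law \<sigma> = overlap_law \<sigma>'"
  shows "cavity_field.mean_truncated_law \<beta> \<sigma> \<Omega> g n = cavity_field.mean_truncated_law \<beta> \<sigma>' \<Omega>' g' n"
proof -
  interpret X: cavity_field \<beta> \<sigma> \<Omega> g by fact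
  interpret Y: cavity_field \<beta> \<sigma>' \<Omega>' g' by fact
  show ?thesis
    unfolding X.mean_truncated_law_def Y.mean_truncated_law_def
  proof (rule moments_determine_law[OF X.prob_base Y.prob_base])
    fix cs :: "(nat set \<times> nat) list" assume "set cs \<subseteq> {c. fst c \<subseteq> {..<n}}"
    then have cs: "\<And>c. c \<in> set cs \<Longrightarrow> fst c \<subseteq> {..<n}" by auto
    \<comment> \<open>Large enough for both indices of the replica fields: the number of factors on
      one side, the number of sites on the other.\<close>
    define N where "N = max n (length cs)"
    let ?J = "{..<N} \<times> {..<N}"
    let ?H = "\<lambda>x :: nat \<times> nat \<Rightarrow> real. \<Prod>k<length cs. truncated_weight n (cs ! k) (\<lambda>i. x (k, i))"
    have H: "?H \<in> borel_measurable (PiM ?J (\<lambda>_. borel))"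
    proof (intro borel_measurable_prod truncated_weight_measurable)
      fix k i assume "k \<in> {..<length cs}" "i < n"
      then show "(\<lambda>x. x (k, i)) \<in> borel_measurable (PiM ?J (\<lambda>_. borel))"
        by (intro measurable_component_singleton) (auto simp: N_def)
    qed (use cs in auto)
    have H_restrict: "?H (\<lambda>j\<in>?J. x j) = ?H x" for x
      using cs by (intro prod.cong refl truncated_weight_cong) (auto simp: N_def)
    have X_eq: "(\<integral>q. ?H (\<lambda>j. X.replica_field j q) \<partial>X.replicas) =
        (\<integral>x. ?H x \<partial>distr X.replicas (PiM ?J (\<lambda>_. borel)) (\<lambda>q. \<lambda>j\<in>?J. X.replica_field j q))"
      by (subst integral_distr[OF measurable_restrict[OF X.replica_field_measurable] H]) (simp only: H_restrict)
    have Y_eq: "(\<integral>q. ?H (\<lambda>j. Y.replica_field j q) \<partial>Y.replicas) =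
        (\<integral>x. ?H x \<partial>distr Y.replicas (PiM ?J (\<lambda>_. borel)) (\<lambda>q. \<lambda>j\<in>?J. Y.replica_field j q))"
      by (subst integral_distr[OF measurable_restrict[OF Y.replica_field_measurable] H]) (simp only: H_restrict)
    show "(\<integral>p. (\<Prod>c\<leftarrow>cs. X.mean_truncated n c p) \<partial>(I01 \<Otimes>\<^sub>M \<Omega>)) = (\<integral>p. (\<Prod>c\<leftarrow>cs. Y.mean_truncated n c p) \<partial>(I01 \<Otimes>\<^sub>M \<Omega>'))"
      using X_eq Y_eq replica_field_law[OF X Y law, of N] X.mean_truncated_moment[of cs n] Y.mean_truncated_moment[of cs n] cs by simp
  qed (auto intro: X.mean_truncated_measurable Y.mean_truncated_measurable X.mean_truncated_le_1 Y.mean_truncated_le_1)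
qed

section \<open>Exponential moments and integrability of the weight\<close>

lemma std_gauss_exp_moment: "(\<integral>\<^sup>+x. ennreal (exp (t * x)) \<partial>std_gauss) = ennreal (exp (t\<^sup>2 / 2))"
proof -
  \<comment> \<open>Completing the square: tilting by \<open>exp (t * x)\<close> shifts the mean of
    the Gaussian to \<open>t\<close>.\<close>
  have *: "std_normal_density x * exp (t * x) = exp (t\<^sup>2 / 2) * normal_density t 1 x" for x
  proof -
    have "exp (- x\<^sup>2 / 2) * exp (t * x) = exp (t\<^sup>2 / 2) * exp (- (x - t)\<^sup>2 / 2)"
      unfolding exp_add[symmetric] by (simp add: power2_diff field_simps)
    then show ?thesis by (simp add: normal_density_def)
  qed
  have "(\<integral>\<^sup>+x. ennreal (exp (t * x)) \<partial>std_gauss) = (\<integral>\<^sup>+x. ennreal (exp (t\<^sup>2 / 2) * normal_density t 1 x) \<partial>lborel)"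
    by (subst nn_integral_density) (auto simp: ennreal_mult'[symmetric] *)
  also have "\<dots> = ennreal (\<integral>x. exp (t\<^sup>2 / 2) * normal_density t 1 x \<partial>lborel)"
    by (rule nn_integral_eq_integral) auto
  finally show ?thesis by simp
qed

lemma gaussian_exp_moment:
  assumes X: "centered_gaussian_process M T X K" and t: "t \<in> T"
  shows "(\<integral>\<^sup>+\<omega>. ennreal (exp (s * X t \<omega>)) \<partial>M) = ennreal (exp (s\<^sup>2 * K t t / 2))"
proof -
  have [measurable]: "X t \<in> borel_measurable M" using X t by (simp add: centered_gaussian_process_def)
  have lin: "\<exists>c. distr M borel (\<lambda>\<omega>. \<Sum>t\<in>F. a t * X t \<omega>) = distr std_gauss borel (\<lambda>x. c * x)"
    if "finite F" "F \<subseteq> T" for F a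
    using X that by (simp add: centered_gaussian_process_def)
  obtain c where c: "distr M borel (X t) = distr std_gauss borel (\<lambda>x. c * x)"
    using lin[of "{t}" "\<lambda>_. 1"] t by auto
  have "K t t = (\<integral>\<omega>. X t \<omega> * X t \<omega> \<partial>M)" using X t by (simp add: centered_gaussian_process_def)
  then have K: "K t t = c\<^sup>2" using gaussian_multiple_second_moment(1)[OF _ c] by (simp add: power2_eq_square)
  have "(\<integral>\<^sup>+\<omega>. ennreal (exp (s * X t \<omega>)) \<partial>M) = (\<integral>\<^sup>+x. ennreal (exp (s * x)) \<partial>distr M borel (X t))"
    by (subst nn_integral_distr) auto
  also have "\<dots> = (\<integral>\<^sup>+x. ennreal (exp ((s * c) * x)) \<partial>std_gauss)"
    unfolding c by (subst nn_integral_distr) (auto simp: mult.assoc)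
  also have "\<dots> = ennreal (exp (s\<^sup>2 * K t t / 2))" by (simp add: std_gauss_exp_moment K power_mult_distrib)
  finally show ?thesis .
qed

text \<open>With \<open>m\<close> the index of the largest modulus, the product is at most
  \<open>exp (n * \<bar>x m\<bar>)\<close>, and one of the two exponentials for \<open>m\<close>
  attains this. The summand 1 covers \<open>n = 0\<close>. The product is thus reduced to
  exponentials of one field at a time.\<close>

lemma prod_cosh_le_sum_exp:
  fixes x :: "nat \<Rightarrow> real"
  shows "(\<Prod>i<n. cosh (x i)) \<le> 1 + (\<Sum>i<n. exp (real n * x i) + exp (- real n * x i))"
proof (cases "n = 0")
  case False
  then have "Max ((\<lambda>i. \<bar>x i\<bar>) ` {..<n}) \<in> (\<lambda>i. \<bar>x i\<bar>) ` {..<n}" by (intro Max_in) auto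
  then obtain m where "m < n" and Max: "Max ((\<lambda>i. \<bar>x i\<bar>) ` {..<n}) = \<bar>x m\<bar>" by auto
  have m: "m < n" "\<And>i. i < n \<Longrightarrow> \<bar>x i\<bar> \<le> \<bar>x m\<bar>"
    using \<open>m < n\<close> unfolding Max[symmetric] by auto
  have "cosh (x i) \<le> exp \<bar>x m\<bar>" if "i < n" for i
  proof -
    have "exp (x i) \<le> exp \<bar>x m\<bar>" "exp (- x i) \<le> exp \<bar>x m\<bar>" using m(2)[OF that] by auto
    moreover have "(a + b) / 2 \<le> c" if "a \<le> c" "b \<le> c" for a b c :: real
      using add_mono[OF that] by (simp add: divide_le_eq)
    ultimately show ?thesis unfolding cosh_field_def by blast
  qed
  then have "(\<Prod>i<n. cosh (x i)) \<le> (\<Prod>i<n. exp \<bar>x m\<bar>)"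
    by (intro prod_mono) (auto intro: less_imp_le)
  also have "\<dots> = exp (real n * \<bar>x m\<bar>)" by (simp add: exp_of_nat_mult)
  also have "\<dots> \<le> exp (real n * x m) + exp (- real n * x m)" by (auto simp: abs_if)
  also have "\<dots> \<le> (\<Sum>i<n. exp (real n * x i) + exp (- real n * x i))"
    using m(1) by (intro member_le_sum[where f="\<lambda>i. exp (real n * x i) + exp (- real n * x i)"]) (auto intro: add_nonneg_nonneg)
  finally show ?thesis by simp
qed simp

context cavity_field
begin

interpretation PY: pair_prob_space "I01 \<Otimes>\<^sub>M \<Omega>" inner_space
proof -
  interpret P: prob_space "I01 \<Otimes>\<^sub>M \<Omega>" by (rule prob_base)
  interpret Y: prob_space inner_space by (rule prob_inner_space)
  show "pair_prob_space (I01 \<Otimes>\<^sub>M \<Omega>) inner_space" ..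
qed

text \<open>The exponent is a process value plus extra noise, and
  \<open>exp (x + y) \<le> exp (2 * x) + exp (2 * y)\<close> separates the two. Each part has a
  Gaussian exponential moment bounded uniformly, because the bound \<open>b\<close> on the
  derivative of \<xi> controls both variances.\<close>

lemma integrable_exp_inner_field:
  "integrable ((I01 \<Otimes>\<^sub>M \<Omega>) \<Otimes>\<^sub>M inner_space) (\<lambda>(p, y). exp (t * inner_field i p y))"
proof (rule integrableI_nonneg)
  let ?PY = "(I01 \<Otimes>\<^sub>M \<Omega>) \<Otimes>\<^sub>M inner_space"
  show "(\<lambda>(p, y). exp (t * inner_field i p y)) \<in> borel_measurable ?PY"
    using inner_field_measurable unfolding case_prod_unfold by measurable
  obtain b where b: "\<And>x. \<bar>xi_deriv \<beta> x\<bar> \<le> b" by (rule xi_deriv_bounded) blast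
  have g_meas: "(\<lambda>((w, \<omega>), (u, z, z')). g (Inl i) w u \<omega>) \<in> borel_measurable ?PY"
    using measurable_compose[OF _ field_measurable, of "\<lambda>((w, \<omega>), (u, z, z')). (w, u, \<omega>)" ?PY "Inl i"]
    by (simp add: case_prod_unfold)
  have c_meas: "(\<lambda>((w, \<omega>), (u, z, z')). z i * noise_scale w u) \<in> borel_measurable ?PY"
  proof -
    have "(\<lambda>q. fst (snd (snd q))) \<in> measurable ?PY gauss_seq" by measurable
    from measurable_compose[OF this measurable_component_singleton[of i UNIV]]
    have 1: "(\<lambda>q. fst (snd (snd q)) i) \<in> borel_measurable ?PY" by simp
    have 2: "(\<lambda>q. noise_scale (fst (fst q)) (fst (snd q))) \<in> borel_measurable ?PY"
      using measurable_compose[OF _ noise_scale_measurable, of "\<lambda>q. (fst (fst q), fst (snd q))" ?PY] by simp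
    show ?thesis using borel_measurable_times[OF 1 2] by (simp add: case_prod_unfold)
  qed
  let ?f = "\<lambda>((w, \<omega>), (u, z, z')). ennreal (exp (2 * t * g (Inl i) w u \<omega>))"
  let ?h = "\<lambda>((w, \<omega>), (u, z, z')). ennreal (exp (2 * t * (z i * noise_scale w u)))"
  have f: "?f \<in> borel_measurable ?PY" using g_meas unfolding case_prod_unfold by measurable
  have h: "?h \<in> borel_measurable ?PY" using c_meas unfolding case_prod_unfold by measurable
  have "(\<integral>\<^sup>+q. ?f q \<partial>?PY) = (\<integral>\<^sup>+y. (\<integral>\<^sup>+p. ?f (p, y) \<partial>(I01 \<Otimes>\<^sub>M \<Omega>)) \<partial>inner_space)"
    by (rule PY.nn_integral_snd[OF f, symmetric])
  also have "\<dots> \<le> (\<integral>\<^sup>+y. ennreal (exp ((2 * t)\<^sup>2 * b / 2)) \<partial>inner_space)"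
  proof (rule nn_integral_mono)
    fix y assume y: "y \<in> space inner_space"
    then obtain u z z' where u: "y = (u, z, z')" "u \<in> {0..1}" by (auto simp: space_pair_measure space_I01)
    have "(\<integral>\<^sup>+p. ?f (p, y) \<partial>(I01 \<Otimes>\<^sub>M \<Omega>)) = (\<integral>\<^sup>+w. (\<integral>\<^sup>+\<omega>. ?f ((w, \<omega>), y) \<partial>\<Omega>) \<partial>I01)"
      by (rule \<Omega>.nn_integral_fst[symmetric]) (rule measurable_compose[OF measurable_Pair2'[OF y] f])
    also have "\<dots> \<le> (\<integral>\<^sup>+w. ennreal (exp ((2 * t)\<^sup>2 * b / 2)) \<partial>I01)"
    proof (rule nn_integral_mono)
      fix w assume "w \<in> space I01"
      then have w: "w \<in> {0..1}" by (simp add: space_I01)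
      have "centered_gaussian_process \<Omega> {0..1} (g (Inl i) w) (\<lambda>u u'. deriv (xi \<beta>) (overlap \<sigma> w u u'))"
        using fields w by (simp add: gaussian_fields_def)
      from gaussian_exp_moment[OF this u(2), of "2 * t"]
      have "(\<integral>\<^sup>+\<omega>. ?f ((w, \<omega>), y) \<partial>\<Omega>) = ennreal (exp ((2 * t)\<^sup>2 * xi_deriv \<beta> (overlap \<sigma> w u u) / 2))"
        using w u by (simp add: deriv_overlap)
      also have "\<dots> \<le> ennreal (exp ((2 * t)\<^sup>2 * b / 2))"
        using b[of "overlap \<sigma> w u u"]
        by (intro ennreal_leI iffD2[OF exp_le_cancel_iff] divide_right_mono mult_left_mono) (auto simp: abs_le_iff)
      finally show "(\<integral>\<^sup>+\<omega>. ?f ((w, \<omega>), y) \<partial>\<Omega>) \<le> ennreal (exp ((2 * t)\<^sup>2 * b / 2))" .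
    qed
    also have "\<dots> = ennreal (exp ((2 * t)\<^sup>2 * b / 2))" by (simp add: I01.emeasure_space_1)
    finally show "(\<integral>\<^sup>+p. ?f (p, y) \<partial>(I01 \<Otimes>\<^sub>M \<Omega>)) \<le> ennreal (exp ((2 * t)\<^sup>2 * b / 2))" .
  qed
  also have "\<dots> = ennreal (exp ((2 * t)\<^sup>2 * b / 2))"
    by (simp add: prob_space.emeasure_space_1[OF prob_inner_space])
  finally have f_fin: "(\<integral>\<^sup>+q. ?f q \<partial>?PY) < \<infinity>" by (simp add: le_less_trans)
  have "(\<integral>\<^sup>+q. ?h q \<partial>?PY) = (\<integral>\<^sup>+p. (\<integral>\<^sup>+y. ?h (p, y) \<partial>inner_space) \<partial>(I01 \<Otimes>\<^sub>M \<Omega>))"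
    by (rule sigma_finite_measure.nn_integral_fst[OF prob_space_imp_sigma_finite[OF prob_inner_space] h, symmetric])
  also have "\<dots> \<le> (\<integral>\<^sup>+p. ennreal (exp ((2 * t)\<^sup>2 * (2 * b) / 2)) \<partial>(I01 \<Otimes>\<^sub>M \<Omega>))"
  proof (rule nn_integral_mono)
    fix p assume p: "p \<in> space (I01 \<Otimes>\<^sub>M \<Omega>)"
    obtain w \<omega> where w: "p = (w, \<omega>)" by (cases p)
    have hp: "(\<lambda>y. ?h (p, y)) \<in> borel_measurable (I01 \<Otimes>\<^sub>M (gauss_seq \<Otimes>\<^sub>M gauss_seq))"
      by (rule measurable_compose[OF measurable_Pair1'[OF p] h])
    have "(\<integral>\<^sup>+y. ?h (p, y) \<partial>inner_space) = (\<integral>\<^sup>+u. (\<integral>\<^sup>+zz. ?h (p, (u, zz)) \<partial>(gauss_seq \<Otimes>\<^sub>M gauss_seq)) \<partial>I01)"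
      by (rule sigma_finite_measure.nn_integral_fst[OF prob_space_imp_sigma_finite[OF prob_gauss_pair] hp, symmetric])
    also have "\<dots> \<le> (\<integral>\<^sup>+u. ennreal (exp ((2 * t)\<^sup>2 * (2 * b) / 2)) \<partial>I01)"
    proof (rule nn_integral_mono)
      fix u
      let ?e = "\<lambda>x. ennreal (exp ((2 * t * noise_scale w u) * x))"
      have "(\<integral>\<^sup>+zz. ?h (p, (u, zz)) \<partial>(gauss_seq \<Otimes>\<^sub>M gauss_seq)) = (\<integral>\<^sup>+zz. ?e (fst zz i) \<partial>(gauss_seq \<Otimes>\<^sub>M gauss_seq))"
        by (simp add: w case_prod_unfold ac_simps)
      also have "\<dots> = (\<integral>\<^sup>+z. ?e (z i) \<partial>distr (gauss_seq \<Otimes>\<^sub>M gauss_seq) gauss_seq fst)"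
        by (subst nn_integral_distr) (auto intro!: measurable_compose[OF measurable_component_singleton[of i UNIV]])
      also have "\<dots> = (\<integral>\<^sup>+z. ?e (z i) \<partial>gauss_seq)"
        by (simp only: prob_space.distr_pair_fst[OF prob_gauss_seq])
      also have "\<dots> = (\<integral>\<^sup>+x. ?e x \<partial>distr gauss_seq std_gauss (\<lambda>z. z i))"
        by (subst nn_integral_distr) auto
      also have "\<dots> = (\<integral>\<^sup>+x. ?e x \<partial>std_gauss)"
        by (subst distr_PiM_component) (auto intro: std_gauss.prob_space_axioms)
      also have "\<dots> = ennreal (exp ((2 * t)\<^sup>2 * (noise_scale w u)\<^sup>2 / 2))"
        by (simp add: std_gauss_exp_moment power_mult_distrib)
      also have "\<dots> \<le> ennreal (exp ((2 * t)\<^sup>2 * (2 * b) / 2))"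
      proof -
        \<comment> \<open>\<open>sqrt\<close> is an odd function here, so the square of the root is
          the absolute value whatever the sign of the difference.\<close>
        have "(noise_scale w u)\<^sup>2 = \<bar>xi_deriv \<beta> 1 - xi_deriv \<beta> (overlap \<sigma> w u u)\<bar>"
          unfolding noise_scale_def by (simp add: real_sqrt_abs2 power2_eq_square)
        then have "(noise_scale w u)\<^sup>2 \<le> 2 * b" using b[of 1] b[of "overlap \<sigma> w u u"] by linarith
        then show ?thesis
          by (intro ennreal_leI iffD2[OF exp_le_cancel_iff] divide_right_mono mult_left_mono) auto
      qed
      finally show "(\<integral>\<^sup>+zz. ?h (p, (u, zz)) \<partial>(gauss_seq \<Otimes>\<^sub>M gauss_seq)) \<le> ennreal (exp ((2 * t)\<^sup>2 * (2 * b) / 2))" .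
    qed
    also have "\<dots> = ennreal (exp ((2 * t)\<^sup>2 * (2 * b) / 2))" by (simp add: I01.emeasure_space_1)
    finally show "(\<integral>\<^sup>+y. ?h (p, y) \<partial>inner_space) \<le> ennreal (exp ((2 * t)\<^sup>2 * (2 * b) / 2))" .
  qed
  also have "\<dots> = ennreal (exp ((2 * t)\<^sup>2 * (2 * b) / 2))"
    by (simp add: prob_space.emeasure_space_1[OF prob_base])
  finally have h_fin: "(\<integral>\<^sup>+q. ?h q \<partial>?PY) < \<infinity>" by (simp add: le_less_trans)
  have "(\<integral>\<^sup>+q. ennreal (case q of (p, y) \<Rightarrow> exp (t * inner_field i p y)) \<partial>?PY) \<le> (\<integral>\<^sup>+q. ?f q + ?h q \<partial>?PY)"
  proof (rule nn_integral_mono)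
    fix q assume "q \<in> space ?PY"
    then obtain w \<omega> u z z' where q: "q = ((w, \<omega>), (u, z, z'))" "w \<in> {0..1}" "u \<in> {0..1}"
      by (auto simp: space_pair_measure space_I01)
    let ?x = "t * g (Inl i) w u \<omega>" and ?y = "t * (z i * noise_scale w u)"
    have "exp (?x + ?y) \<le> exp (2 * ?x) + exp (2 * ?y)"
    proof (cases "?x \<le> ?y")
      case True
      then have "exp (?x + ?y) \<le> exp (2 * ?y)" by simp
      then show ?thesis using exp_gt_zero[of "2 * ?x"] by linarith
    next
      case False
      then have "exp (?x + ?y) \<le> exp (2 * ?x)" by simp
      then show ?thesis using exp_gt_zero[of "2 * ?y"] by linarith
    qed
    then show "ennreal (case q of (p, y) \<Rightarrow> exp (t * inner_field i p y)) \<le> ?f q + ?h q"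
      using q by (simp add: inner_field_def G_xi_eq distrib_left mult.assoc ennreal_plus[symmetric] del: ennreal_plus)
  qed
  also have "\<dots> = (\<integral>\<^sup>+q. ?f q \<partial>?PY) + (\<integral>\<^sup>+q. ?h q \<partial>?PY)" by (rule nn_integral_add[OF f h])
  also have "\<dots> < \<infinity>" using f_fin h_fin by simp
  finally show "(\<integral>\<^sup>+q. ennreal (case q of (p, y) \<Rightarrow> exp (t * inner_field i p y)) \<partial>?PY) < \<infinity>" .
qed (simp add: case_prod_unfold)

definition weight :: "nat \<Rightarrow> real \<times> 'a \<Rightarrow> real \<times> (nat \<Rightarrow> real) \<times> (nat \<Rightarrow> real) \<Rightarrow> real" where
  "weight n p y = (\<Prod>i<n. cosh (inner_field i p y))"

lemma weight_measurable[measurable]: "(\<lambda>(p, y). weight n p y) \<in> borel_measurable ((I01 \<Otimes>\<^sub>M \<Omega>) \<Otimes>\<^sub>M inner_space)"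
proof -
  have "(\<lambda>q. cosh (inner_field i (fst q) (snd q))) \<in> borel_measurable ((I01 \<Otimes>\<^sub>M \<Omega>) \<Otimes>\<^sub>M inner_space)" for i
    using measurable_compose[OF inner_field_measurable cosh_measurable] by (simp add: case_prod_unfold)
  then show ?thesis unfolding weight_def case_prod_unfold by (intro borel_measurable_prod)
qed

text \<open>Joint integrability on the product follows from the exponential bounds; Fubini turns it
  into integrability of almost every section.\<close>

lemma AE_integrable_weight: "AE p in I01 \<Otimes>\<^sub>M \<Omega>. integrable inner_space (weight n p)"
proof -
  have "integrable ((I01 \<Otimes>\<^sub>M \<Omega>) \<Otimes>\<^sub>M inner_space) (\<lambda>(p, y). weight n p y)"
  proof (rule Bochner_Integration.integrable_bound)
    show "integrable ((I01 \<Otimes>\<^sub>M \<Omega>) \<Otimes>\<^sub>M inner_space)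
      (\<lambda>q. 1 + (\<Sum>i<n. exp (real n * inner_field i (fst q) (snd q)) + exp (- real n * inner_field i (fst q) (snd q))))"
      using integrable_exp_inner_field unfolding case_prod_unfold
      by (intro Bochner_Integration.integrable_add Bochner_Integration.integrable_sum PY.integrable_const)
    show "AE q in (I01 \<Otimes>\<^sub>M \<Omega>) \<Otimes>\<^sub>M inner_space. norm (case q of (p, y) \<Rightarrow> weight n p y) \<le>
      norm (1 + (\<Sum>i<n. exp (real n * inner_field i (fst q) (snd q)) + exp (- real n * inner_field i (fst q) (snd q))))"
    proof (rule AE_I2)
      fix q
      let ?s = "1 + (\<Sum>i<n. exp (real n * inner_field i (fst q) (snd q)) + exp (- real n * inner_field i (fst q) (snd q)))"
      have "1 \<le> weight n (fst q) (snd q)" unfolding weight_def by (rule prod_cosh_ge_1)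
      moreover have "weight n (fst q) (snd q) \<le> ?s" unfolding weight_def by (rule prod_cosh_le_sum_exp)
      ultimately show "norm (case q of (p, y) \<Rightarrow> weight n p y) \<le> norm ?s" by (simp add: case_prod_unfold)
    qed
  qed (rule weight_measurable)
  from PY.AE_integrable_fst'[OF this] show ?thesis by simp
qed

section \<open>The two sides of the invariance equations\<close>

definition cavity_numerator :: "nat \<Rightarrow> nat set \<Rightarrow> real \<times> 'a \<Rightarrow> real" where
  "cavity_numerator n C p = (\<integral>y. (\<Prod>i\<in>C. tanh (inner_field i p y)) * weight n p y \<partial>inner_space)"

lemma cavity_integrand_measurable:
  "(\<lambda>(p, y). (\<Prod>i\<in>C. tanh (inner_field i p y)) * weight n p y) \<in> borel_measurable ((I01 \<Otimes>\<^sub>M \<Omega>) \<Otimes>\<^sub>M inner_space)"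
proof -
  have "(\<lambda>q. tanh (inner_field i (fst q) (snd q))) \<in> borel_measurable ((I01 \<Otimes>\<^sub>M \<Omega>) \<Otimes>\<^sub>M inner_space)" for i
    using measurable_compose[OF inner_field_measurable tanh_measurable] by (simp add: case_prod_unfold)
  then show ?thesis
    using weight_measurable unfolding case_prod_unfold by (intro borel_measurable_times borel_measurable_prod)
qed

lemma cavity_numerator_measurable: "cavity_numerator n C \<in> borel_measurable (I01 \<Otimes>\<^sub>M \<Omega>)"
  unfolding cavity_numerator_def[abs_def]
  using sigma_finite_measure.borel_measurable_lebesgue_integral[OF prob_space_imp_sigma_finite[OF prob_inner_space]
      cavity_integrand_measurable] .

text \<open>With all sites of \<open>C\<close> below \<open>n\<close> no magnetization factor is
  left, so the numerator does not involve \<open>v\<close>. The denominator is the case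
  \<open>C = {}\<close>.\<close>

lemma cavity_U_eq:
  assumes "C \<subseteq> {..<n}"
  shows "cavity_U \<beta> \<sigma> g n 0 C w v \<omega> = cavity_numerator n C (w, \<omega>)"
proof -
  have C: "{i \<in> C. i < n} = C" "{i \<in> C. n \<le> i} = {}" using assms by auto
  show ?thesis
    unfolding cavity_U_def cavity_numerator_def E_prime_def cavity_weight_def weight_def C
    by (simp add: exp_sum inner_field_def case_prod_unfold)
qed

lemma cavity_V_eq: "cavity_V \<beta> \<sigma> g n 0 w \<omega> = cavity_numerator n {} (w, \<omega>)"
  unfolding cavity_V_def cavity_numerator_def E_prime_def cavity_weight_def weight_def
  by (simp add: exp_sum inner_field_def case_prod_unfold)

text \<open>Dominated convergence with the weight itself as majorant, since the product of
  hyperbolic tangents is at most 1 in modulus. The factor \<open>Suc L\<close> undoes the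
  normalization of the truncated weight.\<close>

lemma truncation_limit:
  assumes p: "p \<in> space (I01 \<Otimes>\<^sub>M \<Omega>)" and int: "integrable inner_space (weight n p)" and C: "C \<subseteq> {..<n}"
  shows "(\<lambda>L. real (Suc L) * mean_truncated n (C, L) p) \<longlonglongrightarrow> cavity_numerator n C p"
proof -
  let ?T = "\<lambda>y. \<Prod>i\<in>C. tanh (inner_field i p y)"
  have w_meas: "weight n p \<in> borel_measurable inner_space" using int by auto
  have T_meas: "?T \<in> borel_measurable inner_space"
    by (intro borel_measurable_prod measurable_compose[OF inner_field_section_measurable[OF p] tanh_measurable])
  have w1: "1 \<le> weight n p y" for y unfolding weight_def by (rule prod_cosh_ge_1)
  have "(\<lambda>L. \<integral>y. ?T y * min (weight n p y) (real (Suc L)) \<partial>inner_space) \<longlonglongrightarrow> (\<integral>y. ?T y * weight n p y \<partial>inner_space)"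
  proof (rule integral_dominated_convergence[where w="weight n p"])
    show "(\<lambda>y. ?T y * weight n p y) \<in> borel_measurable inner_space"
      "(\<lambda>y. ?T y * min (weight n p y) (real (Suc L))) \<in> borel_measurable inner_space" for L
      using T_meas w_meas by auto
    show "integrable inner_space (weight n p)" by (rule int)
    show "AE y in inner_space. (\<lambda>L. ?T y * min (weight n p y) (real (Suc L))) \<longlonglongrightarrow> ?T y * weight n p y"
    proof (rule AE_I2)
      fix y
      obtain N where "weight n p y < real N" using reals_Archimedean2 by blast
      then have "min (weight n p y) (real (Suc L)) = weight n p y" if "L \<ge> N" for L using that by auto
      then have "eventually (\<lambda>L. ?T y * min (weight n p y) (real (Suc L)) = ?T y * weight n p y) sequentially"
        by (auto simp: eventually_sequentially)
      then show "(\<lambda>L. ?T y * min (weight n p y) (real (Suc L))) \<longlonglongrightarrow> ?T y * weight n p y"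
        by (rule tendsto_eventually)
    qed
    show "AE y in inner_space. norm (?T y * min (weight n p y) (real (Suc L))) \<le> weight n p y" for L
    proof (rule AE_I2)
      fix y
      have "\<bar>?T y\<bar> * \<bar>min (weight n p y) (real (Suc L))\<bar> \<le> 1 * weight n p y"
        using w1[of y] by (intro mult_mono abs_prod_tanh_le_1) auto
      then show "norm (?T y * min (weight n p y) (real (Suc L))) \<le> weight n p y" by (simp add: abs_mult)
    qed
  qed
  moreover have "real (Suc L) * mean_truncated n (C, L) p = (\<integral>y. ?T y * min (weight n p y) (real (Suc L)) \<partial>inner_space)" for L
    unfolding mean_truncated_def truncated_weight_def prod.case weight_def by (simp del: of_nat_Suc)
  ultimately show ?thesis by (simp add: cavity_numerator_def)
qed

lemma E_outer_base:
  assumes "\<Phi> \<in> borel_measurable (I01 \<Otimes>\<^sub>M \<Omega>)"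
  shows "E_outer \<Omega> (\<lambda>w v \<omega>. \<Phi> (w, \<omega>)) = (\<integral>p. \<Phi> p \<partial>(I01 \<Otimes>\<^sub>M \<Omega>))"
proof -
  let ?S = "seq_I01 :: (nat \<Rightarrow> real) measure"
  interpret S: prob_space ?S by (rule prob_seq_I01)
  have snd: "distr (?S \<Otimes>\<^sub>M \<Omega>) \<Omega> snd = \<Omega>"
  proof (rule measure_eqI)
    fix A assume "A \<in> sets (distr (?S \<Otimes>\<^sub>M \<Omega>) \<Omega> snd)"
    then have A: "A \<in> sets \<Omega>" by simp
    then have "emeasure (distr (?S \<Otimes>\<^sub>M \<Omega>) \<Omega> snd) A = emeasure (?S \<Otimes>\<^sub>M \<Omega>) (space ?S \<times> A)"
      by (auto simp: emeasure_distr space_pair_measure dest: sets.sets_into_space intro!: arg_cong2[where f=emeasure])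
    then show "emeasure (distr (?S \<Otimes>\<^sub>M \<Omega>) \<Omega> snd) A = emeasure \<Omega> A"
      using A by (simp add: \<Omega>.emeasure_pair_measure_Times S.emeasure_space_1)
  qed simp
  have "I01 \<Otimes>\<^sub>M \<Omega> = distr I01 I01 (\<lambda>x. x) \<Otimes>\<^sub>M distr (?S \<Otimes>\<^sub>M \<Omega>) \<Omega> snd"
    by (simp add: snd distr_id)
  also have "\<dots> = distr (I01 \<Otimes>\<^sub>M (?S \<Otimes>\<^sub>M \<Omega>)) (I01 \<Otimes>\<^sub>M \<Omega>) (\<lambda>(w, q). (w, snd q))"
    by (rule pair_measure_distr) (auto simp: snd \<Omega>.sigma_finite_measure_axioms)
  finally have d: "I01 \<Otimes>\<^sub>M \<Omega> = distr (I01 \<Otimes>\<^sub>M (?S \<Otimes>\<^sub>M \<Omega>)) (I01 \<Otimes>\<^sub>M \<Omega>) (\<lambda>(w, q). (w, snd q))" .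
  show ?thesis
    unfolding E_outer_def using assms
    by (subst arg_cong[OF d, where f="\<lambda>M. integral\<^sup>L M \<Phi>"], subst integral_distr) (auto simp: case_prod_unfold)
qed

text \<open>The cavity quotient as a measurable function of the truncated averages.
  \<open>lim\<close> is total, so the formula makes sense for every \<open>s\<close>; for almost
  every sample of the law the limits exist and are the numerator and the denominator.\<close>

definition law_functional :: "nat \<Rightarrow> (nat \<Rightarrow> nat set) \<Rightarrow> (nat set \<times> nat \<Rightarrow> real) \<Rightarrow> real" where
  "law_functional q C s = (\<Prod>l<q. lim (\<lambda>L. real (Suc L) * s (C l, L))) / lim (\<lambda>L. real (Suc L) * s ({}, L)) ^ q"

lemma cavity_rhs:
  assumes C: "\<And>l. l < q \<Longrightarrow> C l \<subseteq> {..<n}"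
  shows "E_outer \<Omega> (\<lambda>w v \<omega>. (\<Prod>l<q. cavity_U \<beta> \<sigma> g n 0 (C l) w v \<omega>) / cavity_V \<beta> \<sigma> g n 0 w \<omega> ^ q) =
    (\<integral>s. law_functional q C s \<partial>mean_truncated_law n)"
proof -
  let ?J = "{c :: nat set \<times> nat. fst c \<subseteq> {..<n}}"
  let ?\<Phi> = "\<lambda>p. (\<Prod>l<q. cavity_numerator n (C l) p) / cavity_numerator n {} p ^ q"
  let ?r = "\<lambda>p. \<lambda>c\<in>?J. mean_truncated n c p"
  have \<Phi>: "?\<Phi> \<in> borel_measurable (I01 \<Otimes>\<^sub>M \<Omega>)"
    using cavity_numerator_measurable by (intro borel_measurable_divide borel_measurable_prod borel_measurable_power)
  have law: "law_functional q C \<in> borel_measurable (PiM ?J (\<lambda>_. borel))"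
  proof -
    have "(\<lambda>s. lim (\<lambda>L. real (Suc L) * s (D, L))) \<in> borel_measurable (PiM ?J (\<lambda>_. borel :: real measure))" if "D \<subseteq> {..<n}" for D
    proof -
      have [measurable]: "(\<lambda>s. s (D, L)) \<in> borel_measurable (PiM ?J (\<lambda>_. borel :: real measure))" for L
        using that by (intro measurable_component_singleton) auto
      show ?thesis by measurable
    qed
    then show ?thesis
      using C unfolding law_functional_def[abs_def]
      by (intro borel_measurable_divide borel_measurable_prod borel_measurable_power) auto
  qed
  have r: "?r \<in> measurable (I01 \<Otimes>\<^sub>M \<Omega>) (PiM ?J (\<lambda>_. borel))"
    by (intro measurable_restrict mean_truncated_measurable) simp
  have "E_outer \<Omega> (\<lambda>w v \<omega>. (\<Prod>l<q. cavity_U \<beta> \<sigma> g n 0 (C l) w v \<omega>) / cavity_V \<beta> \<sigma> g n 0 w \<omega> ^ q) =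
      E_outer \<Omega> (\<lambda>w v \<omega>. ?\<Phi> (w, \<omega>))"
    using C by (simp add: cavity_U_eq cavity_V_eq)
  also have "\<dots> = (\<integral>p. ?\<Phi> p \<partial>(I01 \<Otimes>\<^sub>M \<Omega>))" by (rule E_outer_base[OF \<Phi>])
  also have "\<dots> = (\<integral>p. law_functional q C (?r p) \<partial>(I01 \<Otimes>\<^sub>M \<Omega>))"
  proof (rule integral_cong_AE[OF \<Phi> measurable_compose[OF r law]])
    show "AE p in I01 \<Otimes>\<^sub>M \<Omega>. ?\<Phi> p = law_functional q C (?r p)"
      using AE_integrable_weight[of n] AE_space
    proof eventually_elim
      case (elim p)
      have "lim (\<lambda>L. real (Suc L) * ?r p (D, L)) = cavity_numerator n D p" if D: "D \<subseteq> {..<n}" for D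
        using limI[OF truncation_limit[OF elim(2) elim(1) D]] D by simp
      then show ?case using C by (simp add: law_functional_def)
    qed
  qed
  also have "\<dots> = (\<integral>s. law_functional q C s \<partial>mean_truncated_law n)"
    unfolding mean_truncated_law_def by (rule integral_distr[OF r law, symmetric])
  finally show ?thesis .
qed

text \<open>The \<open>q\<close> averages over \<open>u\<close> unfold into replicas, and the sets
  \<open>{i. (i, l) \<in> set es}\<close> list the sites joined to replica \<open>l\<close>. Every
  distinct edge list arises in this way, so the left-hand sides exhaust the moments of the
  spins.\<close>

lemma cavity_lhs:
  assumes es: "distinct es" and q: "\<And>i l. (i, l) \<in> set es \<Longrightarrow> l < q"
  shows "E_outer \<Omega> (\<lambda>w v \<omega>. \<Prod>l<q. E_prime (\<lambda>u z z'. \<Prod>i\<in>{i. (i, l) \<in> set es}. mag \<sigma> w u (v i))) = K.edge_moment es"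
proof -
  let ?C = "\<lambda>l. {i. (i, l) \<in> set es}"
  let ?B = "\<lambda>w v. \<integral>u. K.edge_prod es (w, u, v) \<partial>seq_I01"
  have b: "bounded_meas (I01 \<Otimes>\<^sub>M (seq_I01 \<Otimes>\<^sub>M seq_I01)) (K.edge_prod es)"
    using K.bounded_meas_edge_prod by (simp add: K.sample_space_def)
  have inner: "(\<Prod>l<q. E_prime (\<lambda>u z z'. \<Prod>i\<in>?C l. mag \<sigma> w u (v i))) = ?B w v"
    if w: "w \<in> space I01" and v: "v \<in> space seq_I01" for w and v :: "nat \<Rightarrow> real"
  proof -
    have h: "bounded_meas I01 (\<lambda>u. \<Prod>i\<in>?C l. mag \<sigma> w u (v i))" for l
    proof (rule bounded_measI[where c=1])
      have "(\<lambda>u. mag \<sigma> w u (v i)) \<in> borel_measurable I01" for i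
        using measurable_compose[OF _ K.kernel_measurable, of "\<lambda>u. (w, u, v i)" I01] w v
        by (simp add: space_I01 space_seq_I01)
      then show "(\<lambda>u. \<Prod>i\<in>?C l. mag \<sigma> w u (v i)) \<in> borel_measurable I01" by (intro borel_measurable_prod)
      fix u assume "u \<in> space I01"
      then show "\<bar>\<Prod>i\<in>?C l. mag \<sigma> w u (v i)\<bar> \<le> 1"
        unfolding abs_prod using w v
        by (intro prod_le_1 conjI abs_ge_zero K.kernel_le_1) (auto simp: space_I01 space_seq_I01)
    qed
    have "E_prime (\<lambda>u z z'. \<Prod>i\<in>?C l. mag \<sigma> w u (v i)) = (\<integral>u. (\<Prod>i\<in>?C l. mag \<sigma> w u (v i)) \<partial>I01)" for l
    proof -
      have "bounded_meas (I01 \<Otimes>\<^sub>M (gauss_seq \<Otimes>\<^sub>M gauss_seq)) (\<lambda>(u, z, z'). \<Prod>i\<in>?C l. mag \<sigma> w u (v i))"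
        using bounded_meas_compose[OF h measurable_fst] by (simp add: case_prod_unfold)
      from bounded_meas_integral_pair[OF I01.prob_space_axioms prob_gauss_pair this]
      show ?thesis
        by (simp add: E_prime_def case_prod_unfold prob_space.prob_space[OF prob_gauss_pair])
    qed
    then have "(\<Prod>l<q. E_prime (\<lambda>u z z'. \<Prod>i\<in>?C l. mag \<sigma> w u (v i))) = (\<Prod>l<q. \<integral>u. (\<Prod>i\<in>?C l. mag \<sigma> w u (v i)) \<partial>I01)"
      by simp
    also have "\<dots> = (\<integral>u. (\<Prod>l<q. \<Prod>i\<in>?C l. mag \<sigma> w (u l) (v i)) \<partial>seq_I01)"
      by (rule integral_PiM_prod[symmetric]) (auto intro: I01.prob_space_axioms I01.bounded_meas_integrable h)
    also have "\<dots> = ?B w v"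
    proof (rule Bochner_Integration.integral_cong[OF refl])
      fix u
      have fin: "finite (?C l)" for l by (rule finite_subset[of _ "fst ` set es"]) force+
      have "(\<Prod>l<q. \<Prod>i\<in>?C l. mag \<sigma> w (u l) (v i)) = (\<Prod>(l, i)\<in>Sigma {..<q} ?C. mag \<sigma> w (u l) (v i))"
        using fin by (intro prod.Sigma) auto
      also have "\<dots> = (\<Prod>(i, l)\<in>set es. mag \<sigma> w (u l) (v i))"
        using q by (intro prod.reindex_bij_witness[of _ prod.swap prod.swap]) auto
      also have "\<dots> = K.edge_prod es (w, u, v)"
        using es by (simp add: K.edge_prod_def prod.distinct_set_conv_list)
      finally show "(\<Prod>l<q. \<Prod>i\<in>?C l. mag \<sigma> w (u l) (v i)) = K.edge_prod es (w, u, v)" .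
    qed
    finally show ?thesis .
  qed
  have B: "bounded_meas (I01 \<Otimes>\<^sub>M (seq_I01 \<Otimes>\<^sub>M \<Omega>)) (\<lambda>(w, v, \<omega>). ?B w v)"
  proof -
    have "bounded_meas ((I01 \<Otimes>\<^sub>M (seq_I01 \<Otimes>\<^sub>M \<Omega>)) \<Otimes>\<^sub>M seq_I01) (\<lambda>((w, v, \<omega>), u). K.edge_prod es (w, u, v))"
      using bounded_meas_compose[OF b, of "\<lambda>((w, v, \<omega>), u). (w, u, v)" "(I01 \<Otimes>\<^sub>M (seq_I01 \<Otimes>\<^sub>M \<Omega>)) \<Otimes>\<^sub>M seq_I01"]
      by (simp add: case_prod_unfold)
    then show ?thesis
      using prob_space.bounded_meas_integral[OF prob_seq_I01, of "I01 \<Otimes>\<^sub>M (seq_I01 \<Otimes>\<^sub>M \<Omega>)" "\<lambda>(w, v, \<omega>) u. K.edge_prod es (w, u, v)"]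
      by (simp add: case_prod_unfold)
  qed
  have prob_v\<omega>: "prob_space (seq_I01 \<Otimes>\<^sub>M \<Omega>)" by (intro prob_space_pair prob_seq_I01 \<Omega>.prob_space_axioms)
  have "E_outer \<Omega> (\<lambda>w v \<omega>. \<Prod>l<q. E_prime (\<lambda>u z z'. \<Prod>i\<in>?C l. mag \<sigma> w u (v i))) = (\<integral>(w, v, \<omega>). ?B w v \<partial>(I01 \<Otimes>\<^sub>M (seq_I01 \<Otimes>\<^sub>M \<Omega>)))"
    unfolding E_outer_def
    by (rule Bochner_Integration.integral_cong[OF refl]) (auto simp: inner space_pair_measure)
  also have "\<dots> = (\<integral>w. (\<integral>(v, \<omega>). ?B w v \<partial>(seq_I01 \<Otimes>\<^sub>M \<Omega>)) \<partial>I01)"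
    using bounded_meas_integral_pair[OF I01.prob_space_axioms prob_v\<omega> B] by simp
  also have "\<dots> = (\<integral>w. (\<integral>u. (\<integral>v. K.edge_prod es (w, u, v) \<partial>seq_I01) \<partial>seq_I01) \<partial>I01)"
  proof (rule Bochner_Integration.integral_cong[OF refl])
    fix w assume w: "w \<in> space I01"
    have "(\<integral>(v, \<omega>). ?B w v \<partial>(seq_I01 \<Otimes>\<^sub>M \<Omega>)) = (\<integral>v. ?B w v \<partial>seq_I01)"
      using bounded_meas_integral_pair[OF prob_seq_I01 \<Omega>.prob_space_axioms bounded_meas_Pair1[OF B w]]
      by (simp add: \<Omega>.prob_space)
    also have "\<dots> = (\<integral>q. K.edge_prod es (w, q) \<partial>(seq_I01 \<Otimes>\<^sub>M seq_I01))"
      by (rule bounded_meas_integral_pair_snd[OF prob_seq_I01 prob_seq_I01 bounded_meas_Pair1[OF b w], symmetric])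
    also have "\<dots> = (\<integral>u. (\<integral>v. K.edge_prod es (w, u, v) \<partial>seq_I01) \<partial>seq_I01)"
      by (rule bounded_meas_integral_pair[OF prob_seq_I01 prob_seq_I01 bounded_meas_Pair1[OF b w]])
    finally show "(\<integral>(v, \<omega>). ?B w v \<partial>(seq_I01 \<Otimes>\<^sub>M \<Omega>)) = (\<integral>u. (\<integral>v. K.edge_prod es (w, u, v) \<partial>seq_I01) \<partial>seq_I01)" .
  qed
  finally show ?thesis by (simp add: edge_moment_iterated[OF spin])
qed

end

section \<open>Comparison of two invariant spin functions\<close>

lemma cavity_invariant_edge_moment:
  assumes summable: "(\<lambda>p. 2 ^ p * (\<beta> p)\<^sup>2) summable_on spin_degrees"
    and spin: "spin_function \<sigma>" and inv: "cavity_invariant \<beta> \<sigma>"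
  obtains \<Omega> :: "(nat \<Rightarrow> real) measure" and g where "cavity_field \<beta> \<sigma> \<Omega> g"
    and "\<And>n q es. \<lbrakk>1 \<le> n; 1 \<le> q; distinct es; \<And>i l. (i, l) \<in> set es \<Longrightarrow> i < n \<and> l < q\<rbrakk> \<Longrightarrow>
      spin_edge_moment \<sigma> es =
      (\<integral>s. cavity_field.law_functional q (\<lambda>l. {i. (i, l) \<in> set es}) s \<partial>cavity_field.mean_truncated_law \<beta> \<sigma> \<Omega> g n)"
proof -
  from inv obtain \<Omega> :: "(nat \<Rightarrow> real) measure" and g where fields: "gaussian_fields \<beta> \<sigma> \<Omega> g"
    and eq: "\<And>n r m q C. 1 \<le> m \<Longrightarrow> 1 \<le> q \<Longrightarrow> n \<le> m \<Longrightarrow> (\<forall>l<q. C l \<subseteq> {..<m}) \<Longrightarrow>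
           E_outer \<Omega> (\<lambda>w v \<omega>. \<Prod>l<q. E_prime (\<lambda>u z z'. \<Prod>i\<in>C l. mag \<sigma> w u (v i))) =
           E_outer \<Omega> (\<lambda>w v \<omega>. (\<Prod>l<q. cavity_U \<beta> \<sigma> g n r (C l) w v \<omega>) / cavity_V \<beta> \<sigma> g n r w \<omega> ^ q)"
    unfolding cavity_invariant_def by blast
  interpret F: cavity_field \<beta> \<sigma> \<Omega> g using summable spin fields by unfold_locales
  show thesis
  proof (rule that[OF F.cavity_field_axioms])
    fix n q :: nat and es :: "(nat \<times> nat) list"
    assume n: "1 \<le> n" "1 \<le> q" and es: "distinct es" "\<And>i l. (i, l) \<in> set es \<Longrightarrow> i < n \<and> l < q"
    let ?C = "\<lambda>l. {i. (i, l) \<in> set es}"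
    have C: "?C l \<subseteq> {..<n}" for l using es(2) by auto
    have "spin_edge_moment \<sigma> es = E_outer \<Omega> (\<lambda>w v \<omega>. \<Prod>l<q. E_prime (\<lambda>u z z'. \<Prod>i\<in>?C l. mag \<sigma> w u (v i)))"
      using es by (intro F.cavity_lhs[symmetric]) auto
    also have "\<dots> = E_outer \<Omega> (\<lambda>w v \<omega>. (\<Prod>l<q. cavity_U \<beta> \<sigma> g n 0 (?C l) w v \<omega>) / cavity_V \<beta> \<sigma> g n 0 w \<omega> ^ q)"
      using n C by (intro eq[of n q n ?C 0]) auto
    also have "\<dots> = (\<integral>s. F.law_functional q ?C s \<partial>F.mean_truncated_law n)"
      by (rule F.cavity_rhs[OF C])
    finally show "spin_edge_moment \<sigma> es = (\<integral>s. F.law_functional q ?C s \<partial>F.mean_truncated_law n)" .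
  qed
qed

theorem cavity_invariant_spin_law_cong:
  assumes summable: "(\<lambda>p. 2 ^ p * (\<beta> p)\<^sup>2) summable_on spin_degrees"
    and spin: "spin_function \<sigma>" "spin_function \<sigma>'"
    and inv: "cavity_invariant \<beta> \<sigma>" "cavity_invariant \<beta> \<sigma>'"
    and law: "overlap_law \<sigma> = overlap_law \<sigma>'"
  shows "spin_law \<sigma> = spin_law \<sigma>'"
proof (rule spin_law_eqI[OF spin])
  fix es :: "(nat \<times> nat) list" assume es: "distinct es"
  obtain n where n: "\<And>i. i \<in> fst ` set es \<Longrightarrow> i < n" using finite_nat_set_iff_bounded[of "fst ` set es"] by auto
  obtain q where q: "\<And>l. l \<in> snd ` set es \<Longrightarrow> l < q" using finite_nat_set_iff_bounded[of "snd ` set es"] by auto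
  \<comment> \<open>The successors ensure at least one site and one replica also for the empty edge
    list.\<close>
  have bounds: "1 \<le> Suc n" "1 \<le> Suc q" "\<And>i l. (i, l) \<in> set es \<Longrightarrow> i < Suc n \<and> l < Suc q"
    using n q by (force intro: less_SucI)+
  obtain \<Omega> :: "(nat \<Rightarrow> real) measure" and g where X: "cavity_field \<beta> \<sigma> \<Omega> g"
    and eqX: "\<And>n q es. \<lbrakk>1 \<le> n; 1 \<le> q; distinct es; \<And>i l. (i, l) \<in> set es \<Longrightarrow> i < n \<and> l < q\<rbrakk> \<Longrightarrow>
      spin_edge_moment \<sigma> es =
      (\<integral>s. cavity_field.law_functional q (\<lambda>l. {i. (i, l) \<in> set es}) s \<partial>cavity_field.mean_truncated_law \<beta> \<sigma> \<Omega> g n)"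
    by (rule cavity_invariant_edge_moment[OF summable spin(1) inv(1)]) blast
  obtain \<Omega>' :: "(nat \<Rightarrow> real) measure" and g' where Y: "cavity_field \<beta> \<sigma>' \<Omega>' g'"
    and eqY: "\<And>n q es. \<lbrakk>1 \<le> n; 1 \<le> q; distinct es; \<And>i l. (i, l) \<in> set es \<Longrightarrow> i < n \<and> l < q\<rbrakk> \<Longrightarrow>
      spin_edge_moment \<sigma>' es =
      (\<integral>s. cavity_field.law_functional q (\<lambda>l. {i. (i, l) \<in> set es}) s \<partial>cavity_field.mean_truncated_law \<beta> \<sigma>' \<Omega>' g' n)"
    by (rule cavity_invariant_edge_moment[OF summable spin(2) inv(2)]) blast
  show "spin_edge_moment \<sigma> es = spin_edge_moment \<sigma>' es"
    using eqX[OF bounds(1,2) es bounds(3)] eqY[OF bounds(1,2) es bounds(3)] mean_truncated_law_cong[OF X Y law] by simp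
qed

theorem theorem5:
  fixes \<beta> :: "nat \<Rightarrow> real"
    and \<mu> \<mu>' :: "(nat \<times> nat \<Rightarrow> real) measure"
    and \<sigma> \<sigma>' :: "real \<Rightarrow> real \<Rightarrow> real \<Rightarrow> real \<Rightarrow> real"
  assumes "(\<lambda>p. 2 ^ p * (\<beta> p)\<^sup>2) summable_on spin_degrees"
    and "\<mu> \<in> M_inv \<beta>" and "\<mu>' \<in> M_inv \<beta>"
    and "generates \<sigma> \<mu>" and "generates \<sigma>' \<mu>'"
    and "overlap_law \<sigma> = overlap_law \<sigma>'"
  shows "\<mu> = \<mu>' \<and> multi_overlap_law \<sigma> = multi_overlap_law \<sigma>'"
proof -
  \<comment> \<open>The spin functions \<tau>, \<tau>' satisfy the invariance equations, while
    \<sigma>, \<sigma>' are the given generators of the same laws.\<close>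
  from assms(2,3) obtain \<tau> \<tau>' where \<tau>: "spin_function \<tau>" "\<mu> = spin_law \<tau>" "cavity_invariant \<beta> \<tau>"
    and \<tau>': "spin_function \<tau>'" "\<mu>' = spin_law \<tau>'" "cavity_invariant \<beta> \<tau>'"
    by (auto simp: M_inv_def generates_def)
  from assms(4,5) have \<sigma>: "spin_function \<sigma>" "\<mu> = spin_law \<sigma>" and \<sigma>': "spin_function \<sigma>'" "\<mu>' = spin_law \<sigma>'"
    by (auto simp: generates_def)
  \<comment> \<open>The overlap law depends only on the array law, so the assumption on \<sigma>,
    \<sigma>' carries over to \<tau>, \<tau>'.\<close>
  have "overlap_law \<tau> = overlap_law \<tau>'"
    using overlap_law_cong[OF \<tau>(1) \<sigma>(1)] overlap_law_cong[OF \<tau>'(1) \<sigma>'(1)] assms(6) \<tau>(2) \<tau>'(2) \<sigma>(2) \<sigma>'(2) by simp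
  from cavity_invariant_spin_law_cong[OF assms(1) \<tau>(1) \<tau>'(1) \<tau>(3) \<tau>'(3) this]
  have "\<mu> = \<mu>'" using \<tau>(2) \<tau>'(2) by simp
  then show ?thesis using multi_overlap_law_cong[OF \<sigma>(1) \<sigma>'(1)] \<sigma>(2) \<sigma>'(2) by simp
qed

end
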